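(* Let $M$ be a complete, oriented, minimal submanifold of $\mathbb{R}^{k}$, of dimension $m$, and suppose that its Gauss map $M \to \widetilde{G}_{m,k-m}$ is a bounded embedding. Then $\mathrm{Ric} < 0$ and $$\sup \mathrm{Ric} = 0 .$$
   Context: $M$ carries the Riemannian metric induced from $\mathbb{R}^k$, and completeness refers to this metric. $\mathrm{Ric}$ is the Ricci curvature of $M$. $\mathrm{Ric}<0$ means $\mathrm{Ric}(X,X)<0$ for every nonzero tangent vector $X$ of $M$, and $\sup \mathrm{Ric}$ is the supremum of $\mathrm{Ric}(X,X)$ over all unit tangent vectors $X$ of $M$. $\widetilde{G}_{m,n}$ is the oriented Grassmannian of oriented $m$-planes (through the origin) in $\mathbb{R}^{m+n}$. The (first) Gauss map sends $p\in M$ to the oriented $m$-plane $T_pM$, translated to the origin. The canonical Riemannian metric $g_c$ on $\widetilde{G}_{m,n}$ is determined as follows. For $P,Q\in\widetilde{G}_{m,n}$ with oriented orthonormal bases $\xi_1,\dots,\xi_m$ of $P$ and $\zeta_1,\dots,\zeta_m$ of $Q$, let $\alpha_{ij}=\langle \xi_i,\zeta_j\rangle$ and let $\lambda_1^2,\dots,\lambda_m^2$ (with $0\le\lambda_i\le 1$) be the eigenvalues of $\alpha\alpha^{T}$. Put $d_c(P,Q)=\sqrt{\sum_{i=1}^m \arccos^2\lambda_i}$. Then $g_c(X,X)=\left(\frac{d}{dt}\big|_{t=0^+} d_c(x(0),x(t))\right)^2$ for any smooth path $x(t)$ in $\widetilde{G}_{m,n}$ with $\dot x(0)=X$. A bounded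 embedding into $\widetilde{G}_{m,n}$ is a smooth embedding whose image $\mathcal{I}$ is bounded with respect to the metric on $\mathcal{I}$ induced from the canonical metric $g_c$. That is, with the Riemannian metric on the submanifold $\mathcal{I}$ obtained by restricting $g_c$, the distance between two points of $\mathcal{I}$, defined as the infimum of the lengths of piecewise smooth curves lying in $\mathcal{I}$ joining them, is bounded by a finite constant independent of the two points. *)

theory Defs
  imports "HOL-Analysis.Analysis"
begin

section \<open>Smooth maps between Euclidean spaces\<close>

text \<open>Both notions are meant for open sets \<open>S\<close> only.\<close>

primrec Ck_on :: "nat \<Rightarrow> 'a::euclidean_space set \<Rightarrow> ('a \<Rightarrow> 'b::euclidean_space) \<Rightarrow> bool" where
  "Ck_on 0 S f \<longleftrightarrow> continuous_on S f"
| "Ck_on (Suc n) S f \<longleftrightarrow>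
     (\<forall>x\<in>S. f differentiable (at x)) \<and> (\<forall>v. Ck_on n S (\<lambda>x. frechet_derivative f (at x) v))"

definition smooth_on :: "'a::euclidean_space set \<Rightarrow> ('a \<Rightarrow> 'b::euclidean_space) \<Rightarrow> bool" where
  "smooth_on S f \<longleftrightarrow> (\<forall>n. Ck_on n S f)"

section \<open>Oriented smooth manifolds\<close>

text \<open>An atlas is a set of parametrizations \<open>(V, x)\<close>, where \<open>x\<close> maps the open set \<open>V\<close> of the
  Euclidean space of dimension \<open>m = CARD('m)\<close> homeomorphically onto an open subset of \<open>M\<close>. The set
  \<open>M\<close> carries the subspace topology of the type \<open>'p\<close>. An orientation is an atlas all of whose
  parameter changes have positive Jacobian determinant.\<close>

type_synonym ('p, 'm) atlas = "((real^'m) set \<times> (real^'m \<Rightarrow> 'p)) set"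

definition oriented_smooth_manifold ::
    "'p::{second_countable_topology, t2_space} set \<Rightarrow> ('p, 'm::finite) atlas \<Rightarrow> bool" where
  "oriented_smooth_manifold M A \<longleftrightarrow>
     (\<forall>(V, x)\<in>A. open V \<and> openin (top_of_set M) (x ` V) \<and> (\<exists>y. homeomorphism V (x ` V) x y)) \<and>
     (\<Union>(V, x)\<in>A. x ` V) = M \<and>
     (\<forall>(V, x)\<in>A. \<forall>(W, y)\<in>A.
        let D = {u \<in> V. x u \<in> y ` W}; \<tau> = (\<lambda>u. the_inv_into W y (x u))
        in smooth_on D \<tau> \<and> (\<forall>u\<in>D. det (matrix (frechet_derivative \<tau> (at u))) > 0))"

text \<open>Immersions and embeddings into a Euclidean space. They are also used for maps into a
  submanifold \<open>G\<close> of a Euclidean space, such a map being smooth (an immersion, an embedding) iff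
  it is so as a map into the ambient space.\<close>

definition immersion :: "('p, 'm::finite) atlas \<Rightarrow> ('p \<Rightarrow> 'e::euclidean_space) \<Rightarrow> bool" where
  "immersion A F \<longleftrightarrow>
     (\<forall>(V, x)\<in>A. smooth_on V (F \<circ> x) \<and> (\<forall>u\<in>V. inj (frechet_derivative (F \<circ> x) (at u))))"

definition smooth_embedding ::
    "'p::topological_space set \<Rightarrow> ('p, 'm::finite) atlas \<Rightarrow> 'e set \<Rightarrow> ('p \<Rightarrow> 'e::euclidean_space) \<Rightarrow> bool"
  where
  "smooth_embedding M A G F \<longleftrightarrow>
     F ` M \<subseteq> G \<and> immersion A F \<and> (\<exists>h. homeomorphism M (F ` M) F h)"

section \<open>Smooth and piecewise smooth curves\<close>

text \<open>A curve is smooth on a closed interval if it extends smoothly to an open neighbourhood.\<close>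

definition smooth_curve_manifold ::
    "'p::topological_space set \<Rightarrow> ('p, 'm::finite) atlas \<Rightarrow> (real \<Rightarrow> 'p) \<Rightarrow> real \<Rightarrow> real \<Rightarrow> bool" where
  "smooth_curve_manifold M A c a b \<longleftrightarrow>
     (\<exists>T c'. open T \<and> {a..b} \<subseteq> T \<and> continuous_on T c' \<and> c' ` T \<subseteq> M \<and>
        (\<forall>(V, x)\<in>A. smooth_on {t \<in> T. c' t \<in> x ` V} (\<lambda>t. the_inv_into V x (c' t))) \<and>
        (\<forall>t\<in>{a..b}. c' t = c t))"

definition smooth_curve_in ::
    "'e::euclidean_space set \<Rightarrow> (real \<Rightarrow> 'e) \<Rightarrow> real \<Rightarrow> real \<Rightarrow> bool" where
  "smooth_curve_in S c a b \<longleftrightarrow>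
     c ` {a..b} \<subseteq> S \<and>
     (\<exists>T c'. open T \<and> {a..b} \<subseteq> T \<and> smooth_on T c' \<and> (\<forall>t\<in>{a..b}. c' t = c t))"

text \<open>\<open>piecewise Q\<close> holds for a curve on \<open>{0..1}\<close> if \<open>Q\<close> holds on the closed intervals of some
  subdivision; in particular the curve is continuous if \<open>Q\<close> entails continuity.\<close>

definition piecewise :: "(real \<Rightarrow> real \<Rightarrow> bool) \<Rightarrow> bool" where
  "piecewise Q \<longleftrightarrow>
     (\<exists>(n::nat) \<tau>. \<tau> 0 = 0 \<and> \<tau> n = 1 \<and> (\<forall>i<n. \<tau> i < \<tau> (Suc i) \<and> Q (\<tau> i) (\<tau> (Suc i))))"

section \<open>Riemannian geometry of an immersed submanifold\<close>

text \<open>\<open>f\<close> is the immersion of \<open>M\<close> into the Euclidean space, and \<open>M\<close> carries the induced metric. Thus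
  tangent vectors of \<open>M\<close> at \<open>p\<close> are identified with vectors of the Euclidean space.\<close>

definition tangent_space ::
    "('p, 'm::finite) atlas \<Rightarrow> ('p \<Rightarrow> 'e::euclidean_space) \<Rightarrow> 'p \<Rightarrow> 'e set" where
  "tangent_space A f p =
     {X. \<exists>(V, x)\<in>A. \<exists>u\<in>V. x u = p \<and> X \<in> range (frechet_derivative (f \<circ> x) (at u))}"

definition curve_length :: "('p \<Rightarrow> 'e::euclidean_space) \<Rightarrow> (real \<Rightarrow> 'p) \<Rightarrow> real" where
  "curve_length f c = integral {0..1} (\<lambda>t. norm (vector_derivative (f \<circ> c) (at t)))"

definition riemannian_dist ::
    "'p::topological_space set \<Rightarrow> ('p, 'm::finite) atlas \<Rightarrow> ('p \<Rightarrow> 'e::euclidean_space)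
      \<Rightarrow> 'p \<Rightarrow> 'p \<Rightarrow> ereal" where
  "riemannian_dist M A f p q =
     Inf {ereal (curve_length f c) | c. piecewise (smooth_curve_manifold M A c) \<and> c 0 = p \<and> c 1 = q}"

definition complete_submanifold ::
    "'p::topological_space set \<Rightarrow> ('p, 'm::finite) atlas \<Rightarrow> ('p \<Rightarrow> 'e::euclidean_space) \<Rightarrow> bool" where
  "complete_submanifold M A f \<longleftrightarrow>
     (\<forall>s :: nat \<Rightarrow> 'p.
        range s \<subseteq> M \<and>
        (\<forall>\<epsilon>>0. \<exists>N. \<forall>i\<ge>N. \<forall>j\<ge>N. riemannian_dist M A f (s i) (s j) < ereal \<epsilon>) \<longrightarrow>
        (\<exists>l\<in>M. (\<lambda>n. riemannian_dist M A f (s n) l) \<longlonglongrightarrow> 0))"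

subsection \<open>Local formulas in a parametrization\<close>

definition pderiv_at :: "'m::finite \<Rightarrow> (real^'m \<Rightarrow> 'e::euclidean_space) \<Rightarrow> real^'m \<Rightarrow> 'e" where
  "pderiv_at i h u = frechet_derivative h (at u) (axis i 1)"

definition induced_metric :: "(real^'m::finite \<Rightarrow> 'e::euclidean_space) \<Rightarrow> real^'m \<Rightarrow> real^'m^'m" where
  "induced_metric F u = (\<chi> i j. pderiv_at i F u \<bullet> pderiv_at j F u)"

definition normal_component :: "'e::euclidean_space set \<Rightarrow> 'e \<Rightarrow> 'e" where
  "normal_component T z = (THE n. z - n \<in> T \<and> (\<forall>X\<in>T. n \<bullet> X = 0))"

definition second_fundamental_form ::
    "(real^'m::finite \<Rightarrow> 'e::euclidean_space) \<Rightarrow> real^'m \<Rightarrow> 'm \<Rightarrow> 'm \<Rightarrow> 'e" where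
  "second_fundamental_form F u i j =
     normal_component (range (frechet_derivative F (at u))) (pderiv_at i (pderiv_at j F) u)"

definition mean_curvature :: "(real^'m::finite \<Rightarrow> 'e::euclidean_space) \<Rightarrow> real^'m \<Rightarrow> 'e" where
  "mean_curvature F u =
     (1 / real CARD('m)) *\<^sub>R
       (\<Sum>i\<in>UNIV. \<Sum>j\<in>UNIV. matrix_inv (induced_metric F u) $ i $ j *\<^sub>R second_fundamental_form F u i j)"

definition minimal_submanifold ::
    "('p, 'm::finite) atlas \<Rightarrow> ('p \<Rightarrow> 'e::euclidean_space) \<Rightarrow> bool" where
  "minimal_submanifold A f \<longleftrightarrow> (\<forall>(V, x)\<in>A. \<forall>u\<in>V. mean_curvature (f \<circ> x) u = 0)"

text \<open>\<open>christoffel g u l i j\<close> is the symbol with upper index \<open>l\<close> and lower indices \<open>i j\<close> of the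
  Levi-Civita connection of \<open>g\<close>. The sign of the Ricci tensor is the one that is positive on round
  spheres.\<close>

definition christoffel ::
    "(real^'m::finite \<Rightarrow> real^'m^'m) \<Rightarrow> real^'m \<Rightarrow> 'm \<Rightarrow> 'm \<Rightarrow> 'm \<Rightarrow> real" where
  "christoffel g u l i j =
     (1/2) * (\<Sum>s\<in>UNIV. matrix_inv (g u) $ l $ s *
       (pderiv_at i (\<lambda>y. g y $ j $ s) u + pderiv_at j (\<lambda>y. g y $ i $ s) u - pderiv_at s (\<lambda>y. g y $ i $ j) u))"

definition ricci_coeff ::
    "(real^'m::finite \<Rightarrow> real^'m^'m) \<Rightarrow> real^'m \<Rightarrow> 'm \<Rightarrow> 'm \<Rightarrow> real" where
  "ricci_coeff g u i j =
     (\<Sum>l\<in>UNIV. pderiv_at l (\<lambda>y. christoffel g y l i j) u - pderiv_at j (\<lambda>y. christoffel g y l i l) u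
       + (\<Sum>s\<in>UNIV. christoffel g u l l s * christoffel g u s i j
                   - christoffel g u l j s * christoffel g u s i l))"

subsection \<open>The Ricci curvature of an immersed submanifold\<close>

definition Ric ::
    "('p, 'm::finite) atlas \<Rightarrow> ('p \<Rightarrow> 'e::euclidean_space) \<Rightarrow> 'p \<Rightarrow> 'e \<Rightarrow> 'e \<Rightarrow> real" where
  "Ric A f p X Y = (THE r. \<exists>(V, x)\<in>A. \<exists>u\<in>V. \<exists>v w. x u = p \<and>
     frechet_derivative (f \<circ> x) (at u) v = X \<and> frechet_derivative (f \<circ> x) (at u) w = Y \<and>
     r = (\<Sum>i\<in>UNIV. \<Sum>j\<in>UNIV. ricci_coeff (induced_metric (f \<circ> x)) u i j * v $ i * w $ j))"

section \<open>The oriented Grassmannian\<close>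

text \<open>An \<open>m\<close>-tuple of vectors is a matrix with rows \<open>\<xi> $ i\<close>. The oriented plane with oriented
  orthonormal basis \<open>\<xi>\<close> is represented by the \<open>m\<close>-vector \<open>\<xi>\<^sub>1 \<and> \<dots> \<and> \<xi>\<^sub>m\<close>, given by its Pluecker
  coordinates, that is, all \<open>m \<times> m\<close> minors of \<open>\<xi>\<close> (indexed by arbitrary, not only increasing, choices
  of columns). The oriented Grassmannian is thereby a compact submanifold of a Euclidean space. The
  lemma \<open>wedge_eq_iff\<close> below says that two orthonormal bases represent the same point iff they are
  oriented bases of the same oriented plane.\<close>

definition wedge :: "real^'k^'m \<Rightarrow> (real, 'm::finite \<Rightarrow> 'k::finite) vec" where
  "wedge \<xi> = (\<chi> I. det (\<chi> i j. \<xi> $ i $ I j))"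

definition orthonormal_frame :: "real^'k::finite^'m::finite \<Rightarrow> bool" where
  "orthonormal_frame \<xi> \<longleftrightarrow> (\<forall>i j. \<xi> $ i \<bullet> \<xi> $ j = (if i = j then 1 else 0))"

definition oriented_grassmannian :: "(real, 'm::finite \<Rightarrow> 'k::finite) vec set" where
  "oriented_grassmannian = wedge ` Collect orthonormal_frame"

definition oriented_basis :: "(real, 'm::finite \<Rightarrow> 'k::finite) vec \<Rightarrow> real^'k^'m \<Rightarrow> bool" where
  "oriented_basis P \<xi> \<longleftrightarrow> orthonormal_frame \<xi> \<and> wedge \<xi> = P"

lemma wedge_matrix_mult:
  fixes R :: "real^'m^'m" and \<xi> :: "real^'k^'m"
  shows "wedge (R ** \<xi>) = det R *\<^sub>R wedge \<xi>"
proof -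
  have "(\<chi> i j. (R ** \<xi>) $ i $ I j) = R ** (\<chi> i j. \<xi> $ i $ I j)" for I :: "'m \<Rightarrow> 'k"
    by (simp add: matrix_matrix_mult_def vec_eq_iff)
  then have "det (\<chi> i j. (R ** \<xi>) $ i $ I j) = det R * det (\<chi> i j. \<xi> $ i $ I j)"
    for I :: "'m \<Rightarrow> 'k"
    by (simp only: det_mul)
  then show ?thesis
    by (simp add: wedge_def vec_eq_iff)
qed

lemma det_inner_wedge:
  fixes \<eta> \<xi> :: "real^'k^'m"
  shows "det (\<chi> j i. \<eta> $ j \<bullet> \<xi> $ i) = (\<Sum>I\<in>UNIV. (\<Prod>j\<in>UNIV. \<eta> $ j $ I j) * wedge \<xi> $ I)"
proof -
  let ?S = "{p. p permutes (UNIV :: 'm set)}"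
  have wedge: "wedge \<xi> $ I = (\<Sum>p\<in>?S. of_int (sign p) * (\<Prod>j\<in>UNIV. \<xi> $ p j $ I j))" for I
  proof -
    have "wedge \<xi> $ I = det (transpose (\<chi> i j. \<xi> $ i $ I j))"
      by (simp only: wedge_def det_transpose) simp
    then show ?thesis by (simp add: det_def transpose_def)
  qed
  have "det (\<chi> j i. \<eta> $ j \<bullet> \<xi> $ i) =
      (\<Sum>p\<in>?S. of_int (sign p) * (\<Prod>j\<in>UNIV. \<Sum>k\<in>UNIV. \<eta> $ j $ k * \<xi> $ p j $ k))"
    by (simp add: det_def inner_vec_def)
  also have "\<dots> = (\<Sum>p\<in>?S. \<Sum>I\<in>UNIV. of_int (sign p) *
      ((\<Prod>j\<in>UNIV. \<eta> $ j $ I j) * (\<Prod>j\<in>UNIV. \<xi> $ p j $ I j)))"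
    by (simp add: prod_sum_PiE PiE_UNIV_domain prod.distrib sum_distrib_left)
  also have "\<dots> = (\<Sum>I\<in>UNIV. (\<Prod>j\<in>UNIV. \<eta> $ j $ I j) * wedge \<xi> $ I)"
    by (subst sum.swap) (simp add: wedge sum_distrib_left mult_ac)
  finally show ?thesis .
qed

lemma wedge_eq_iff:
  fixes \<xi> \<zeta> :: "real^'k^'m"
  assumes "orthonormal_frame \<xi>" "orthonormal_frame \<zeta>"
  shows "wedge \<xi> = wedge \<zeta> \<longleftrightarrow> (\<exists>R. orthogonal_matrix R \<and> det R = 1 \<and> \<xi> = R ** \<zeta>)"
proof
  assume "\<exists>R. orthogonal_matrix R \<and> det R = 1 \<and> \<xi> = R ** \<zeta>"
  then show "wedge \<xi> = wedge \<zeta>" by (auto simp: wedge_matrix_mult)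
next
  assume eq: "wedge \<xi> = wedge \<zeta>"
  have on: "\<xi> $ i \<bullet> \<xi> $ j = (if i = j then 1 else 0)" "\<zeta> $ i \<bullet> \<zeta> $ j = (if i = j then 1 else 0)" for i j
    using assms by (auto simp: orthonormal_frame_def)
  have dets: "det (\<chi> j i. \<eta> $ j \<bullet> \<xi> $ i) = det (\<chi> j i. \<eta> $ j \<bullet> \<zeta> $ i)" for \<eta>
    by (simp add: det_inner_wedge eq)
  have perp: "v \<bullet> \<xi> $ i = 0" if v: "\<And>j. v \<bullet> \<zeta> $ j = 0" for v i
  proof -
    define \<eta> where "\<eta> = (\<chi> j. if j = i then v else \<xi> $ j)"
    have "row i (\<chi> j i. \<eta> $ j \<bullet> \<zeta> $ i) = 0"
      by (simp add: row_def \<eta>_def v vec_eq_iff)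
    then have 0: "det (\<chi> j i. \<eta> $ j \<bullet> \<xi> $ i) = 0"
      unfolding dets using det_zero_row(2) by blast
    have "(\<chi> j l. \<eta> $ j \<bullet> \<xi> $ l) =
        (\<chi> j. if j = i then (\<Sum>l\<in>UNIV. (v \<bullet> \<xi> $ l) *s row l (mat 1 :: real^'m^'m)) else row j (mat 1))"
      by (simp add: vec_eq_iff \<eta>_def row_def mat_def on sum_component if_distrib cong: if_cong)
    then have "det (\<chi> j l. \<eta> $ j \<bullet> \<xi> $ l) = (v \<bullet> \<xi> $ i) * det (mat 1 :: real^'m^'m)"
      using cramer_lemma_transpose[of i "\<chi> l. v \<bullet> \<xi> $ l" "mat 1 :: real^'m^'m"]
      by (simp cong: if_cong)
    then show ?thesis using 0 by simp
  qed
  define R where "R = (\<chi> i j. \<xi> $ i \<bullet> \<zeta> $ j)"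
  have \<xi>: "\<xi> $ i = (\<Sum>j\<in>UNIV. R $ i $ j *\<^sub>R \<zeta> $ j)" for i
  proof -
    define v where "v = \<xi> $ i - (\<Sum>j\<in>UNIV. R $ i $ j *\<^sub>R \<zeta> $ j)"
    have v: "v \<bullet> \<zeta> $ j = 0" for j
      by (simp add: v_def R_def inner_diff_left inner_sum_left on if_distrib cong: if_cong)
    have "v \<bullet> v = v \<bullet> \<xi> $ i - (\<Sum>j\<in>UNIV. R $ i $ j * (v \<bullet> \<zeta> $ j))"
      by (subst (2) v_def) (simp add: inner_diff_right inner_sum_right)
    then have "v \<bullet> v = 0" by (simp add: v perp)
    then show ?thesis by (simp add: v_def)
  qed
  have RZ: "\<xi> = R ** \<zeta>"
    by (simp add: vec_eq_iff matrix_matrix_mult_def \<xi> sum_component)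
  have "(\<Sum>l\<in>UNIV. R $ i $ l * R $ j $ l) = (if i = j then 1 else 0)" for i j
  proof -
    have "\<xi> $ i \<bullet> \<xi> $ j = (\<Sum>l\<in>UNIV. R $ j $ l * (\<xi> $ i \<bullet> \<zeta> $ l))"
      by (subst (2) \<xi>) (simp add: inner_sum_right)
    then show ?thesis using on(1)[of i j] by (simp add: R_def mult.commute)
  qed
  then have "R ** transpose R = mat 1"
    by (simp add: vec_eq_iff matrix_matrix_mult_def transpose_def mat_def)
  then have orth: "orthogonal_matrix R"
    by (simp add: orthogonal_matrix_def matrix_left_right_inverse)
  have "det R = det (\<chi> j i. \<xi> $ j \<bullet> \<xi> $ i)"
    by (simp add: dets R_def)
  also have "(\<chi> j i. \<xi> $ j \<bullet> \<xi> $ i) = (mat 1 :: real^'m^'m)"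
    by (simp add: on mat_def vec_eq_iff)
  finally show "\<exists>R. orthogonal_matrix R \<and> det R = 1 \<and> \<xi> = R ** \<zeta>"
    using orth RZ by auto
qed

subsection \<open>The canonical metric\<close>

text \<open>The last conjunct below says that the \<open>(l $ i)\<^sup>2\<close> are the eigenvalues of the matrix
  \<open>\<alpha> ** transpose \<alpha>\<close>, listed with multiplicity.\<close>

definition dist_c :: "(real, 'm::finite \<Rightarrow> 'k::finite) vec \<Rightarrow> (real, 'm \<Rightarrow> 'k) vec \<Rightarrow> real" where
  "dist_c P Q = (THE d. \<exists>(\<xi> :: real^'k^'m) (\<zeta> :: real^'k^'m) (l :: real^'m).
     oriented_basis P \<xi> \<and> oriented_basis Q \<zeta> \<and> d = sqrt (\<Sum>i\<in>UNIV. (arccos (l $ i))\<^sup>2) \<and>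
     (\<forall>i. 0 \<le> l $ i \<and> l $ i \<le> 1) \<and>
     (let \<alpha> = (\<chi> i j. \<xi> $ i \<bullet> \<zeta> $ j) :: real^'m^'m
      in \<forall>s. det (mat s - \<alpha> ** transpose \<alpha>) = (\<Prod>i\<in>UNIV. s - (l $ i)\<^sup>2)))"

text \<open>\<open>metric_c P X\<close> is the value \<open>g\<^sub>c(X, X)\<close> for a tangent vector \<open>X\<close> of the Grassmannian at \<open>P\<close>.\<close>

definition metric_c :: "(real, 'm::finite \<Rightarrow> 'k::finite) vec \<Rightarrow> (real, 'm \<Rightarrow> 'k) vec \<Rightarrow> real" where
  "metric_c P X = (THE q. \<exists>T x. open T \<and> 0 \<in> T \<and> smooth_on T x \<and> x ` T \<subseteq> oriented_grassmannian \<and>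
     x 0 = P \<and> vector_derivative x (at 0) = X \<and>
     q = (vector_derivative (\<lambda>t. dist_c (x 0) (x t)) (at_right 0))\<^sup>2)"

definition length_c :: "(real \<Rightarrow> (real, 'm::finite \<Rightarrow> 'k::finite) vec) \<Rightarrow> real" where
  "length_c c = integral {0..1} (\<lambda>t. sqrt (metric_c (c t) (vector_derivative c (at t))))"

definition dist_c_on ::
    "(real, 'm::finite \<Rightarrow> 'k::finite) vec set \<Rightarrow> (real, 'm \<Rightarrow> 'k) vec \<Rightarrow> (real, 'm \<Rightarrow> 'k) vec \<Rightarrow> ereal"
  where
  "dist_c_on S P Q =
     Inf {ereal (length_c c) | c. piecewise (smooth_curve_in S c) \<and> c 0 = P \<and> c 1 = Q}"

definition bounded_embedding ::
    "'p::topological_space set \<Rightarrow> ('p, 'm::finite) atlas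
      \<Rightarrow> ('p \<Rightarrow> (real, 'm \<Rightarrow> 'k::finite) vec) \<Rightarrow> bool" where
  "bounded_embedding M A F \<longleftrightarrow>
     smooth_embedding M A oriented_grassmannian F \<and>
     (\<exists>C::real. \<forall>P\<in>F ` M. \<forall>Q\<in>F ` M. dist_c_on (F ` M) P Q \<le> ereal C)"

section \<open>The Gauss map\<close>

text \<open>The orientation of \<open>T\<^sub>pM\<close> is the one induced by the (oriented) atlas.\<close>

definition gauss_map ::
    "('p, 'm::finite) atlas \<Rightarrow> ('p \<Rightarrow> real^'k::finite) \<Rightarrow> 'p \<Rightarrow> (real, 'm \<Rightarrow> 'k) vec" where
  "gauss_map A f p = (THE P. \<exists>(V, x)\<in>A. \<exists>u\<in>V. \<exists>v :: real^'m^'m. x u = p \<and> det v > 0 \<and>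
     oriented_basis P (\<chi> i. frechet_derivative (f \<circ> x) (at u) (v $ i)))"

end

theory Submission
  imports Defs
begin

text \<open>
  The heart of the matter is Obata's identity (\<open>ricci_gauss_map\<close>): the Gauss map of a
  minimal submanifold pulls the canonical metric of the Grassmannian back to minus the Ricci
  tensor. If the Gauss map is an immersion, this pulled back tensor is positive definite, and the
  Ricci curvature is negative. Suppose that its supremum over unit vectors is also negative, say
  \<open>- \<epsilon>\<close>. Then the Gauss map stretches lengths at least by the factor
  \<open>sqrt \<epsilon>\<close>, so curves in the Gauss image pull back to curves of bounded
  length in \<open>M\<close> (\<open>gauss_curve\<close>), and \<open>M\<close> has finite
  diameter. A complete manifold of finite diameter is compact
  (\<open>compact_if_complete_bounded\<close>). But no minimal submanifold of a Euclidean space is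
  compact (\<open>minimal_submanifold_not_compact\<close>), because the Laplacian of the squared
  norm of the position vector is a positive constant, and this function would attain its maximum.

  Obata's identity compares two computations in a chart \<open>\<Phi>\<close>. On the one hand,
  the Gauss equation (\<open>gauss_equation_ricci\<close>) expresses the Ricci tensor by the
  second fundamental form, and minimality leaves only the negative trace of its square. On the
  other hand, the Gauss map is the normalized Pluecker vector of the coordinate frame. When the
  point moves, the tangential part of the motion of an orthonormal frame only rescales this
  vector, while the normal parts change one row each and contribute orthogonally
  (\<open>norm_wedge_velocity\<close>). The squared speed of the Gauss map is therefore the same
  trace.

  This uses that the canonical metric is, up to the constant factor \<open>m!\<close>, the
  Euclidean metric of Pluecker vectors (\<open>metric_c_velocity\<close>). If two planes make the
  angles \<open>\<theta>\<^sub>i\<close>, the inner product of their Pluecker vectors is, up to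
  sign, \<open>m!\<close> times the product of the \<open>cos \<theta>\<^sub>i\<close>. For
  nearby planes, \<open>- 2 * ln (cos \<theta>)\<close> is asymptotic to the square of
  \<open>\<theta>\<close>, so the sum of the squared angles is asymptotic to the squared Euclidean
  distance divided by \<open>m!\<close>. The right derivative of the distance along a path is thus
  determined by the velocity alone. That the distance is well defined rests on the spectral
  theorem for symmetric matrices.

  Compactness is proved without geodesics. If \<open>M\<close> were not compact, the largest
  radius of a relatively compact ball would be finite at each point, and within this radius there
  would be a point where it is at most half as large; iteration gives a Cauchy sequence that
  cannot converge.
\<close>

abbreviation fderiv :: "('a::real_normed_vector \<Rightarrow> 'b::real_normed_vector) \<Rightarrow> 'a \<Rightarrow> 'a \<Rightarrow> 'b" where
  "fderiv h u \<equiv> frechet_derivative h (at u)"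

section \<open>Calculus of smooth maps\<close>

lemma Ck_on_subset: "Ck_on n S f \<Longrightarrow> T \<subseteq> S \<Longrightarrow> Ck_on n T f"
  by (induction n arbitrary: f) (auto intro: continuous_on_subset)

lemma Ck_on_SucD: "Ck_on (Suc n) S f \<Longrightarrow> Ck_on n S f"
proof (induction n arbitrary: f)
  case 0
  then show ?case
    by (auto intro!: continuous_at_imp_continuous_on differentiable_imp_continuous_within)
next
  case (Suc n)
  then show ?case by (metis Ck_on.simps(2))
qed

lemma Ck_on_cong:
  assumes "open S" "Ck_on n S f" "\<And>x. x \<in> S \<Longrightarrow> f x = g x"
  shows "Ck_on n S g"
  using assms(2,3)
proof (induction n arbitrary: f g)
  case 0
  then show ?case by (simp cong: continuous_on_cong)
next
  case (Suc n)
  have diff: "g differentiable (at x)" if "x \<in> S" for x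
    using has_derivative_transform_within_open[OF _ assms(1) that, of f _ UNIV g] Suc.prems that
    unfolding Ck_on.simps(2) differentiable_def by blast
  have eq: "fderiv f x = fderiv g x" if "x \<in> S" for x
    using Suc.prems that assms(1) by (auto intro!: frechet_derivative_transform_within_open)
  show ?case
    using diff Suc.prems(1) Suc.IH[of "\<lambda>x. fderiv f x v" "\<lambda>x. fderiv g x v" for v] eq
    by auto
qed

lemma Ck_on_local:
  assumes "\<And>x. x \<in> S \<Longrightarrow> \<exists>T. open T \<and> x \<in> T \<and> Ck_on n T f"
  shows "Ck_on n S f"
  using assms
proof (induction n arbitrary: f)
  case 0
  then show ?case
    by (metis Ck_on.simps(1) continuous_at_imp_continuous_on continuous_on_eq_continuous_at)
next
  case (Suc n)
  show ?case
    using Suc.prems by (auto intro!: Suc.IH) (metis)+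
qed

text \<open>A map is \<open>k + 1\<close> times continuously differentiable as soon as some formula for its
  derivative is \<open>k\<close> times so. Closure under each of the basic operations below is
  thus an induction on \<open>k\<close> in which the product, chain or quotient rule provides the
  formula.\<close>

lemma Ck_on_SucI:
  assumes "open S"
    and "\<And>x. x \<in> S \<Longrightarrow> (f has_derivative f' x) (at x)"
    and "\<And>v. Ck_on n S (\<lambda>x. f' x v)"
  shows "Ck_on (Suc n) S f"
proof -
  have "fderiv f x = f' x" if "x \<in> S" for x
    using assms(2)[OF that] by (metis frechet_derivative_at)
  then have "Ck_on n S (\<lambda>x. fderiv f x v)" for v
    by (intro Ck_on_cong[OF assms(1) assms(3)[of v]]) simp
  then show ?thesis
    using assms(2) by (auto simp: differentiable_def)
qed

lemma Ck_on_Suc_has_derivative: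
  "Ck_on (Suc n) S f \<Longrightarrow> x \<in> S \<Longrightarrow> (f has_derivative fderiv f x) (at x)"
  by (simp add: frechet_derivative_works)

lemma Ck_on_const: "Ck_on n S (\<lambda>x. c)"
  by (induction n arbitrary: c) auto

lemma Ck_on_bounded_linear:
  assumes h: "bounded_linear h" and S: "open S"
  shows "Ck_on n S f \<Longrightarrow> Ck_on n S (\<lambda>x. h (f x))"
proof (induction n arbitrary: f)
  case 0
  then show ?case by (auto intro: bounded_linear.continuous_on[OF h])
next
  case (Suc n)
  show ?case
  proof (rule Ck_on_SucI[OF S])
    fix x assume "x \<in> S"
    then show "((\<lambda>x. h (f x)) has_derivative (\<lambda>v. h (fderiv f x v))) (at x)"
      using Ck_on_Suc_has_derivative[OF Suc.prems] by (intro bounded_linear.has_derivative[OF h]) 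
  next
    show "Ck_on n S (\<lambda>x. h (fderiv f x v))" for v
      using Suc by auto
  qed
qed

lemma Ck_on_id: "open S \<Longrightarrow> Ck_on n S (\<lambda>x. x)"
  by (cases n) (auto intro: Ck_on_const simp: continuous_on_id)

lemma Ck_on_linear: "bounded_linear h \<Longrightarrow> open S \<Longrightarrow> Ck_on n S h"
  using Ck_on_bounded_linear[OF _ _ Ck_on_id] by blast

lemma Ck_on_add:
  assumes S: "open S"
  shows "Ck_on n S f \<Longrightarrow> Ck_on n S g \<Longrightarrow> Ck_on n S (\<lambda>x. f x + g x)"
proof (induction n arbitrary: f g)
  case 0
  then show ?case by (auto intro: continuous_intros)
next
  case (Suc n)
  show ?case
  proof (rule Ck_on_SucI[OF S])
    fix x assume "x \<in> S"
    then show "((\<lambda>x. f x + g x) has_derivative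
        (\<lambda>v. fderiv f x v + fderiv g x v)) (at x)"
      using Ck_on_Suc_has_derivative[OF Suc.prems(1)] Ck_on_Suc_has_derivative[OF Suc.prems(2)]
      by (intro has_derivative_add)
  next
    show "Ck_on n S (\<lambda>x. fderiv f x v + fderiv g x v)" for v
      using Suc by auto
  qed
qed

lemma Ck_on_sum:
  assumes "open S" "\<And>i. i \<in> I \<Longrightarrow> Ck_on n S (f i)"
  shows "Ck_on n S (\<lambda>x. \<Sum>i\<in>I. f i x)"
  using assms(2)
  by (induction I rule: infinite_finite_induct) (auto intro: Ck_on_add Ck_on_const assms(1))

lemma Ck_on_bilinear:
  assumes b: "bounded_bilinear b" and S: "open S"
  shows "Ck_on n S f \<Longrightarrow> Ck_on n S g \<Longrightarrow> Ck_on n S (\<lambda>x. b (f x) (g x))"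
proof (induction n arbitrary: f g)
  case 0
  then show ?case by (auto intro: bounded_bilinear.continuous_on[OF b])
next
  case (Suc n)
  show ?case
  proof (rule Ck_on_SucI[OF S])
    fix x assume "x \<in> S"
    then show "((\<lambda>x. b (f x) (g x)) has_derivative
        (\<lambda>v. b (f x) (fderiv g x v) + b (fderiv f x v) (g x))) (at x)"
      using Ck_on_Suc_has_derivative[OF Suc.prems(1)] Ck_on_Suc_has_derivative[OF Suc.prems(2)]
      by (intro bounded_bilinear.FDERIV[OF b])
  next
    show "Ck_on n S (\<lambda>x. b (f x) (fderiv g x v) + b (fderiv f x v) (g x))" for v
      using Suc.prems Suc.IH Ck_on_SucD[OF Suc.prems(1)] Ck_on_SucD[OF Suc.prems(2)]
      by (intro Ck_on_add[OF S]) auto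
  qed
qed

lemmas Ck_on_scaleR = Ck_on_bilinear[OF bounded_bilinear_scaleR]
lemmas Ck_on_inner = Ck_on_bilinear[OF bounded_bilinear_inner]

lemma Ck_on_mult:
  fixes f g :: "'a::euclidean_space \<Rightarrow> real"
  shows "open S \<Longrightarrow> Ck_on n S f \<Longrightarrow> Ck_on n S g \<Longrightarrow> Ck_on n S (\<lambda>x. f x * g x)"
  by (rule Ck_on_bilinear[OF bounded_bilinear_mult])

lemma Ck_on_prod:
  fixes f :: "'i \<Rightarrow> 'a::euclidean_space \<Rightarrow> real"
  assumes "open S" "\<And>i. i \<in> I \<Longrightarrow> Ck_on n S (f i)"
  shows "Ck_on n S (\<lambda>x. \<Prod>i\<in>I. f i x)"
  using assms(2)
  by (induction I rule: infinite_finite_induct) (auto intro: Ck_on_mult Ck_on_const assms(1))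

lemma Ck_on_componentwise:
  assumes "open S" "\<And>b. b \<in> Basis \<Longrightarrow> Ck_on n S (\<lambda>x. f x \<bullet> b)"
  shows "Ck_on n S f"
proof -
  have "Ck_on n S (\<lambda>x. \<Sum>b\<in>Basis. (f x \<bullet> b) *\<^sub>R b)"
    by (intro Ck_on_sum Ck_on_scaleR Ck_on_const assms)
  then show ?thesis by (simp add: euclidean_representation)
qed

lemma Ck_on_vecI:
  fixes f :: "'a::euclidean_space \<Rightarrow> real^'m::finite"
  assumes "open S" "\<And>i. Ck_on n S (\<lambda>x. f x $ i)"
  shows "Ck_on n S f"
proof (rule Ck_on_componentwise[OF assms(1)])
  fix b :: "real^'m" assume "b \<in> Basis"
  then obtain i where "b = axis i 1" by (auto simp: Basis_vec_def)
  then have "(\<lambda>x. f x \<bullet> b) = (\<lambda>x. f x $ i)" by (simp add: inner_axis)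
  then show "Ck_on n S (\<lambda>x. f x \<bullet> b)" using assms(2) by simp
qed

text \<open>In the chain rule the direction in which \<open>g\<close> is differentiated varies with
  \<open>x\<close>, whereas \<^const>\<open>Ck_on\<close> speaks of fixed directions. Expanding
  that direction in the standard basis separates the two.\<close>

lemma Ck_on_compose:
  assumes S: "open S" and T: "open T"
  shows "Ck_on n S f \<Longrightarrow> Ck_on n T g \<Longrightarrow> f ` S \<subseteq> T \<Longrightarrow> Ck_on n S (\<lambda>x. g (f x))"
proof (induction n arbitrary: f g)
  case 0
  then show ?case by (auto intro: continuous_on_compose2)
next
  case (Suc n)
  show ?case
  proof (rule Ck_on_SucI[OF S])
    fix x assume x: "x \<in> S"
    then have fx: "f x \<in> T" using Suc.prems by auto
    have "((\<lambda>x. g (f x)) has_derivative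
        (\<lambda>v. fderiv g (f x) (fderiv f x v))) (at x)"
      using diff_chain_at[OF Ck_on_Suc_has_derivative[OF Suc.prems(1) x] Ck_on_Suc_has_derivative[OF Suc.prems(2) fx]]
      by (simp add: o_def)
    moreover have "fderiv g (f x) (fderiv f x v) =
        (\<Sum>b\<in>Basis. (fderiv f x v \<bullet> b) *\<^sub>R fderiv g (f x) b)" for v
    proof -
      have lin: "linear (fderiv g (f x))"
        using Ck_on_Suc_has_derivative[OF Suc.prems(2) fx] by (rule has_derivative_linear)
      show ?thesis
        by (subst euclidean_representation[of "fderiv f x v", symmetric])
          (simp add: linear_sum[OF lin] linear_scale[OF lin])
    qed
    ultimately show "((\<lambda>x. g (f x)) has_derivative
        (\<lambda>v. \<Sum>b\<in>Basis. (fderiv f x v \<bullet> b) *\<^sub>R fderiv g (f x) b)) (at x)"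
      by simp
  next
    fix v
    have 1: "Ck_on n S (\<lambda>x. fderiv f x v \<bullet> b)" for b
      using Suc.prems by (intro Ck_on_inner[OF S] Ck_on_const) auto
    have 2: "Ck_on n S (\<lambda>x. fderiv g (f x) b)" for b
      using Suc.IH[of f "\<lambda>y. fderiv g y b"] Suc.prems Ck_on_SucD[OF Suc.prems(1)] by auto
    show "Ck_on n S (\<lambda>x. \<Sum>b\<in>Basis. (fderiv f x v \<bullet> b) *\<^sub>R fderiv g (f x) b)"
      by (intro Ck_on_sum[OF S] Ck_on_scaleR[OF S] 1 2)
  qed
qed

lemma Ck_on_inverse:
  fixes f :: "'a::euclidean_space \<Rightarrow> real"
  assumes S: "open S" and nz: "\<And>x. x \<in> S \<Longrightarrow> f x \<noteq> 0"
  shows "Ck_on n S f \<Longrightarrow> Ck_on n S (\<lambda>x. inverse (f x))"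
proof (induction n)
  case 0
  then show ?case using nz by (auto intro: continuous_intros)
next
  case (Suc n)
  show ?case
  proof (rule Ck_on_SucI[OF S])
    fix x assume "x \<in> S"
    then show "((\<lambda>x. inverse (f x)) has_derivative
        (\<lambda>v. (-1) * (inverse (f x) * fderiv f x v * inverse (f x)))) (at x)"
      using Ck_on_Suc_has_derivative[OF Suc.prems] nz
      by (auto intro!: derivative_eq_intros)
  next
    show "Ck_on n S (\<lambda>x. (-1) * (inverse (f x) * fderiv f x v * inverse (f x)))" for v
      using Suc.prems Suc.IH Ck_on_SucD[OF Suc.prems]
      by (intro Ck_on_mult[OF S] Ck_on_const) auto
  qed
qed

lemma Ck_on_det:
  fixes B :: "'a::euclidean_space \<Rightarrow> real^'m^'m::finite"
  assumes "open S" "\<And>i j. Ck_on n S (\<lambda>x. B x $ i $ j)"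
  shows "Ck_on n S (\<lambda>x. det (B x))"
  unfolding det_def by (intro Ck_on_sum Ck_on_mult Ck_on_prod Ck_on_const assms)

text \<open>By Cramer's rule the solution of a linear system is a rational function of its coefficients. This
  yields the regularity of inverse metrics and of local inverses.\<close>

lemma Ck_on_linear_solution:
  fixes B :: "'a::euclidean_space \<Rightarrow> real^'m^'m::finite"
  assumes S: "open S" and B: "\<And>i j. Ck_on n S (\<lambda>x. B x $ i $ j)"
    and w: "\<And>i. Ck_on n S (\<lambda>x. w x $ i)"
    and nz: "\<And>x. x \<in> S \<Longrightarrow> det (B x) \<noteq> 0"
    and sol: "\<And>x. x \<in> S \<Longrightarrow> B x *v z x = w x"
  shows "Ck_on n S z"
proof (rule Ck_on_vecI[OF S])
  fix k
  have "Ck_on n S (\<lambda>x. det (\<chi> i j. if j = k then w x $ i else B x $ i $ j) * inverse (det (B x)))"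
  proof (intro Ck_on_mult[OF S] Ck_on_inverse[OF S] Ck_on_det[OF S] B nz)
    show "Ck_on n S (\<lambda>x. (\<chi> i j. if j = k then w x $ i else B x $ i $ j) $ i $ j)" for i j
      using B w by (cases "j = k") simp_all
  qed
  moreover have "z x $ k = det (\<chi> i j. if j = k then w x $ i else B x $ i $ j) * inverse (det (B x))"
    if "x \<in> S" for x
  proof -
    have "z x = (\<chi> k. det (\<chi> i j. if j = k then w x $ i else B x $ i $ j) / det (B x))"
      using cramer[of "B x" "z x" "w x"] nz[OF that] sol[OF that] by blast
    then show ?thesis by (simp add: divide_inverse)
  qed
  ultimately show "Ck_on n S (\<lambda>x. z x $ k)"
    by (intro Ck_on_cong[OF S, where g = "\<lambda>x. z x $ k"]) auto
qed

lemma smooth_onD: "smooth_on S f \<Longrightarrow> Ck_on n S f"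
  by (simp add: smooth_on_def)

lemma smooth_on_has_derivative:
  "smooth_on S f \<Longrightarrow> x \<in> S \<Longrightarrow> (f has_derivative fderiv f x) (at x)"
  using Ck_on_Suc_has_derivative[of 0] smooth_onD by blast

lemma smooth_on_linear_derivative:
  "smooth_on S f \<Longrightarrow> x \<in> S \<Longrightarrow> linear (fderiv f x)"
  by (meson has_derivative_linear smooth_on_has_derivative)

lemma smooth_on_derivative: "smooth_on S f \<Longrightarrow> smooth_on S (\<lambda>x. fderiv f x v)"
  by (metis smooth_on_def Ck_on.simps(2))

lemma smooth_on_continuous: "smooth_on S f \<Longrightarrow> continuous_on S f"
  by (metis smooth_on_def Ck_on.simps(1))

lemma smooth_on_subset: "smooth_on S f \<Longrightarrow> T \<subseteq> S \<Longrightarrow> smooth_on T f"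
  by (auto simp: smooth_on_def intro: Ck_on_subset)

lemma smooth_on_cong:
  "open S \<Longrightarrow> smooth_on S f \<Longrightarrow> (\<And>x. x \<in> S \<Longrightarrow> f x = g x) \<Longrightarrow> smooth_on S g"
  by (auto simp: smooth_on_def intro: Ck_on_cong)

lemma smooth_on_compose:
  "open S \<Longrightarrow> open T \<Longrightarrow> smooth_on S f \<Longrightarrow> smooth_on T g \<Longrightarrow> f ` S \<subseteq> T \<Longrightarrow> smooth_on S (\<lambda>x. g (f x))"
  by (auto simp: smooth_on_def intro: Ck_on_compose)

lemma smooth_on_local:
  assumes "\<And>x. x \<in> S \<Longrightarrow> \<exists>T. open T \<and> x \<in> T \<and> smooth_on T f"
  shows "smooth_on S f"
  unfolding smooth_on_def using assms by (metis Ck_on_local smooth_onD)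

section \<open>Symmetry of second derivatives\<close>

text \<open>Applying the mean value theorem in the direction \<open>v\<close> to a difference in the direction
  \<open>w\<close>, and then in the direction \<open>w\<close>, turns the second difference into a
  value of one mixed derivative near \<open>u\<close>. The second difference is symmetric in
  \<open>v\<close> and \<open>w\<close>, so it is also a value of the other mixed derivative, and
  continuity identifies the two at \<open>u\<close>.\<close>

lemma second_difference_mean_value:
  fixes f :: "'a::euclidean_space \<Rightarrow> real"
  assumes f: "Ck_on 2 S f" and h: "0 < h"
    and sub: "\<And>s t. 0 \<le> s \<Longrightarrow> s \<le> h \<Longrightarrow> 0 \<le> t \<Longrightarrow> t \<le> h \<Longrightarrow> u + s *\<^sub>R v + t *\<^sub>R w \<in> S"
  obtains s t where "0 \<le> s" "s \<le> h" "0 \<le> t" "t \<le> h"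
    "f (u + h *\<^sub>R v + h *\<^sub>R w) - f (u + h *\<^sub>R v) - f (u + h *\<^sub>R w) + f u =
      h * h * fderiv (\<lambda>x. fderiv f x v) (u + s *\<^sub>R v + t *\<^sub>R w) w"
proof -
  have f2: "Ck_on (Suc (Suc 0)) S f" using f by (simp add: numeral_2_eq_2)
  have d1: "(f has_derivative fderiv f x) (at x)" if "x \<in> S" for x
    using Ck_on_Suc_has_derivative[OF f2 that] .
  have d2: "((\<lambda>x. fderiv f x v) has_derivative
      fderiv (\<lambda>x. fderiv f x v) x) (at x)" if "x \<in> S" for x
    using f2 that Ck_on_Suc_has_derivative[of 0] by (metis Ck_on.simps(2))
  have line: "((\<lambda>r. g (p + r *\<^sub>R q)) has_real_derivative D q) (at r)"
    if "(g has_derivative D) (at (p + r *\<^sub>R q))" for g :: "'a \<Rightarrow> real" and p q r D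
  proof -
    have "((\<lambda>r. p + r *\<^sub>R q) has_derivative (\<lambda>e. e *\<^sub>R q)) (at r)"
      by (auto intro!: derivative_eq_intros)
    from diff_chain_at[OF this that] have "((\<lambda>r. g (p + r *\<^sub>R q)) has_derivative (\<lambda>e. D (e *\<^sub>R q))) (at r)"
      by (simp add: o_def)
    moreover have "D (e *\<^sub>R q) = D q * e" for e
      using linear_scale[OF has_derivative_linear[OF that]] by simp
    ultimately show ?thesis by (simp add: has_field_derivative_def)
  qed
  define \<phi> where "\<phi> s = f ((u + h *\<^sub>R w) + s *\<^sub>R v) - f (u + s *\<^sub>R v)" for s
  define \<phi>' where "\<phi>' s = fderiv f ((u + h *\<^sub>R w) + s *\<^sub>R v) v - fderiv f (u + s *\<^sub>R v) v" for s
  have "(\<phi> has_real_derivative \<phi>' s) (at s)" if "0 \<le> s" "s \<le> h" for s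
    unfolding \<phi>_def \<phi>'_def using sub[of s h] sub[of s 0] that h
    by (intro DERIV_diff line d1) (auto simp: algebra_simps)
  from MVT2[OF h this] obtain s where s: "0 < s" "s < h" "\<phi> h - \<phi> 0 = (h - 0) * \<phi>' s" by blast
  define \<psi> where "\<psi> t = fderiv f ((u + s *\<^sub>R v) + t *\<^sub>R w) v" for t
  have "(\<psi> has_real_derivative fderiv (\<lambda>x. fderiv f x v) ((u + s *\<^sub>R v) + t *\<^sub>R w) w) (at t)"
    if "0 \<le> t" "t \<le> h" for t
    unfolding \<psi>_def using sub[of s t] that s by (intro line[where g = "\<lambda>x. fderiv f x v"] d2) auto
  from MVT2[OF h this] obtain t where t: "0 < t" "t < h"
    "\<psi> h - \<psi> 0 = (h - 0) * fderiv (\<lambda>x. fderiv f x v) ((u + s *\<^sub>R v) + t *\<^sub>R w) w"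
    by blast
  have "\<phi>' s = \<psi> h - \<psi> 0" by (simp add: \<phi>'_def \<psi>_def algebra_simps)
  then have "\<phi> h - \<phi> 0 = h * h * fderiv (\<lambda>x. fderiv f x v) (u + s *\<^sub>R v + t *\<^sub>R w) w"
    using s t by simp
  then show ?thesis
    using that[of s t] s t by (simp add: \<phi>_def algebra_simps)
qed

lemma symmetric_second_derivative_real:
  fixes f :: "'a::euclidean_space \<Rightarrow> real"
  assumes S: "open S" and f: "Ck_on 2 S f" and u: "u \<in> S"
  shows "fderiv (\<lambda>x. fderiv f x v) u w =
    fderiv (\<lambda>x. fderiv f x w) u v"
proof -
  define A where "A v w x = fderiv (\<lambda>x. fderiv f x v) x w" for v w x
  have cont: "continuous_on S (A v w)" for v w
    using f by (simp add: A_def numeral_2_eq_2)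
  have "\<bar>A v w u - A w v u\<bar> < e" if e: "e > 0" for e
  proof -
    have "\<forall>\<^sub>F x in at u. dist (A v w x) (A v w u) < e/2" "\<forall>\<^sub>F x in at u. dist (A w v x) (A w v u) < e/2"
      using cont u S e
      by (metis continuous_on_eq_continuous_at isCont_def tendstoD half_gt_zero)+
    moreover have "\<forall>\<^sub>F x in at u. x \<in> S"
      using S u by (metis eventually_at_topological)
    ultimately have "\<forall>\<^sub>F x in at u. x \<in> S \<and> dist (A v w x) (A v w u) < e/2 \<and> dist (A w v x) (A w v u) < e/2"
      by eventually_elim auto
    then obtain d where d: "d > 0" "\<And>x. x \<noteq> u \<Longrightarrow> dist x u < d \<Longrightarrow>
        x \<in> S \<and> dist (A v w x) (A v w u) < e/2 \<and> dist (A w v x) (A w v u) < e/2"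
      by (auto simp: eventually_at)
    have d': "x \<in> S \<and> dist (A v w x) (A v w u) < e/2 \<and> dist (A w v x) (A w v u) < e/2" if "dist x u < d" for x
      using d(2)[of x] that u e by (cases "x = u") auto
    define h where "h = d / (2 * (norm v + norm w + 1))"
    have pos: "norm v + norm w + 1 > 0" by (simp add: add_nonneg_pos)
    have h: "h > 0" using d pos by (simp add: h_def)
    have near: "dist (u + s *\<^sub>R v + t *\<^sub>R w) u < d" if "0 \<le> s" "s \<le> h" "0 \<le> t" "t \<le> h" for s t
    proof -
      have "dist (u + s *\<^sub>R v + t *\<^sub>R w) u \<le> s * norm v + t * norm w"
        using that norm_triangle_ineq[of "s *\<^sub>R v" "t *\<^sub>R w"] by (simp add: dist_norm)
      also have "\<dots> \<le> h * norm v + h * norm w"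
        using that by (intro add_mono mult_right_mono) auto
      also have "\<dots> \<le> h * (norm v + norm w + 1)" using h by (simp add: algebra_simps)
      also have "h * (norm v + norm w + 1) = d / 2"
        using pos by (simp only: h_def) (simp add: divide_simps)
      also have "\<dots> < d" using d by simp
      finally show ?thesis .
    qed
    have near': "dist (u + s *\<^sub>R w + t *\<^sub>R v) u < d" if "0 \<le> s" "s \<le> h" "0 \<le> t" "t \<le> h" for s t
      using near[of t s] that by (simp add: algebra_simps)
    obtain s t where 1: "0 \<le> s" "s \<le> h" "0 \<le> t" "t \<le> h"
      "f (u + h *\<^sub>R v + h *\<^sub>R w) - f (u + h *\<^sub>R v) - f (u + h *\<^sub>R w) + f u = h * h * A v w (u + s *\<^sub>R v + t *\<^sub>R w)"
      using second_difference_mean_value[OF f h, of u v w] near d' unfolding A_def by metis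
    obtain s' t' where 2: "0 \<le> s'" "s' \<le> h" "0 \<le> t'" "t' \<le> h"
      "f (u + h *\<^sub>R w + h *\<^sub>R v) - f (u + h *\<^sub>R w) - f (u + h *\<^sub>R v) + f u = h * h * A w v (u + s' *\<^sub>R w + t' *\<^sub>R v)"
      using second_difference_mean_value[OF f h, of u w v] near' d' unfolding A_def by metis
    have "u + h *\<^sub>R w + h *\<^sub>R v = u + h *\<^sub>R v + h *\<^sub>R w" by (simp add: algebra_simps)
    then have "h * h * A v w (u + s *\<^sub>R v + t *\<^sub>R w) = h * h * A w v (u + s' *\<^sub>R w + t' *\<^sub>R v)"
      using 1(5) 2(5) by (simp add: algebra_simps)
    then have "A v w (u + s *\<^sub>R v + t *\<^sub>R w) = A w v (u + s' *\<^sub>R w + t' *\<^sub>R v)" using h by simp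
    moreover have "\<bar>A v w (u + s *\<^sub>R v + t *\<^sub>R w) - A v w u\<bar> < e/2" "\<bar>A w v (u + s' *\<^sub>R w + t' *\<^sub>R v) - A w v u\<bar> < e/2"
      using d'[OF near[OF 1(1-4)]] d'[OF near'[OF 2(1-4)]] unfolding dist_real_def by blast+
    ultimately show ?thesis by linarith
  qed
  then have "\<bar>A v w u - A w v u\<bar> = 0"
    by (metis abs_ge_zero less_le_not_le order.order_iff_strict)
  then show ?thesis by (simp add: A_def)
qed

lemma symmetric_second_derivative:
  fixes f :: "'a::euclidean_space \<Rightarrow> 'b::euclidean_space"
  assumes S: "open S" and f: "Ck_on 2 S f" and u: "u \<in> S"
  shows "fderiv (\<lambda>x. fderiv f x v) u w =
    fderiv (\<lambda>x. fderiv f x w) u v"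
proof (rule euclidean_eqI)
  fix b :: 'b assume "b \<in> Basis"
  have f2: "Ck_on (Suc (Suc 0)) S f" using f by (simp add: numeral_2_eq_2)
  have d: "fderiv (\<lambda>x. g x \<bullet> b) x z = fderiv g x z \<bullet> b"
    if "g differentiable (at x)" for g :: "'a \<Rightarrow> 'b" and x z
    using that by (metis frechet_derivative_at frechet_derivative_works has_derivative_inner_left)
  have "fderiv (\<lambda>x. fderiv f x v) u w \<bullet> b =
      fderiv (\<lambda>x. fderiv (\<lambda>x. f x \<bullet> b) x v) u w" for v w
  proof -
    have "fderiv (\<lambda>x. fderiv (\<lambda>x. f x \<bullet> b) x v) u =
        fderiv (\<lambda>x. fderiv f x v \<bullet> b) u"
      using f2 S u by (intro frechet_derivative_transform_within_open[where X = S, symmetric]) (auto simp: d)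
    then show ?thesis using f2 u by (simp add: d)
  qed
  moreover have "Ck_on 2 S (\<lambda>x. f x \<bullet> b)"
    by (intro Ck_on_inner S f Ck_on_const)
  ultimately show "fderiv (\<lambda>x. fderiv f x v) u w \<bullet> b =
      fderiv (\<lambda>x. fderiv f x w) u v \<bullet> b"
    using symmetric_second_derivative_real[OF S _ u] by metis
qed

section \<open>Smooth local inverses\<close>

text \<open>The inverse function theorem gives a differentiable inverse \<open>g\<close> whose derivative at
  \<open>y\<close> is the inverse of the derivative of \<open>\<Psi>\<close> at
  \<open>g y\<close>. If \<open>g\<close> is \<open>k\<close> times continuously differentiable
  then, by Cramer's rule, so is this inverse linear map, and \<open>g\<close> gains one more
  derivative.\<close>

lemma smooth_local_inverse:
  fixes \<Psi> :: "real^'m::finite \<Rightarrow> real^'m"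
  assumes V: "open V" and sm: "smooth_on V \<Psi>" and u0: "u0 \<in> V"
    and inj: "inj (fderiv \<Psi> u0)"
  obtains U W g where "open U" "U \<subseteq> V" "u0 \<in> U" "open W" "homeomorphism U W \<Psi> g" "smooth_on W g"
proof -
  define D where "D x = fderiv \<Psi> x" for x
  have der: "(\<Psi> has_derivative D x) (at x)" if "x \<in> V" for x
    using smooth_on_has_derivative[OF sm that] by (simp add: D_def)
  have bl: "bounded_linear (D x)" if "x \<in> V" for x
    using der[OF that] by (rule has_derivative_bounded_linear)
  have contD: "continuous_on V (\<lambda>x. D x v)" for v
    using smooth_on_continuous[OF smooth_on_derivative[OF sm]] by (simp add: D_def)
  define D' where "D' x = Blinfun (D x)" for x
  have D': "blinfun_apply (D' x) = D x" if "x \<in> V" for x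
    using bounded_linear_Blinfun_apply[OF bl[OF that]] by (simp add: D'_def)
  have cont: "continuous_on V D'"
  proof (rule continuous_on_blinfun_componentwise)
    fix i :: "real^'m" assume "i \<in> Basis"
    show "continuous_on V (\<lambda>x. blinfun_apply (D' x) i)"
      using contD[of i] by (subst continuous_on_cong[OF refl, of V _ "\<lambda>x. D x i"]) (auto simp: D')
  qed
  obtain L where L: "linear L" "L \<circ> D u0 = id"
    using linear_injective_left_inverse[of "D u0"] inj bl[OF u0] by (auto simp: D_def bounded_linear.linear)
  have Lb: "bounded_linear L" using L by (simp add: linear_conv_bounded_linear)
  have "Blinfun L o\<^sub>L D' u0 = id_blinfun"
    by (rule blinfun_eqI) (use L(2) in \<open>simp add: bounded_linear_Blinfun_apply[OF Lb] D'[OF u0] fun_eq_iff\<close>)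
  then obtain U W g g' where *: "open U" "U \<subseteq> V" "u0 \<in> U" "open W" "homeomorphism U W \<Psi> g"
    "\<And>y. y \<in> W \<Longrightarrow> (g has_derivative g' y) (at y)"
    "\<And>y. y \<in> W \<Longrightarrow> g' y = inv (blinfun_apply (D' (g y)))"
    "\<And>y. y \<in> W \<Longrightarrow> bij (blinfun_apply (D' (g y)))"
    using inverse_function_theorem[OF V _ cont u0, of \<Psi> "Blinfun L"] der D' by (metis (no_types, lifting))
  have gV: "g y \<in> V" if "y \<in> W" for y
    using *(2,5) that by (auto simp: homeomorphism_def)
  have "Ck_on n W g" for n
  proof (induction n)
    case 0
    then show ?case using *(5) by (simp add: homeomorphism_def)
  next
    case (Suc n)
    show ?case
    proof (rule Ck_on_SucI[OF *(4) *(6)])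
      fix v
      define B where "B y = matrix (D (g y))" for y
      have lin: "linear (D (g y))" if "y \<in> W" for y
        using bl[OF gV[OF that]] by (simp add: bounded_linear.linear)
      have bij: "bij (D (g y))" if "y \<in> W" for y
        using *(8)[OF that] D'[OF gV[OF that]] by simp
      show "Ck_on n W (\<lambda>y. g' y v)"
      proof (rule Ck_on_linear_solution[OF *(4), where B = B and w = "\<lambda>y. v"])
        fix i j
        have "Ck_on n V (\<lambda>x. D x (axis j 1) \<bullet> axis i 1)"
          using smooth_onD[OF smooth_on_derivative[OF sm]] by (intro Ck_on_inner[OF V] Ck_on_const) (auto simp: D_def)
        from Ck_on_compose[OF *(4) V Suc.IH this] gV
        show "Ck_on n W (\<lambda>y. B y $ i $ j)"
          by (auto simp: B_def matrix_def inner_axis)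
      next
        show "Ck_on n W (\<lambda>y. v $ i)" for i by (rule Ck_on_const)
      next
        fix y assume y: "y \<in> W"
        show "det (B y) \<noteq> 0"
          using bij[OF y] lin[OF y] unfolding B_def
          by (simp add: det_nz_iff_inj bij_is_inj)
        have "g' y v = inv (D (g y)) v" using *(7)[OF y] D'[OF gV[OF y]] by simp
        then show "B y *v g' y v = v"
          using lin[OF y] bij[OF y] by (simp add: B_def matrix_works bij_inv_eq_iff)
      qed
    qed
  qed
  then show ?thesis
    using that *(1-5) by (auto simp: smooth_on_def)
qed

text \<open>If \<open>L\<close> is the adjoint of the derivative of \<open>\<Phi>\<close> at
  \<open>u0\<close>, then \<open>L \<circ> \<Phi>\<close> is a local diffeomorphism between
  spaces of the same dimension, since \<open>L (D v) = 0\<close> forces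
  \<open>D v \<bullet> D v = 0\<close>.\<close>

lemma smooth_local_left_inverse:
  fixes \<Phi> :: "real^'m::finite \<Rightarrow> 'e::euclidean_space"
  assumes V: "open V" and sm: "smooth_on V \<Phi>" and u0: "u0 \<in> V"
    and inj: "inj (fderiv \<Phi> u0)"
  obtains U W r where "open U" "U \<subseteq> V" "u0 \<in> U" "open W" "\<Phi> ` U \<subseteq> W" "smooth_on W r" "r ` W \<subseteq> U"
    "\<And>u. u \<in> U \<Longrightarrow> r (\<Phi> u) = u"
proof -
  define D where "D = fderiv \<Phi> u0"
  have linD: "linear D" using smooth_on_linear_derivative[OF sm u0] by (simp add: D_def)
  define L where "L = adjoint D"
  have L: "x \<bullet> L y = D x \<bullet> y" for x y
    using adjoint_works[OF linD] by (simp add: L_def)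
  have linL: "bounded_linear L"
    using adjoint_linear[OF linD] by (simp add: L_def linear_conv_bounded_linear)
  have smL: "smooth_on V (\<lambda>u. L (\<Phi> u))"
    using sm by (auto simp: smooth_on_def intro: Ck_on_bounded_linear[OF linL V])
  have "fderiv (\<lambda>u. L (\<Phi> u)) u0 = (\<lambda>v. L (D v))"
    using bounded_linear.has_derivative[OF linL smooth_on_has_derivative[OF sm u0]]
    by (metis D_def frechet_derivative_at)
  moreover have "inj (\<lambda>v. L (D v))"
  proof -
    have "v = 0" if "L (D v) = 0" for v
    proof -
      have "D v \<bullet> D v = 0" using L[of v "D v"] that by simp
      then show ?thesis
        using inj linD by (metis D_def inner_eq_zero_iff linear_injective_0)
    qed
    moreover have "linear (\<lambda>v. L (D v))"
      using linear_compose[OF linD bounded_linear.linear[OF linL]] by (simp add: o_def)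
    ultimately show ?thesis by (simp add: linear_injective_0)
  qed
  ultimately obtain U W g where *: "open U" "U \<subseteq> V" "u0 \<in> U" "open W"
    "homeomorphism U W (\<lambda>u. L (\<Phi> u)) g" "smooth_on W g"
    using smooth_local_inverse[OF V smL u0] by metis
  have Lc: "continuous_on UNIV L" by (rule linear_continuous_on[OF linL])
  have oW: "open (L -` W)"
    by (rule open_vimage[OF *(4) Lc])
  have 1: "smooth_on (L -` W) L"
    unfolding smooth_on_def using Ck_on_linear[OF linL oW] by blast
  show ?thesis
  proof (rule that[of U "L -` W" "\<lambda>y. g (L y)"])
    show "smooth_on (L -` W) (\<lambda>y. g (L y))"
      by (rule smooth_on_compose[OF oW *(4) 1 *(6)]) auto
  qed (use * oW in \<open>auto simp: homeomorphism_def\<close>)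
qed

section \<open>Inner products of Pluecker vectors\<close>

lemma wedge_component:
  fixes \<xi> :: "real^'k^'m::finite"
  shows "wedge \<xi> $ I = (\<Sum>p | p permutes (UNIV::'m set). of_int (sign p) * (\<Prod>j\<in>UNIV. \<xi> $ p j $ I j))"
proof -
  have "wedge \<xi> $ I = det (transpose (\<chi> i j. \<xi> $ i $ I j))"
    by (simp only: wedge_def det_transpose) simp
  then show ?thesis by (simp add: det_def transpose_def)
qed

text \<open>The identity of Cauchy and Binet. The factorial appears because Pluecker coordinates are indexed
  by all choices of columns, not only by the increasing ones; each permutation of rows contributes
  the same determinant. In particular the oriented Grassmannian lies in the sphere whose squared
  radius is this factorial.\<close>

lemma inner_wedge:
  fixes \<eta> \<xi> :: "real^'k::finite^'m::finite"
  shows "wedge \<eta> \<bullet> wedge \<xi> = fact CARD('m) * det (\<chi> j i. \<eta> $ j \<bullet> \<xi> $ i)"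
proof -
  let ?S = "{p. p permutes (UNIV :: 'm set)}"
  have "wedge \<eta> \<bullet> wedge \<xi> =
      (\<Sum>I\<in>UNIV. \<Sum>p\<in>?S. of_int (sign p) * ((\<Prod>j\<in>UNIV. \<eta> $ p j $ I j) * wedge \<xi> $ I))"
    by (simp add: inner_vec_def wedge_component[of \<eta>] sum_distrib_right mult.assoc)
  also have "\<dots> = (\<Sum>p\<in>?S. of_int (sign p) * (\<Sum>I\<in>UNIV. (\<Prod>j\<in>UNIV. (\<chi> j. \<eta> $ p j) $ j $ I j) * wedge \<xi> $ I))"
    by (subst sum.swap) (simp add: sum_distrib_left)
  also have "\<dots> = (\<Sum>p\<in>?S. of_int (sign p) * det (\<chi> j i. (\<chi> j. \<eta> $ p j) $ j \<bullet> \<xi> $ i))"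
    by (simp only: det_inner_wedge)
  also have "\<dots> = (\<Sum>p\<in>?S. det (\<chi> j i. \<eta> $ j \<bullet> \<xi> $ i))"
  proof (rule sum.cong[OF refl])
    fix p assume "p \<in> ?S"
    then have "det (\<chi> j i. (\<chi> j. \<eta> $ p j) $ j \<bullet> \<xi> $ i) = of_int (sign p) * det (\<chi> j i. \<eta> $ j \<bullet> \<xi> $ i)"
      using det_permute_rows[of p "\<chi> j i. \<eta> $ j \<bullet> \<xi> $ i"] by simp
    moreover have "of_int (sign p) * (of_int (sign p) * r) = r" for r :: real
      by (metis mult.assoc mult_1 of_int_1 of_int_mult sign_idempotent)
    ultimately show "of_int (sign p) * det (\<chi> j i. (\<chi> j. \<eta> $ p j) $ j \<bullet> \<xi> $ i) = det (\<chi> j i. \<eta> $ j \<bullet> \<xi> $ i)"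
      by simp
  qed
  also have "\<dots> = fact CARD('m) * det (\<chi> j i. \<eta> $ j \<bullet> \<xi> $ i)"
    by (simp add: card_permutations[of UNIV "CARD('m)"])
  finally show ?thesis .
qed

lemma norm_wedge_orthonormal:
  fixes \<xi> :: "real^'k::finite^'m::finite"
  assumes "orthonormal_frame \<xi>"
  shows "(norm (wedge \<xi>))\<^sup>2 = fact CARD('m)"
proof -
  have "(\<chi> j i. \<xi> $ j \<bullet> \<xi> $ i) = (mat 1 :: real^'m^'m)"
    using assms by (simp add: orthonormal_frame_def mat_def vec_eq_iff)
  then show ?thesis by (simp add: power2_norm_eq_inner inner_wedge)
qed

section \<open>Symmetric matrices\<close>

text \<open>A maximum of the Rayleigh quotient on the unit sphere of \<open>U\<close> is an eigenvector: its
  image under \<open>T\<close> is orthogonal to every \<open>y \<in> U\<close> orthogonal to it,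
  because otherwise a small step in the direction of \<open>y\<close> would increase the
  quotient.\<close>

lemma selfadjoint_eigenvector:
  fixes T :: "'a::euclidean_space \<Rightarrow> 'a"
  assumes lin: "linear T" and sa: "\<And>x y. T x \<bullet> y = x \<bullet> T y"
    and U: "subspace U" "\<And>x. x \<in> U \<Longrightarrow> T x \<in> U" "U \<noteq> {0}"
  obtains x c where "x \<in> U" "norm x = 1" "T x = c *\<^sub>R x"
proof -
  define K where "K = {x \<in> U. norm x = 1}"
  have "K = sphere 0 1 \<inter> U" by (auto simp: K_def)
  then have "compact K"
    using closed_subspace[OF U(1)] by (simp add: compact_Int_closed)
  moreover obtain y where y: "y \<in> U" "y \<noteq> 0"
    using U(1,3) subspace_0 by blast
  then have "y /\<^sub>R norm y \<in> K" using U(1) by (simp add: K_def subspace_scale)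
  moreover have "continuous_on K (\<lambda>x. T x \<bullet> x)"
    using lin by (intro continuous_intros linear_continuous_on) (simp add: linear_conv_bounded_linear)
  ultimately obtain x where x: "x \<in> K" "\<And>y. y \<in> K \<Longrightarrow> T y \<bullet> y \<le> T x \<bullet> x"
    using continuous_attains_sup[of K "\<lambda>x. T x \<bullet> x"] by blast
  define c where "c = T x \<bullet> x"
  have xU: "x \<in> U" "norm x = 1" "x \<bullet> x = 1" using x(1) by (auto simp: K_def norm_eq_1)
  have le: "T y \<bullet> y \<le> c * (y \<bullet> y)" if "y \<in> U" for y
  proof (cases "y = 0")
    case True then show ?thesis using lin by (simp add: linear_0)
  next
    case False
    then have "y /\<^sub>R norm y \<in> K" using U(1) that by (simp add: K_def subspace_scale)
    then have "T (y /\<^sub>R norm y) \<bullet> (y /\<^sub>R norm y) \<le> c" unfolding c_def by (rule x(2))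
    then have "T y \<bullet> y / (norm y)\<^sup>2 \<le> c"
      using lin False by (simp add: linear_scale power2_eq_square divide_inverse mult.commute mult.left_commute)
    then show ?thesis
      using False by (simp add: divide_le_eq power2_norm_eq_inner)
  qed
  have orth: "T x \<bullet> y = 0" if y: "y \<in> U" "x \<bullet> y = 0" for y
  proof -
    define q where "q = c * (y \<bullet> y) - T y \<bullet> y"
    have q: "2 * t * (T x \<bullet> y) \<le> t * t * q" for t
    proof -
      have "T (x + t *\<^sub>R y) \<bullet> (x + t *\<^sub>R y) \<le> c * ((x + t *\<^sub>R y) \<bullet> (x + t *\<^sub>R y))"
        using xU(1) y(1) U(1) by (intro le) (simp add: subspace_add subspace_scale)
      moreover have "T y \<bullet> x = T x \<bullet> y" using sa[of y x] by (simp add: inner_commute)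
      moreover have "y \<bullet> x = 0" using y by (simp add: inner_commute)
      ultimately show ?thesis
        using xU(3) y(2) lin by (simp add: linear_add linear_scale inner_add_left inner_add_right q_def c_def[symmetric] algebra_simps)
    qed
    have q0: "q \<ge> 0" using le[OF y(1)] by (simp add: q_def)
    show ?thesis
    proof (rule ccontr)
      assume nz: "T x \<bullet> y \<noteq> 0"
      \<comment> \<open>the step at which the linear gain outweighs the quadratic loss\<close>
      define t where "t = (T x \<bullet> y) / (q + 1)"
      have a: "T x \<bullet> y = t * (q + 1)" using q0 by (simp add: t_def)
      have "t * t * (q + 2) \<le> 0" using q[of t] unfolding a by (simp add: algebra_simps)
      moreover have "t * t > 0" using nz a by (metis mult_zero_left not_real_square_gt_zero)
      ultimately have "q + 2 \<le> 0" by (metis mult_le_0_iff not_le)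
      then show False using q0 by simp
    qed
  qed
  define y where "y = T x - c *\<^sub>R x"
  have "y \<in> U" using xU(1) U by (simp add: y_def subspace_diff subspace_scale)
  moreover have xy: "x \<bullet> y = 0" using xU(3) by (simp add: y_def inner_diff_right c_def inner_commute)
  ultimately have "T x \<bullet> y = 0" using orth by blast
  moreover have "y \<bullet> y = T x \<bullet> y - c * (x \<bullet> y)" unfolding y_def by (simp add: inner_diff_left)
  ultimately have "y \<bullet> y = 0" using xy by simp
  then show ?thesis using that xU by (simp add: y_def)
qed

lemma selfadjoint_eigenbasis:
  fixes T :: "'a::euclidean_space \<Rightarrow> 'a"
  assumes lin: "linear T" and sa: "\<And>x y. T x \<bullet> y = x \<bullet> T y"
    and "subspace U" "\<And>x. x \<in> U \<Longrightarrow> T x \<in> U"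
  shows "\<exists>B. finite B \<and> pairwise orthogonal B \<and> (\<forall>b\<in>B. norm b = 1 \<and> (\<exists>c. T b = c *\<^sub>R b)) \<and> span B = U"
  using assms(3,4)
proof (induction "dim U" arbitrary: U rule: less_induct)
  case less
  show ?case
  proof (cases "U = {0}")
    case True
    then show ?thesis by (intro exI[of _ "{}"]) auto
  next
    case False
    obtain x c where x: "x \<in> U" "norm x = 1" "T x = c *\<^sub>R x"
      using selfadjoint_eigenvector[OF lin sa less.prems False] by blast
    have xx: "x \<bullet> x = 1" using x(2) by (simp add: norm_eq_1)
    define W where "W = {y \<in> U. x \<bullet> y = 0}"
    have W: "subspace W"
      using less.prems(1) by (auto simp: W_def subspace_def inner_add_right)
    have "x \<notin> W" using xx by (simp add: W_def)
    moreover have "W \<subseteq> U" by (auto simp: W_def)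
    ultimately have "W \<subset> U" using x(1) by blast
    then have dim: "dim W < dim U"
      using W less.prems(1) by (metis dim_psubset span_eq_iff)
    have "T y \<in> W" if "y \<in> W" for y
      using that less.prems(2) sa[of x y] x(3) by (auto simp: W_def)
    then obtain B where B: "finite B" "pairwise orthogonal B" "\<forall>b\<in>B. norm b = 1 \<and> (\<exists>c. T b = c *\<^sub>R b)" "span B = W"
      using less.hyps[OF dim W] by blast
    have BW: "b \<in> W" if "b \<in> B" for b using B(4) that span_base by blast
    have "span (insert x B) = U"
    proof
      have "insert x B \<subseteq> U" using x(1) BW by (auto simp: W_def)
      then show "span (insert x B) \<subseteq> U" using less.prems(1) by (simp add: span_minimal)
      show "U \<subseteq> span (insert x B)"
      proof
        fix y assume y: "y \<in> U"
        have "y - (x \<bullet> y) *\<^sub>R x \<in> W"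
          using y x(1) less.prems(1) xx by (simp add: W_def subspace_diff subspace_scale inner_diff_right)
        then show "y \<in> span (insert x B)" using B(4) span_breakdown_eq by blast
      qed
    qed
    moreover have "pairwise orthogonal (insert x B)"
      using B(2) BW by (auto simp: pairwise_insert orthogonal_def W_def inner_commute)
    ultimately show ?thesis
      using B x by (intro exI[of _ "insert x B"]) auto
  qed
qed

lemma matrix_diff_rdistrib: "(B - C) ** A = B ** A - C ** (A :: real^'n^'m)" for B C :: "real^'m^'l"
  by (simp add: vec_eq_iff matrix_matrix_mult_def left_diff_distrib sum_subtractf)

lemma matrix_diff_ldistrib: "A ** (B - C) = A ** B - A ** (C :: real^'n^'m)" for A :: "real^'m^'l"
  by (simp add: vec_eq_iff matrix_matrix_mult_def right_diff_distrib sum_subtractf)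

text \<open>The characteristic polynomial of a symmetric matrix splits, and the roots are tied to unit
  eigenvectors so that they can be estimated.\<close>

lemma symmetric_matrix_char_poly:
  fixes S :: "real^'m^'m::finite"
  assumes sym: "transpose S = S"
  obtains q :: "'m \<Rightarrow> real^'m" and d :: "'m \<Rightarrow> real"
  where "\<And>i. norm (q i) = 1" "\<And>i. S *v q i = d i *\<^sub>R q i" "\<And>s. det (mat s - S) = (\<Prod>i\<in>UNIV. s - d i)"
proof -
  have sa: "(S *v x) \<bullet> y = x \<bullet> (S *v y)" for x y
    using dot_lmul_matrix[of x S y] sym
    by (metis dot_matrix_product dot_lmul_matrix inner_commute vector_transpose_matrix)
  obtain B where B: "finite B" "pairwise orthogonal B" "\<forall>b\<in>B. norm b = 1 \<and> (\<exists>c. S *v b = c *\<^sub>R b)" "span B = UNIV"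
    using selfadjoint_eigenbasis[of "(*v) S" UNIV] sa by (auto simp: matrix_vector_mul_linear)
  have "0 \<notin> B" using B(3) by auto
  then have ind: "independent B" using B(2) pairwise_orthogonal_independent by blast
  then have "card B = CARD('m)"
    using B(4) by (metis dim_UNIV dim_eq_card DIM_cart DIM_real mult_1_right dim_span)
  then obtain q :: "'m \<Rightarrow> real^'m" where q: "bij_betw q UNIV B"
    using B(1) by (metis finite_same_card_bij finite_class.finite_UNIV)
  have qB: "q i \<in> B" for i using q by (auto simp: bij_betw_def)
  define d where "d i = (SOME c. S *v q i = c *\<^sub>R q i)" for i
  have d: "S *v q i = d i *\<^sub>R q i" for i
    unfolding d_def by (rule someI_ex) (use B(3) qB in blast)
  define Q :: "real^'m^'m" where "Q = (\<chi> i j. q j $ i)"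
  have orth: "q i \<bullet> q j = (if i = j then 1 else 0)" for i j
  proof (cases "i = j")
    case True
    then show ?thesis using B(3) qB by (simp add: norm_eq_1[symmetric])
  next
    case False
    then have "q i \<noteq> q j" using q by (auto simp: bij_betw_def inj_on_def)
    then show ?thesis using B(2) qB False by (simp add: pairwise_def orthogonal_def)
  qed
  have "transpose Q ** Q = mat 1"
    using orth by (simp add: vec_eq_iff Q_def matrix_matrix_mult_def transpose_def mat_def inner_vec_def)
  then have "det Q * det Q = 1"
    by (metis det_I det_mul det_transpose)
  then have Qnz: "det Q \<noteq> 0" by auto
  have "det (mat s - S) = (\<Prod>i\<in>UNIV. s - d i)" for s
  proof -
    define D :: "real^'m^'m" where "D = (\<chi> i j. if i = j then s - d i else 0)"
    have "(mat s ** Q) $ i $ j = s * Q $ i $ j" for i j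
      by (simp add: matrix_matrix_mult_def mat_def if_distribR if_distrib[of "\<lambda>x. x * _"] cong: if_cong)
    moreover have "(Q ** D) $ i $ j = Q $ i $ j * (s - d j)" for i j
      by (simp add: matrix_matrix_mult_def D_def if_distrib cong: if_cong)
    moreover
    have "(S ** Q) $ i $ j = d j * Q $ i $ j" for i j
    proof -
      have "(S ** Q) $ i $ j = (S *v q j) $ i"
        by (simp add: matrix_matrix_mult_def matrix_vector_mult_def Q_def)
      then show ?thesis by (simp add: d Q_def)
    qed
    ultimately have "(mat s - S) ** Q = Q ** D"
      by (simp add: vec_eq_iff matrix_diff_rdistrib algebra_simps)
    then have "det (mat s - S) * det Q = det Q * det D" by (metis det_mul)
    moreover have "det D = (\<Prod>i\<in>UNIV. s - d i)"
      by (subst det_diagonal) (auto simp: D_def)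
    ultimately show ?thesis using Qnz by simp
  qed
  then show ?thesis using that[of q d] d B(3) qB by blast
qed

text \<open>A polynomial determines its roots with multiplicity, hence also the sum of \<open>h\<close> over
  its roots. The eigenvalues in the definition of \<^const>\<open>dist_c\<close> are given only
  through their characteristic polynomial. Dividing by a common linear factor is legitimate away
  from its root, and at the root by continuity.\<close>

lemma sum_over_roots_unique:
  fixes a :: "'i \<Rightarrow> real" and b :: "'j \<Rightarrow> real" and h :: "real \<Rightarrow> real"
  assumes "finite I" "finite J" "\<And>s. (\<Prod>i\<in>I. s - a i) = (\<Prod>j\<in>J. s - b j)"
  shows "(\<Sum>i\<in>I. h (a i)) = (\<Sum>j\<in>J. h (b j))"
  using assms
proof (induction I arbitrary: J rule: finite_induct)
  case empty
  have "J = {}"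
  proof (rule ccontr)
    assume "J \<noteq> {}"
    then obtain j where j: "j \<in> J" by blast
    then have "(\<Prod>k\<in>J. b j - b k) = 0" using empty.prems(1) by (intro prod_zero) auto
    then show False using empty.prems(2)[of "b j"] by simp
  qed
  then show ?case by simp
next
  case (insert i I)
  have "(\<Prod>j\<in>J. a i - b j) = 0" using insert by (subst insert.prems(2)[symmetric]) simp
  then obtain j where j: "j \<in> J" "a i = b j" using insert.prems(1) by auto
  have eq: "(\<Prod>k\<in>I. s - a k) = (\<Prod>k\<in>J - {j}. s - b k)" for s
  proof -
    have ne: "(\<Prod>k\<in>I. s - a k) = (\<Prod>k\<in>J - {j}. s - b k)" if "s \<noteq> a i" for s
    proof -
      have "(s - a i) * (\<Prod>k\<in>I. s - a k) = (s - b j) * (\<Prod>k\<in>J - {j}. s - b k)"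
        using insert j by (metis prod.insert prod.remove)
      then show ?thesis using that j by simp
    qed
    have "isCont (\<lambda>s. \<Prod>k\<in>I. s - a k) s" "isCont (\<lambda>s. \<Prod>k\<in>J - {j}. s - b k) s"
      by (intro continuous_intros)+
    then have lims: "((\<lambda>s. \<Prod>k\<in>I. s - a k) \<longlongrightarrow> (\<Prod>k\<in>I. s - a k)) (at s)"
      "((\<lambda>s. \<Prod>k\<in>J - {j}. s - b k) \<longlongrightarrow> (\<Prod>k\<in>J - {j}. s - b k)) (at s)"
      by (auto simp: isCont_def)
    have "\<forall>\<^sub>F r in at s. (\<Prod>k\<in>I. r - a k) = (\<Prod>k\<in>J - {j}. r - b k)"
      using ne eventually_neq_at_within[of "a i" s UNIV] by (auto elim!: eventually_mono)
    then have "((\<lambda>s. \<Prod>k\<in>J - {j}. s - b k) \<longlongrightarrow> (\<Prod>k\<in>I. s - a k)) (at s)"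
      by (rule Lim_transform_eventually[OF lims(1)])
    then show ?thesis using lims(2) by (rule tendsto_unique[OF at_neq_bot])
  qed
  have "(\<Sum>k\<in>I. h (a k)) = (\<Sum>k\<in>J - {j}. h (b k))"
    using insert.IH[of "J - {j}"] eq insert.prems(1) by simp
  then show ?case
    using insert.hyps insert.prems(1) j by (simp add: sum.remove[of J j])
qed

section \<open>The canonical distance\<close>

lemma bessel_frame:
  fixes \<zeta> :: "real^'k::finite^'m::finite"
  assumes "orthonormal_frame \<zeta>"
  shows "(\<Sum>j\<in>UNIV. (w \<bullet> \<zeta> $ j)\<^sup>2) \<le> w \<bullet> w"
proof -
  have on: "\<zeta> $ i \<bullet> \<zeta> $ j = (if i = j then 1 else 0)" for i j
    using assms by (simp add: orthonormal_frame_def)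
  define z where "z = (\<Sum>j\<in>UNIV. (w \<bullet> \<zeta> $ j) *\<^sub>R \<zeta> $ j)"
  have zz: "z \<bullet> z = (\<Sum>j\<in>UNIV. (w \<bullet> \<zeta> $ j)\<^sup>2)"
    unfolding z_def by (simp add: inner_sum_left inner_sum_right on power2_eq_square if_distrib cong: if_cong)
  have wz: "w \<bullet> z = (\<Sum>j\<in>UNIV. (w \<bullet> \<zeta> $ j)\<^sup>2)"
    by (simp add: z_def inner_sum_right power2_eq_square)
  have "0 \<le> (w - z) \<bullet> (w - z)" by simp
  then show ?thesis using zz wz by (simp add: inner_diff_left inner_diff_right inner_commute)
qed

text \<open>The data on which the definition of \<^const>\<open>dist_c\<close> depends: oriented bases of the
  two planes and the cosines of the angles between the planes.\<close>

definition dist_c_witness ::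
    "(real, 'm::finite \<Rightarrow> 'k::finite) vec \<Rightarrow> (real, 'm \<Rightarrow> 'k) vec \<Rightarrow> real^'k^'m \<Rightarrow> real^'k^'m \<Rightarrow> real^'m \<Rightarrow> bool" where
  "dist_c_witness P Q \<xi> \<zeta> l \<longleftrightarrow> oriented_basis P \<xi> \<and> oriented_basis Q \<zeta> \<and>
     (\<forall>i. 0 \<le> l $ i \<and> l $ i \<le> 1) \<and>
     (let \<alpha> = (\<chi> i j. \<xi> $ i \<bullet> \<zeta> $ j) :: real^'m^'m
      in \<forall>s. det (mat s - \<alpha> ** transpose \<alpha>) = (\<Prod>i\<in>UNIV. s - (l $ i)\<^sup>2))"

text \<open>An eigenvalue of \<open>\<alpha> ** transpose \<alpha>\<close> with unit eigenvector
  \<open>q\<close> is the sum of squares of the coordinates in the frame \<open>\<zeta>\<close> of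
  the unit vector with coordinates \<open>q\<close> in the frame \<open>\<xi>\<close>; Bessel's
  inequality places it between 0 and 1.\<close>

lemma dist_c_witness_exists:
  fixes P Q :: "(real, 'm::finite \<Rightarrow> 'k::finite) vec"
  assumes "P \<in> oriented_grassmannian" "Q \<in> oriented_grassmannian"
  obtains \<xi> \<zeta> l where "dist_c_witness P Q \<xi> \<zeta> l"
proof -
  obtain \<xi> \<zeta> where b: "oriented_basis P \<xi>" "oriented_basis Q \<zeta>"
    using assms by (auto simp: oriented_grassmannian_def oriented_basis_def)
  then have on: "orthonormal_frame \<xi>" "orthonormal_frame \<zeta>" by (auto simp: oriented_basis_def)
  define \<alpha> where "\<alpha> = ((\<chi> i j. \<xi> $ i \<bullet> \<zeta> $ j) :: real^'m^'m)"
  have "transpose (\<alpha> ** transpose \<alpha>) = \<alpha> ** transpose \<alpha>"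
    by (simp add: matrix_transpose_mul)
  then obtain q :: "'m \<Rightarrow> real^'m" and d :: "'m \<Rightarrow> real" where q: "\<And>i. norm (q i) = 1" "\<And>i. (\<alpha> ** transpose \<alpha>) *v q i = d i *\<^sub>R q i"
    "\<And>s. det (mat s - \<alpha> ** transpose \<alpha>) = (\<Prod>i\<in>UNIV. s - d i)"
    using symmetric_matrix_char_poly by blast
  have d: "0 \<le> d i \<and> d i \<le> 1" for i
  proof -
    define w where "w = (\<Sum>k\<in>UNIV. q i $ k *\<^sub>R \<xi> $ k)"
    have on': "\<xi> $ i \<bullet> \<xi> $ j = (if i = j then 1 else 0)" for i j
      using on(1) by (simp add: orthonormal_frame_def)
    have "w \<bullet> w = (\<Sum>k\<in>UNIV. q i $ k * q i $ k)"
      unfolding w_def by (simp add: inner_sum_left inner_sum_right on' if_distrib cong: if_cong)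
    then have "w \<bullet> w = q i \<bullet> q i" by (simp add: inner_vec_def)
    then have ww: "w \<bullet> w = 1" using q(1) by (simp add: norm_eq_1)
    have aq: "(transpose \<alpha> *v q i) $ j = w \<bullet> \<zeta> $ j" for j
      by (simp add: w_def \<alpha>_def matrix_vector_mult_def transpose_def inner_sum_left mult.commute vector_matrix_mult_def)
    have "d i = q i \<bullet> (d i *\<^sub>R q i)" using q(1) by (simp add: norm_eq_1)
    also have "\<dots> = q i \<bullet> (\<alpha> *v (transpose \<alpha> *v q i))"
      by (simp only: q(2)[symmetric] matrix_vector_mul_assoc)
    also have "\<dots> = (transpose \<alpha> *v q i) \<bullet> (transpose \<alpha> *v q i)"
      by (simp add: dot_lmul_matrix)
    also have "\<dots> = (\<Sum>j\<in>UNIV. (w \<bullet> \<zeta> $ j)\<^sup>2)"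
      by (simp only: inner_vec_def aq power2_eq_square inner_real_def)
    finally have di: "d i = (\<Sum>j\<in>UNIV. (w \<bullet> \<zeta> $ j)\<^sup>2)" .
    show ?thesis
    proof
      show "0 \<le> d i" unfolding di by (rule sum_nonneg) simp
      show "d i \<le> 1" using bessel_frame[OF on(2), of w] ww di by simp
    qed
  qed
  have "dist_c_witness P Q \<xi> \<zeta> (\<chi> i. sqrt (d i))"
    using b q(3) d by (simp add: dist_c_witness_def \<alpha>_def[symmetric])
  then show ?thesis using that by blast
qed

text \<open>Another choice of bases multiplies \<open>\<alpha>\<close> by orthogonal matrices on both sides,
  which conjugates \<open>\<alpha> ** transpose \<alpha>\<close> and leaves its characteristic
  polynomial unchanged.\<close>

lemma dist_c_eq:
  fixes P Q :: "(real, 'm::finite \<Rightarrow> 'k::finite) vec"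
  assumes w: "dist_c_witness P Q \<xi> \<zeta> l"
  shows "dist_c P Q = sqrt (\<Sum>i\<in>UNIV. (arccos (l $ i))\<^sup>2)"
proof -
  have unique: "sqrt (\<Sum>i\<in>UNIV. (arccos (l' $ i))\<^sup>2) = sqrt (\<Sum>i\<in>UNIV. (arccos (l $ i))\<^sup>2)"
    if w': "dist_c_witness P Q \<xi>' \<zeta>' l'" for \<xi>' \<zeta>' l'
  proof -
    define \<alpha> where "\<alpha> = ((\<chi> i j. \<xi> $ i \<bullet> \<zeta> $ j) :: real^'m^'m)"
    define \<alpha>' where "\<alpha>' = ((\<chi> i j. \<xi>' $ i \<bullet> \<zeta>' $ j) :: real^'m^'m)"
    obtain R where R: "orthogonal_matrix R" "\<xi>' = R ** \<xi>"
      using w w' wedge_eq_iff[of \<xi>' \<xi>] by (auto simp: dist_c_witness_def oriented_basis_def)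
    obtain S where S: "orthogonal_matrix S" "\<zeta>' = S ** \<zeta>"
      using w w' wedge_eq_iff[of \<zeta>' \<zeta>] by (auto simp: dist_c_witness_def oriented_basis_def)
    have gram: "(\<chi> i j. \<xi> $ i \<bullet> \<zeta> $ j) = \<xi> ** transpose \<zeta>" for \<xi> \<zeta> :: "real^'k^'m"
      by (simp add: vec_eq_iff matrix_matrix_mult_def transpose_def inner_vec_def)
    have \<alpha>': "\<alpha>' = R ** \<alpha> ** transpose S"
      unfolding \<alpha>_def \<alpha>'_def gram R(2) S(2) by (simp add: matrix_transpose_mul matrix_mul_assoc)
    have "\<alpha>' ** transpose \<alpha>' = R ** (\<alpha> ** (transpose S ** S) ** transpose \<alpha>) ** transpose R"
      unfolding \<alpha>' by (simp add: matrix_transpose_mul matrix_mul_assoc)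
    then have conj: "\<alpha>' ** transpose \<alpha>' = R ** (\<alpha> ** transpose \<alpha>) ** transpose R"
      using S(1) by (simp add: orthogonal_matrix_def)
    have RR: "R ** transpose R = mat 1" using R(1) by (simp add: orthogonal_matrix_def)
    have "det (mat s - \<alpha>' ** transpose \<alpha>') = det (mat s - \<alpha> ** transpose \<alpha>)" for s
    proof -
      have ms: "mat s = s *\<^sub>R (mat 1 :: real^'m^'m)" by (simp add: vec_eq_iff mat_def)
      have "R ** mat s ** transpose R = mat s"
        unfolding ms using RR by (simp add: matrix_scalar_ac scalar_matrix_assoc[symmetric])
      then have "mat s - \<alpha>' ** transpose \<alpha>' = R ** (mat s - \<alpha> ** transpose \<alpha>) ** transpose R"
        unfolding conj by (simp add: matrix_diff_ldistrib matrix_diff_rdistrib)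
      moreover have "det R * det R = 1" using RR by (metis det_I det_mul det_transpose)
      ultimately show ?thesis by (simp add: det_mul mult.commute mult.left_commute)
    qed
    then have "(\<Prod>i\<in>UNIV. s - (l' $ i)\<^sup>2) = (\<Prod>i\<in>UNIV. s - (l $ i)\<^sup>2)" for s
      using w w' by (simp add: dist_c_witness_def Let_def \<alpha>_def \<alpha>'_def)
    then have "(\<Sum>i\<in>UNIV. (arccos (sqrt ((l' $ i)\<^sup>2)))\<^sup>2) = (\<Sum>i\<in>UNIV. (arccos (sqrt ((l $ i)\<^sup>2)))\<^sup>2)"
      using sum_over_roots_unique[of UNIV UNIV "\<lambda>i. (l' $ i)\<^sup>2" "\<lambda>i. (l $ i)\<^sup>2" "\<lambda>x. (arccos (sqrt x))\<^sup>2"] by simp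
    then show ?thesis using w w' by (simp add: dist_c_witness_def)
  qed
  show ?thesis
    unfolding dist_c_def
  proof (rule the_equality)
    show "\<exists>\<xi> \<zeta> (l' :: real^'m). oriented_basis P \<xi> \<and> oriented_basis Q \<zeta> \<and>
       sqrt (\<Sum>i\<in>UNIV. (arccos (l $ i))\<^sup>2) = sqrt (\<Sum>i\<in>UNIV. (arccos (l' $ i))\<^sup>2) \<and> (\<forall>i. 0 \<le> l' $ i \<and> l' $ i \<le> 1) \<and>
       (let \<alpha> = (\<chi> i j. \<xi> $ i \<bullet> \<zeta> $ j) in \<forall>s. det (mat s - \<alpha> ** transpose \<alpha>) = (\<Prod>i\<in>UNIV. s - (l' $ i)\<^sup>2))"
      using w unfolding dist_c_witness_def by blast
  next
    fix d
    assume "\<exists>\<xi> \<zeta> (l' :: real^'m). oriented_basis P \<xi> \<and> oriented_basis Q \<zeta> \<and>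
       d = sqrt (\<Sum>i\<in>UNIV. (arccos (l' $ i))\<^sup>2) \<and> (\<forall>i. 0 \<le> l' $ i \<and> l' $ i \<le> 1) \<and>
       (let \<alpha> = (\<chi> i j. \<xi> $ i \<bullet> \<zeta> $ j) in \<forall>s. det (mat s - \<alpha> ** transpose \<alpha>) = (\<Prod>i\<in>UNIV. s - (l' $ i)\<^sup>2))"
    then obtain \<xi>' \<zeta>' l' where "dist_c_witness P Q \<xi>' \<zeta>' l'" "d = sqrt (\<Sum>i\<in>UNIV. (arccos (l' $ i))\<^sup>2)"
      unfolding dist_c_witness_def by blast
    then show "d = sqrt (\<Sum>i\<in>UNIV. (arccos (l $ i))\<^sup>2)" using unique by simp
  qed
qed

text \<open>The inner product of the Pluecker vectors is a multiple of \<open>det \<alpha>\<close>, and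
  evaluating the characteristic polynomial of \<open>\<alpha> ** transpose \<alpha>\<close> at
  0 shows that the square of \<open>det \<alpha>\<close> is the product of the
  eigenvalues.\<close>

lemma dist_c_witness_inner:
  fixes P Q :: "(real, 'm::finite \<Rightarrow> 'k::finite) vec"
  assumes w: "dist_c_witness P Q \<xi> \<zeta> l"
  shows "\<bar>P \<bullet> Q\<bar> = fact CARD('m) * (\<Prod>i\<in>UNIV. l $ i)"
proof -
  define \<alpha> where "\<alpha> = ((\<chi> i j. \<xi> $ i \<bullet> \<zeta> $ j) :: real^'m^'m)"
  have PQ: "P \<bullet> Q = fact CARD('m) * det \<alpha>"
    using w by (auto simp: dist_c_witness_def oriented_basis_def inner_wedge \<alpha>_def)
  have neg: "mat 0 - B = mat (-1) ** B" for B :: "real^'m^'m"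
    by (simp add: vec_eq_iff mat_def matrix_matrix_mult_def if_distrib if_distribR cong: if_cong)
  have detm: "det (mat (-1) :: real^'m^'m) = (\<Prod>i\<in>(UNIV::'m set). -1)"
    by (subst det_diagonal) (auto simp: mat_def)
  have "det (mat 0 - \<alpha> ** transpose \<alpha>) = (\<Prod>i\<in>UNIV. 0 - (l $ i)\<^sup>2)"
    using w unfolding dist_c_witness_def \<alpha>_def Let_def by blast
  moreover have "(\<Prod>i\<in>UNIV. 0 - (l $ i)\<^sup>2) = (\<Prod>i\<in>(UNIV::'m set). -1) * (\<Prod>i\<in>UNIV. (l $ i)\<^sup>2)"
    by (subst prod.distrib[symmetric]) simp
  ultimately have "(\<Prod>i\<in>(UNIV::'m set). -1) * (det \<alpha>)\<^sup>2 = (\<Prod>i\<in>(UNIV::'m set). -1) * (\<Prod>i\<in>UNIV. (l $ i)\<^sup>2)"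
    unfolding neg det_mul detm det_transpose power2_eq_square by argo
  then have "(det \<alpha>)\<^sup>2 = (\<Prod>i\<in>UNIV. l $ i)\<^sup>2" by (simp add: prod_power_distrib)
  then have "\<bar>det \<alpha>\<bar> = (\<Prod>i\<in>UNIV. l $ i)"
    using w by (metis abs_of_nonneg dist_c_witness_def power2_abs power2_eq_imp_eq prod_nonneg abs_ge_zero)
  then show ?thesis by (simp add: PQ abs_mult)
qed

text \<open>The logarithm turns the product of the cosines into a sum which is comparable, term by term, with
  the sum of the squared angles.\<close>

lemma ln_cos_quadratic:
  fixes e :: real
  assumes "e > 0"
  obtains \<delta> :: real where "0 < \<delta>" "\<delta> < 1" "\<And>\<theta>. 0 \<le> \<theta> \<Longrightarrow> \<theta> < \<delta> \<Longrightarrow> \<bar>- 2 * ln (cos \<theta>) - \<theta>\<^sup>2\<bar> \<le> e * \<theta>\<^sup>2"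
proof -
  have tan: "((\<lambda>x::real. tan x / x) \<longlongrightarrow> 1) (at_right 0)"
  proof -
    have "(tan has_real_derivative inverse ((cos 0)\<^sup>2)) (at (0::real))" by (rule DERIV_tan) simp
    then have "((\<lambda>x::real. tan x / x) \<longlongrightarrow> 1) (at 0)" by (simp add: has_field_derivative_iff)
    then show ?thesis by (rule tendsto_within_subset) simp
  qed
  have c: "\<forall>\<^sub>F x in at_right 0. cos (x::real) > 0 \<and> x > 0"
    using eventually_at_right_real[of 0 1] by (auto elim!: eventually_mono intro!: cos_gt_zero_pi order.strict_trans[OF _ pi_half_less_two] simp: pi_half_gt_zero less_imp_le)
      (use pi_gt3 in linarith)+
  have "((\<lambda>x::real. (- 2 * ln (cos x)) / x\<^sup>2) \<longlongrightarrow> 1) (at_right 0)"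
  proof (rule lhopital_right_0[where f' = "\<lambda>x. 2 * tan x" and g' = "\<lambda>x. 2 * x"])
    have "isCont (\<lambda>x::real. - 2 * ln (cos x)) 0" by (intro continuous_intros) simp
    then show "((\<lambda>x::real. - 2 * ln (cos x)) \<longlongrightarrow> 0) (at_right 0)"
      by (metis (no_types, lifting) cos_zero filterlim_at_split isCont_def ln_one mult_zero_right)
    show "((\<lambda>x::real. x\<^sup>2) \<longlongrightarrow> 0) (at_right 0)"
      by (rule tendsto_eq_intros | simp)+
    show "\<forall>\<^sub>F x::real in at_right 0. x\<^sup>2 \<noteq> 0" "\<forall>\<^sub>F x::real in at_right 0. 2 * x \<noteq> 0"
      using c by (auto elim!: eventually_mono)
    show "\<forall>\<^sub>F x in at_right 0. ((\<lambda>x. - 2 * ln (cos x)) has_real_derivative 2 * tan x) (at x)"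
      using c by (rule eventually_mono) (auto intro!: derivative_eq_intros simp: tan_def field_simps)
    show "\<forall>\<^sub>F x in at_right 0. ((\<lambda>x::real. x\<^sup>2) has_real_derivative 2 * x) (at x)"
      by (auto intro!: always_eventually derivative_eq_intros)
    show "((\<lambda>x::real. 2 * tan x / (2 * x)) \<longlongrightarrow> 1) (at_right 0)"
      using tan by simp
  qed
  then have "\<forall>\<^sub>F x::real in at_right 0. dist (- 2 * ln (cos x) / x\<^sup>2) 1 < e" by (rule tendstoD) fact
  then obtain b where b: "b > 0" "\<And>x::real. 0 < x \<Longrightarrow> x < b \<Longrightarrow> dist (- 2 * ln (cos x) / x\<^sup>2) 1 < e"
    by (auto simp: eventually_at_right_field)
  show ?thesis
  proof (rule that[of "min b (1/2)"])
    fix \<theta> :: real assume th: "0 \<le> \<theta>" "\<theta> < min b (1/2)"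
    show "\<bar>- 2 * ln (cos \<theta>) - \<theta>\<^sup>2\<bar> \<le> e * \<theta>\<^sup>2"
    proof (cases "\<theta> = 0")
      case False
      then have pos: "\<theta>\<^sup>2 > 0" by simp
      have "\<bar>- 2 * ln (cos \<theta>) / \<theta>\<^sup>2 - 1\<bar> < e" using b(2)[of \<theta>] th False by (auto simp: dist_real_def)
      moreover have "- 2 * ln (cos \<theta>) / \<theta>\<^sup>2 - 1 = (- 2 * ln (cos \<theta>) - \<theta>\<^sup>2) / \<theta>\<^sup>2"
        using pos by (simp add: field_simps)
      ultimately have "\<bar>- 2 * ln (cos \<theta>) - \<theta>\<^sup>2\<bar> / \<theta>\<^sup>2 < e" by (simp add: abs_divide)
      then show ?thesis using pos by (simp add: divide_less_eq)
    qed auto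
  qed (use b in auto)
qed

text \<open>For nearby planes the canonical distance and the Euclidean distance of Pluecker vectors agree to
  first order, up to a constant scale. If \<open>p\<close> is the product of the cosines of the
  angles, the scaled squared Euclidean distance \<open>y\<close> is
  \<open>2 * (1 - p)\<close>; the squared canonical distance is close to
  \<open>- 2 * ln p\<close>, and this lies between \<open>y\<close> and
  \<open>y / p\<close>.\<close>

lemma dist_c_asymptotic:
  fixes e :: real
  assumes e: "0 < e" "e \<le> 1"
  obtains \<delta> where "0 < \<delta>"
    "\<And>P Q :: (real, 'm::finite \<Rightarrow> 'k::finite) vec. P \<in> oriented_grassmannian \<Longrightarrow> Q \<in> oriented_grassmannian \<Longrightarrow>
      (norm (P - Q))\<^sup>2 / fact CARD('m) < \<delta> \<Longrightarrow>
      \<bar>(dist_c P Q)\<^sup>2 - (norm (P - Q))\<^sup>2 / fact CARD('m)\<bar> \<le> e * ((norm (P - Q))\<^sup>2 / fact CARD('m))"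
proof -
  define e' where "e' = e / 4"
  have e': "0 < e'" "e' \<le> 1/4" using e by (auto simp: e'_def)
  obtain \<delta> where \<delta>: "0 < \<delta>" "\<delta> < 1"
    "\<And>\<theta>. 0 \<le> \<theta> \<Longrightarrow> \<theta> < \<delta> \<Longrightarrow> \<bar>- 2 * ln (cos \<theta>) - \<theta>\<^sup>2\<bar> \<le> e' * \<theta>\<^sup>2"
    using ln_cos_quadratic[OF e'(1)] by blast
  have \<delta>pi: "\<delta> < pi" using \<delta>(2) pi_gt3 by linarith
  have cos1: "cos \<delta> < 1" using \<delta>(1) \<delta>pi cos_monotone_0_pi[of 0 \<delta>] by simp
  \<comment> \<open>The second bound forces all angles below \<open>\<delta>\<close>, the third one forces \<open>1 / p \<le> 1 + e'\<close>.\<close>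
  define d where "d = Min {1, 2 * (1 - cos \<delta>), 2 * (e' / (1 + e'))}"
  have d: "d > 0" "d \<le> 1" "d \<le> 2 * (1 - cos \<delta>)" "d \<le> 2 * (e' / (1 + e'))"
    using cos1 e' by (auto simp: d_def)
  show ?thesis
  proof (rule that[OF d(1)])
    fix P Q :: "(real, 'm \<Rightarrow> 'k) vec"
    assume PQ: "P \<in> oriented_grassmannian" "Q \<in> oriented_grassmannian"
      and close: "(norm (P - Q))\<^sup>2 / fact CARD('m) < d"
    define y where "y = (norm (P - Q))\<^sup>2 / fact CARD('m)"
    obtain \<xi> \<zeta> l where w: "dist_c_witness P Q \<xi> \<zeta> l" using dist_c_witness_exists[OF PQ] by blast
    have l: "0 \<le> l $ i" "l $ i \<le> 1" for i using w by (auto simp: dist_c_witness_def)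
    define p where "p = (\<Prod>i\<in>UNIV. l $ i)"
    have "P \<bullet> P = fact CARD('m)" "Q \<bullet> Q = fact CARD('m)"
      using w norm_wedge_orthonormal[of \<xi>] norm_wedge_orthonormal[of \<zeta>]
      by (auto simp: dist_c_witness_def oriented_basis_def power2_norm_eq_inner)
    then have "(norm (P - Q))\<^sup>2 = 2 * fact CARD('m) - 2 * (P \<bullet> Q)"
      by (simp add: power2_norm_eq_inner inner_diff_left inner_diff_right inner_commute)
    then have y: "y = 2 - 2 * (P \<bullet> Q / fact CARD('m))" by (simp add: y_def diff_divide_distrib)
    have "y < 1" using close d(2) unfolding y_def by linarith
    then have "P \<bullet> Q / fact CARD('m) > 0" using y by linarith
    then have "P \<bullet> Q > 0" by (simp add: zero_less_divide_iff)
    then have "P \<bullet> Q / fact CARD('m) = p"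
      using dist_c_witness_inner[OF w] by (simp add: p_def)
    then have yp: "y = 2 * (1 - p)" using y by simp
    have pc: "p > cos \<delta>" using close d(3) yp by (simp add: y_def[symmetric])
    have p2: "1 - p < e' / (1 + e')" using close d(4) yp by (simp add: y_def[symmetric])
    have p0: "p > 0" using \<open>y < 1\<close> yp by simp
    have lp: "p \<le> l $ i" for i
    proof -
      have "p = l $ i * (\<Prod>j\<in>UNIV - {i}. l $ j)" unfolding p_def by (rule prod.remove) auto
      also have "\<dots> \<le> l $ i * 1" using l by (intro mult_left_mono prod_le_1) auto
      finally show ?thesis by simp
    qed
    define \<theta> where "\<theta> i = arccos (l $ i)" for i
    have th: "0 \<le> \<theta> i" "cos (\<theta> i) = l $ i" "\<theta> i < \<delta>" for i
    proof -
      show "0 \<le> \<theta> i" "cos (\<theta> i) = l $ i" using l[of i] by (auto simp: \<theta>_def arccos_lbound intro: order_trans[of "-1" 0])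
      have "arccos (l $ i) < arccos (cos \<delta>)"
        using l[of i] lp[of i] pc by (intro arccos_less_arccos) (auto intro: order_trans)
      then show "\<theta> i < \<delta>" using \<delta>(1) \<delta>pi by (simp add: \<theta>_def arccos_cos)
    qed
    define D where "D = (\<Sum>i\<in>UNIV. (\<theta> i)\<^sup>2)"
    define L where "L = - 2 * ln p"
    have D: "(dist_c P Q)\<^sup>2 = D" by (simp add: dist_c_eq[OF w] D_def \<theta>_def sum_nonneg)
    have D0: "D \<ge> 0" by (simp add: D_def sum_nonneg)
    have "l $ i \<noteq> 0" for i using lp[of i] p0 by linarith
    then have "L = (\<Sum>i\<in>UNIV. - 2 * ln (cos (\<theta> i)))"
      by (simp add: L_def p_def ln_prod th(2) sum_distrib_left)
    then have "\<bar>L - D\<bar> \<le> (\<Sum>i\<in>UNIV. \<bar>- 2 * ln (cos (\<theta> i)) - (\<theta> i)\<^sup>2\<bar>)"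
      unfolding D_def by (simp only: sum_subtractf[symmetric] sum_abs)
    also have "\<dots> \<le> (\<Sum>i\<in>UNIV. e' * (\<theta> i)\<^sup>2)"
      by (intro sum_mono \<delta>(3) th)
    finally have LD: "\<bar>L - D\<bar> \<le> e' * D" by (simp add: D_def sum_distrib_left)
    have y0: "y \<ge> 0" by (simp add: y_def)
    have Ly: "y \<le> L" using ln_le_minus_one[OF p0] by (simp add: L_def yp)
    have "L \<le> y * (1 / p)"
      using ln_le_minus_one[of "1 / p"] p0 by (simp add: L_def yp ln_div field_simps)
    also have "1 / p \<le> 1 + e'"
    proof -
      have "(1 - p) * (1 + e') \<le> e'" using p2 e' by (simp add: less_divide_eq less_imp_le)
      then show ?thesis using p0 by (simp add: divide_le_eq algebra_simps)
    qed
    finally have yL: "L \<le> y * (1 + e')" using y0 by (simp add: mult_left_mono)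
    have up: "D \<le> (1 + 4 * e') * y"
    proof -
      have "D * (1 - e') \<le> y * (1 + e')" using LD yL by (simp add: algebra_simps)
      also have "\<dots> \<le> y * ((1 + 4 * e') * (1 - e'))"
      proof (rule mult_left_mono[OF _ y0])
        have "e' * e' \<le> e' * (1/4)" using e' by (intro mult_left_mono) auto
        then show "1 + e' \<le> (1 + 4 * e') * (1 - e')" using e' by (simp add: algebra_simps)
      qed
      finally have "D * (1 - e') \<le> ((1 + 4 * e') * y) * (1 - e')" by (simp add: mult_ac)
      then show ?thesis using e' by (simp add: mult_le_cancel_right)
    qed
    have low: "D \<ge> (1 - 4 * e') * y"
    proof -
      have "y \<le> D * (1 + e')" using LD Ly by (simp add: algebra_simps)
      moreover have "((1 - 4 * e') * y) * (1 + e') \<le> y"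
      proof -
        have "(1 - 4 * e') * (1 + e') \<le> 1" using e' by (simp add: algebra_simps)
        then show ?thesis using mult_left_mono[OF _ y0] by (fastforce simp: mult_ac)
      qed
      ultimately have "((1 - 4 * e') * y) * (1 + e') \<le> D * (1 + e')" by linarith
      then show ?thesis using e' by (simp add: mult_le_cancel_right)
    qed
    show "\<bar>(dist_c P Q)\<^sup>2 - (norm (P - Q))\<^sup>2 / fact CARD('m)\<bar> \<le> e * ((norm (P - Q))\<^sup>2 / fact CARD('m))"
      unfolding D y_def[symmetric] using up low by (simp add: e'_def algebra_simps abs_le_iff)
  qed
qed

lemma dist_c_nonneg:
  fixes P Q :: "(real, 'm::finite \<Rightarrow> 'k::finite) vec"
  assumes "P \<in> oriented_grassmannian" "Q \<in> oriented_grassmannian"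
  shows "0 \<le> dist_c P Q"
proof -
  obtain \<xi> \<zeta> l where w: "dist_c_witness P Q \<xi> \<zeta> l" using dist_c_witness_exists[OF assms] by blast
  show ?thesis by (simp add: dist_c_eq[OF w] sum_nonneg)
qed

lemma dist_c_self:
  fixes P :: "(real, 'm::finite \<Rightarrow> 'k::finite) vec"
  assumes "P \<in> oriented_grassmannian"
  shows "dist_c P P = 0"
proof -
  obtain \<delta> where \<delta>: "0 < \<delta>"
    "\<And>P Q :: (real, 'm::finite \<Rightarrow> 'k::finite) vec. P \<in> oriented_grassmannian \<Longrightarrow> Q \<in> oriented_grassmannian \<Longrightarrow>
      (norm (P - Q))\<^sup>2 / fact CARD('m) < \<delta> \<Longrightarrow>
      \<bar>(dist_c P Q)\<^sup>2 - (norm (P - Q))\<^sup>2 / fact CARD('m)\<bar> \<le> 1 * ((norm (P - Q))\<^sup>2 / fact CARD('m))"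
    using dist_c_asymptotic[of 1] by auto
  show ?thesis using \<delta>(2)[OF assms assms] \<delta>(1) by simp
qed

section \<open>The canonical metric\<close>

lemma has_vector_derivative_at_right_iff:
  fixes f :: "real \<Rightarrow> 'a::real_normed_vector"
  shows "(f has_vector_derivative X) (at_right 0) \<longleftrightarrow> ((\<lambda>t. (f t - f 0) /\<^sub>R t) \<longlongrightarrow> X) (at_right 0)"
proof -
  have "(f has_vector_derivative X) (at_right 0) \<longleftrightarrow>
      ((\<lambda>t. (1 / norm (t - 0)) *\<^sub>R (f t - (f 0 + (t - 0) *\<^sub>R X))) \<longlongrightarrow> 0) (at_right 0)"
    by (simp add: has_vector_derivative_def has_derivative_within bounded_linear_scaleR_left)
  also have "\<dots> \<longleftrightarrow> ((\<lambda>t. (f t - f 0) /\<^sub>R t - X) \<longlongrightarrow> 0) (at_right 0)"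
  proof (rule tendsto_cong)
    show "\<forall>\<^sub>F t in at_right 0. (1 / norm (t - 0)) *\<^sub>R (f t - (f 0 + (t - 0) *\<^sub>R X)) = (f t - f 0) /\<^sub>R t - X"
      by (rule eventually_mono[OF eventually_at_right_less]) (simp add: algebra_simps divide_inverse)
  qed
  also have "\<dots> \<longleftrightarrow> ((\<lambda>t. (f t - f 0) /\<^sub>R t) \<longlongrightarrow> X) (at_right 0)"
    by (rule LIM_zero_iff)
  finally show ?thesis .
qed

lemma dist_c_right_derivative:
  fixes x :: "real \<Rightarrow> (real, 'm::finite \<Rightarrow> 'k::finite) vec"
  assumes T: "open T" "0 \<in> T" "x ` T \<subseteq> oriented_grassmannian" and X: "(x has_vector_derivative X) (at 0)"
  shows "((\<lambda>t. dist_c (x 0) (x t)) has_vector_derivative norm X / sqrt (fact CARD('m))) (at_right 0)"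
proof -
  define y where "y t = (norm (x 0 - x t))\<^sup>2 / fact CARD('m)" for t
  define c where "c = (norm X)\<^sup>2 / fact CARD('m)"
  have ev: "\<forall>\<^sub>F t in at_right 0. t \<in> T \<and> t > 0"
    using T(1,2) by (auto simp: eventually_conj_iff eventually_at_right_less eventually_at_topological)
  have "(x has_vector_derivative X) (at_right 0)" using X by (rule has_vector_derivative_at_within)
  then have "((\<lambda>t. (x t - x 0) /\<^sub>R t) \<longlongrightarrow> X) (at_right 0)"
    by (simp add: has_vector_derivative_at_right_iff)
  then have "((\<lambda>t. (norm ((x t - x 0) /\<^sub>R t))\<^sup>2 / fact CARD('m)) \<longlongrightarrow> c) (at_right 0)"
    unfolding c_def by (intro tendsto_intros) auto
  moreover have "\<forall>\<^sub>F t in at_right 0. (norm ((x t - x 0) /\<^sub>R t))\<^sup>2 / fact CARD('m) = y t / t\<^sup>2"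
    using ev by eventually_elim
      (simp add: y_def power_mult_distrib norm_minus_commute divide_inverse mult_ac power_inverse)
  ultimately have y: "((\<lambda>t. y t / t\<^sup>2) \<longlongrightarrow> c) (at_right 0)"
    by (rule Lim_transform_eventually)
  have y0: "(y \<longlongrightarrow> 0) (at_right 0)"
  proof -
    have "((\<lambda>t. y t / t\<^sup>2 * t\<^sup>2) \<longlongrightarrow> c * 0\<^sup>2) (at_right 0)" by (intro tendsto_intros y)
    moreover have "\<forall>\<^sub>F t in at_right 0. y t / t\<^sup>2 * t\<^sup>2 = y t" using ev by eventually_elim simp
    ultimately show ?thesis using Lim_transform_eventually by fastforce
  qed
  have "((\<lambda>t. (dist_c (x 0) (x t))\<^sup>2 / t\<^sup>2 - y t / t\<^sup>2) \<longlongrightarrow> 0) (at_right 0)"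
  proof (rule tendstoI)
    fix r :: real assume r: "r > 0"
    have c0: "c \<ge> 0" by (simp add: c_def)
    define e where "e = min 1 (r / (2 * (c + 1)))"
    have e: "0 < e" "e \<le> 1" "e \<le> r / (2 * (c + 1))" using r c0 by (auto simp: e_def)
    obtain \<delta> where \<delta>: "0 < \<delta>"
      "\<And>P Q :: (real, 'm::finite \<Rightarrow> 'k::finite) vec. P \<in> oriented_grassmannian \<Longrightarrow> Q \<in> oriented_grassmannian \<Longrightarrow>
        (norm (P - Q))\<^sup>2 / fact CARD('m) < \<delta> \<Longrightarrow>
        \<bar>(dist_c P Q)\<^sup>2 - (norm (P - Q))\<^sup>2 / fact CARD('m)\<bar> \<le> e * ((norm (P - Q))\<^sup>2 / fact CARD('m))"
      using dist_c_asymptotic[OF e(1,2)] by blast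
    have "\<forall>\<^sub>F t in at_right 0. y t < \<delta>" using y0 \<delta>(1) by (rule order_tendstoD)
    moreover have "\<forall>\<^sub>F t in at_right 0. y t / t\<^sup>2 < c + 1" using y by (rule order_tendstoD) simp
    ultimately show "\<forall>\<^sub>F t in at_right 0. dist ((dist_c (x 0) (x t))\<^sup>2 / t\<^sup>2 - y t / t\<^sup>2) 0 < r"
      using ev
    proof eventually_elim
      case (elim t)
      have t2: "t\<^sup>2 > 0" using elim by simp
      have "\<bar>(dist_c (x 0) (x t))\<^sup>2 - y t\<bar> \<le> e * y t"
        using \<delta>(2)[of "x 0" "x t"] T elim by (auto simp: y_def)
      then have "\<bar>(dist_c (x 0) (x t))\<^sup>2 - y t\<bar> / t\<^sup>2 \<le> e * y t / t\<^sup>2" using t2 by (simp add: divide_right_mono)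
      also have "\<dots> = e * (y t / t\<^sup>2)" by simp
      also have "\<dots> \<le> r / (2 * (c + 1)) * (c + 1)"
        using e elim c0 t2 r by (intro mult_mono) (auto simp: y_def)
      also have "\<dots> = r / 2" using c0 by (simp add: field_simps)
      also have "\<dots> < r" using r by simp
      finally show ?case using t2 by (simp add: dist_real_def diff_divide_distrib[symmetric] abs_divide)
    qed
  qed
  from tendsto_add[OF this y] have "((\<lambda>t. (dist_c (x 0) (x t))\<^sup>2 / t\<^sup>2) \<longlongrightarrow> c) (at_right 0)" by simp
  then have "((\<lambda>t. sqrt ((dist_c (x 0) (x t))\<^sup>2 / t\<^sup>2)) \<longlongrightarrow> sqrt c) (at_right 0)" by (rule tendsto_real_sqrt)
  moreover have "\<forall>\<^sub>F t in at_right 0. sqrt ((dist_c (x 0) (x t))\<^sup>2 / t\<^sup>2) = (dist_c (x 0) (x t) - dist_c (x 0) (x 0)) /\<^sub>R t"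
    using ev
  proof eventually_elim
    case (elim t)
    then have "x t \<in> oriented_grassmannian" "x 0 \<in> oriented_grassmannian" using T by auto
    moreover from this have "sqrt ((dist_c (x 0) (x t))\<^sup>2 / t\<^sup>2) = dist_c (x 0) (x t) / t"
      using elim dist_c_nonneg[of "x 0" "x t"] by (simp add: real_sqrt_divide)
    ultimately show ?case by (simp add: dist_c_self divide_inverse mult.commute)
  qed
  ultimately have "((\<lambda>t. (dist_c (x 0) (x t) - dist_c (x 0) (x 0)) /\<^sub>R t) \<longlongrightarrow> sqrt c) (at_right 0)"
    by (rule Lim_transform_eventually)
  moreover have "sqrt c = norm X / sqrt (fact CARD('m))" by (simp add: c_def real_sqrt_divide)
  ultimately show ?thesis by (simp add: has_vector_derivative_at_right_iff)
qed

text \<open>Thus the canonical metric is the Euclidean metric of the space of Pluecker vectors, divided by a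
  constant. The right derivative of the distance to the starting point depends on the path only
  through the length of its velocity, which makes the value in the definition of
  \<^const>\<open>metric_c\<close> unique.\<close>

lemma metric_c_velocity:
  fixes x :: "real \<Rightarrow> (real, 'm::finite \<Rightarrow> 'k::finite) vec"
  assumes "open T" "0 \<in> T" "smooth_on T x" "x ` T \<subseteq> oriented_grassmannian"
  shows "metric_c (x 0) (vector_derivative x (at 0)) = (norm (vector_derivative x (at 0)))\<^sup>2 / fact CARD('m)"
proof -
  have val: "(vector_derivative (\<lambda>t. dist_c (z 0) (z t)) (at_right 0))\<^sup>2 = (norm (vector_derivative z (at 0)))\<^sup>2 / fact CARD('m)"
    if "open S" "0 \<in> S" "smooth_on S z" "z ` S \<subseteq> oriented_grassmannian" for S and z :: "real \<Rightarrow> (real, 'm \<Rightarrow> 'k) vec"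
  proof -
    have "z differentiable (at 0)" using smooth_on_has_derivative[OF that(3,2)] by (auto simp: differentiable_def)
    then have "(z has_vector_derivative vector_derivative z (at 0)) (at 0)" by (simp add: vector_derivative_works)
    from dist_c_right_derivative[OF that(1,2,4) this] have
      "vector_derivative (\<lambda>t. dist_c (z 0) (z t)) (at_right 0) = norm (vector_derivative z (at 0)) / sqrt (fact CARD('m))"
      by (intro vector_derivative_within) auto
    then show ?thesis by (simp add: power_divide)
  qed
  show ?thesis
    unfolding metric_c_def
  proof (rule the_equality)
    show "\<exists>T z. open T \<and> 0 \<in> T \<and> smooth_on T z \<and> z ` T \<subseteq> oriented_grassmannian \<and> z 0 = x 0 \<and>
      vector_derivative z (at 0) = vector_derivative x (at 0) \<and>
      (norm (vector_derivative x (at 0)))\<^sup>2 / fact CARD('m) = (vector_derivative (\<lambda>t. dist_c (z 0) (z t)) (at_right 0))\<^sup>2"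
      using assms val[OF assms] by metis
  qed (use val in metis)
qed

section \<open>Local geometry of an immersion\<close>

lemma smooth_on_pderiv: "smooth_on V h \<Longrightarrow> smooth_on V (pderiv_at i h)"
  unfolding pderiv_at_def[abs_def] by (rule smooth_on_derivative)

lemma pderiv_atI: "(h has_derivative h') (at u) \<Longrightarrow> pderiv_at i h u = h' (axis i 1)"
  unfolding pderiv_at_def by (metis frechet_derivative_at)

lemma pderiv_at_cong:
  assumes "open V" "u \<in> V" "\<And>y. y \<in> V \<Longrightarrow> h y = g y" "smooth_on V h"
  shows "pderiv_at i h u = pderiv_at i g u"
proof -
  have "(g has_derivative fderiv h u) (at u)"
    using has_derivative_transform_within_open[OF smooth_on_has_derivative[OF assms(4,2)] assms(1,2)] assms(3) by blast
  then show ?thesis by (metis pderiv_atI pderiv_at_def)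
qed

lemma pderiv_at_commute:
  assumes "open V" "smooth_on V h" "u \<in> V"
  shows "pderiv_at i (pderiv_at j h) u = pderiv_at j (pderiv_at i h) u"
  using symmetric_second_derivative[OF assms(1) smooth_onD[OF assms(2)] assms(3), of "axis j 1" "axis i 1"]
  by (simp add: pderiv_at_def[abs_def])

lemma pderiv_at_inner:
  assumes "smooth_on V h" "smooth_on V g" "u \<in> V"
  shows "pderiv_at i (\<lambda>y. h y \<bullet> g y) u = h u \<bullet> pderiv_at i g u + pderiv_at i h u \<bullet> g u"
  by (rule pderiv_atI[where h' = "\<lambda>d. h u \<bullet> fderiv g u d + fderiv h u d \<bullet> g u", unfolded pderiv_at_def[symmetric]])
    (intro has_derivative_inner smooth_on_has_derivative[OF assms(1,3)] smooth_on_has_derivative[OF assms(2,3)])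

lemma linear_axis_expansion:
  fixes v :: "real^'m::finite"
  assumes "linear L"
  shows "L v = (\<Sum>i\<in>UNIV. v $ i *\<^sub>R L (axis i 1))"
proof -
  have "v = (\<Sum>i\<in>UNIV. v $ i *\<^sub>R axis i 1)"
    by (simp add: vec_eq_iff axis_def if_distrib cong: if_cong)
  then have "L v = L (\<Sum>i\<in>UNIV. v $ i *\<^sub>R axis i 1)" by simp
  then show ?thesis using assms by (simp add: linear_sum linear_scale)
qed

lemma matrix_inv_inverse:
  fixes G :: "real^'m^'m::finite"
  assumes "det G \<noteq> 0"
  shows "G ** matrix_inv G = mat 1" "matrix_inv G ** G = mat 1"
proof -
  have "\<exists>A'. G ** A' = mat 1 \<and> A' ** G = mat 1"
    using assms by (simp add: invertible_det_nz[symmetric] invertible_def)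
  from someI_ex[OF this] show "G ** matrix_inv G = mat 1" "matrix_inv G ** G = mat 1"
    by (simp_all add: matrix_inv_def)
qed

lemma smooth_on_sum:
  "open S \<Longrightarrow> (\<And>i. i \<in> I \<Longrightarrow> smooth_on S (f i)) \<Longrightarrow> smooth_on S (\<lambda>x. \<Sum>i\<in>I. f i x)"
  by (simp add: smooth_on_def Ck_on_sum)

lemma smooth_on_scaleR:
  "open S \<Longrightarrow> smooth_on S f \<Longrightarrow> smooth_on S g \<Longrightarrow> smooth_on S (\<lambda>x. f x *\<^sub>R g x)"
  by (simp add: smooth_on_def Ck_on_scaleR)

lemma smooth_on_inner:
  "open S \<Longrightarrow> smooth_on S f \<Longrightarrow> smooth_on S g \<Longrightarrow> smooth_on S (\<lambda>x. f x \<bullet> g x)"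
  by (simp add: smooth_on_def Ck_on_inner)

lemma smooth_on_const: "smooth_on S (\<lambda>x. c)"
  by (simp add: smooth_on_def Ck_on_const)

lemma sum_rotate: "(\<Sum>i\<in>I. \<Sum>l\<in>L. \<Sum>s\<in>S. F i l s) = (\<Sum>l\<in>L. \<Sum>s\<in>S. \<Sum>i\<in>I. F i l s)"
proof -
  have "(\<Sum>i\<in>I. \<Sum>l\<in>L. \<Sum>s\<in>S. F i l s) = (\<Sum>l\<in>L. \<Sum>i\<in>I. \<Sum>s\<in>S. F i l s)" by (rule sum.swap)
  also have "\<dots> = (\<Sum>l\<in>L. \<Sum>s\<in>S. \<Sum>i\<in>I. F i l s)" by (rule sum.cong[OF refl], rule sum.swap)
  finally show ?thesis .
qed

text \<open>One chart of an immersed submanifold. The Gauss equation is a statement about such a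
  chart.\<close>

locale parametrized_immersion =
  fixes V :: "(real^'m::finite) set" and \<Phi> :: "real^'m \<Rightarrow> 'e::euclidean_space"
  assumes open_V: "open V" and smooth: "smooth_on V \<Phi>"
    and inj_derivative: "\<And>u. u \<in> V \<Longrightarrow> inj (fderiv \<Phi> u)"
begin

text \<open>The vectors \<open>E i\<close> form the coordinate frame, and \<open>H i j\<close> are the
  second partial derivatives.\<close>

abbreviation "E i \<equiv> pderiv_at i \<Phi>"
abbreviation "H i j \<equiv> pderiv_at i (pderiv_at j \<Phi>)"
abbreviation "g \<equiv> induced_metric \<Phi>"
abbreviation "ginv u \<equiv> matrix_inv (g u)"

text \<open>The dual frame makes the calculation transparent: the Christoffel symbols are its inner products
  with the second derivatives of \<open>\<Phi>\<close>, so that their derivatives can be computed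
  by the product rule.\<close>

definition dual_frame :: "'m \<Rightarrow> real^'m \<Rightarrow> 'e" where
  "dual_frame l u = (\<Sum>s\<in>UNIV. ginv u $ l $ s *\<^sub>R E s u)"

text \<open>The orthogonal projection to the normal space, written with the frame so that it is visibly
  linear.\<close>

definition normal_part :: "real^'m \<Rightarrow> 'e \<Rightarrow> 'e" where
  "normal_part u z = z - (\<Sum>l\<in>UNIV. (dual_frame l u \<bullet> z) *\<^sub>R E l u)"

lemma linear_derivative: "u \<in> V \<Longrightarrow> linear (fderiv \<Phi> u)"
  using smooth by (rule smooth_on_linear_derivative)

lemma derivative_eq: "u \<in> V \<Longrightarrow> fderiv \<Phi> u v = (\<Sum>i\<in>UNIV. v $ i *\<^sub>R E i u)"
  using linear_axis_expansion[OF linear_derivative] by (simp add: pderiv_at_def)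

lemma smooth_E: "smooth_on V (E i)" and smooth_H: "smooth_on V (H i j)"
  using smooth by (auto intro: smooth_on_pderiv)

lemma g_component: "g u $ i $ j = E i u \<bullet> E j u"
  by (simp add: induced_metric_def)

lemma quadratic_form_g:
  assumes "u \<in> V"
  shows "v \<bullet> (g u *v w) = fderiv \<Phi> u v \<bullet> fderiv \<Phi> u w"
  unfolding derivative_eq[OF assms]
  by (simp add: inner_vec_def matrix_vector_mult_def g_component inner_sum_left inner_sum_right
      sum_distrib_left mult_ac) (rule sum.swap)

lemma det_g: "det (g u) \<noteq> 0" if u: "u \<in> V"
proof -
  have "v = 0" if "g u *v v = 0" for v
  proof -
    have "fderiv \<Phi> u v = 0"
      using quadratic_form_g[OF u, of v v] that by simp
    then show ?thesis
      using inj_derivative[OF u] linear_derivative[OF u] by (metis linear_injective_0)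
  qed
  then show ?thesis
    using matrix_left_invertible_ker invertible_left_inverse invertible_det_nz by blast
qed

lemma ginv: assumes "u \<in> V" shows "g u ** ginv u = mat 1" "ginv u ** g u = mat 1"
  using matrix_inv_inverse[OF det_g[OF assms]] by auto

lemma ginv_sum: "u \<in> V \<Longrightarrow> (\<Sum>l\<in>UNIV. (E k u \<bullet> E l u) * ginv u $ l $ s) = (if k = s then 1 else 0)"
  and ginv_sum': "u \<in> V \<Longrightarrow> (\<Sum>s\<in>UNIV. ginv u $ l $ s * (E s u \<bullet> E k u)) = (if l = k then 1 else 0)"
  using ginv[of u] by (auto simp: vec_eq_iff matrix_matrix_mult_def g_component mat_def)

text \<open>Contracting a bilinear form with the inverse metric is taking its trace in an orthonormal basis of
  the tangent space.\<close>

lemma orthonormal_frame_ginv: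
  fixes Q :: "real^'m^'m"
  assumes u: "u \<in> V"
    and on: "\<And>a b. fderiv \<Phi> u (Q $ a) \<bullet> fderiv \<Phi> u (Q $ b) = (if a = b then 1 else 0)"
  shows "(\<Sum>a\<in>UNIV. Q $ a $ l * Q $ a $ s) = ginv u $ l $ s"
proof -
  have "(Q ** g u ** transpose Q) $ a $ b = Q $ a \<bullet> (g u *v Q $ b)" for a b
    by (simp add: matrix_mul_assoc[symmetric] matrix_matrix_mult_def matrix_vector_mult_def transpose_def inner_vec_def
        sum_distrib_left sum_distrib_right mult.assoc) (rule sum.swap)
  then have "Q ** g u ** transpose Q = mat 1"
    using quadratic_form_g[OF u] on by (simp add: vec_eq_iff mat_def)
  then have "g u ** transpose Q ** Q = mat 1"
    by (metis matrix_left_right_inverse matrix_mul_assoc)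
  then have "transpose Q ** Q = ginv u"
    using ginv(2)[OF u] by (metis matrix_mul_assoc matrix_mul_lid matrix_mul_rid)
  then show ?thesis
    by (simp add: matrix_matrix_mult_def transpose_def flip: \<open>transpose Q ** Q = ginv u\<close>)
qed

lemma smooth_ginv: "smooth_on V (\<lambda>u. ginv u $ l $ s)"
proof -
  have "Ck_on n V (\<lambda>u. ginv u *v axis s 1)" for n
  proof (rule Ck_on_linear_solution[OF open_V, where B = g and w = "\<lambda>u. axis s 1"])
    show "Ck_on n V (\<lambda>u. g u $ i $ j)" for i j
      unfolding g_component by (intro Ck_on_inner open_V smooth_onD smooth_E)
    show "det (g u) \<noteq> 0" "g u *v (ginv u *v axis s 1) = axis s 1" if "u \<in> V" for u
      using det_g[OF that] ginv[OF that] by (auto simp: matrix_vector_mul_assoc)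
  qed (rule Ck_on_const)
  then have "Ck_on n V (\<lambda>u. (ginv u *v axis s 1) \<bullet> axis l 1)" for n
    by (intro Ck_on_inner open_V Ck_on_const)
  moreover have "(ginv u *v axis s 1) \<bullet> axis l 1 = ginv u $ l $ s" for u
    by (simp add: inner_axis) (simp add: matrix_vector_mult_def axis_def if_distrib cong: if_cong)
  ultimately show ?thesis by (simp add: smooth_on_def)
qed

lemma smooth_dual_frame: "smooth_on V (dual_frame l)"
  unfolding dual_frame_def[abs_def]
  by (intro smooth_on_sum smooth_on_scaleR open_V smooth_ginv smooth_E)

lemma dual_frame_E: "u \<in> V \<Longrightarrow> dual_frame l u \<bullet> E k u = (if l = k then 1 else 0)"
  using ginv_sum' by (simp add: dual_frame_def inner_sum_left)

lemma normal_part_E: "u \<in> V \<Longrightarrow> normal_part u z \<bullet> E k u = 0"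
proof -
  assume u: "u \<in> V"
  have "(\<Sum>l\<in>UNIV. (dual_frame l u \<bullet> z) * (E l u \<bullet> E k u)) =
      (\<Sum>l\<in>UNIV. \<Sum>s\<in>UNIV. (E s u \<bullet> z) * ((E k u \<bullet> E l u) * ginv u $ l $ s))"
    by (simp add: dual_frame_def inner_sum_left sum_distrib_left sum_distrib_right inner_commute[of "E k u"] mult_ac)
  also have "\<dots> = (\<Sum>s\<in>UNIV. (E s u \<bullet> z) * (\<Sum>l\<in>UNIV. (E k u \<bullet> E l u) * ginv u $ l $ s))"
    by (subst sum.swap) (simp add: sum_distrib_left)
  also have "\<dots> = z \<bullet> E k u"
    unfolding ginv_sum[OF u] by (simp add: if_distrib inner_commute cong: if_cong)
  finally show ?thesis
    by (simp add: normal_part_def inner_diff_left inner_sum_left)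
qed

lemma tangential_expansion: "z = (\<Sum>l\<in>UNIV. (dual_frame l u \<bullet> z) *\<^sub>R E l u) + normal_part u z"
  by (simp add: normal_part_def)

lemma normal_part_inner: "u \<in> V \<Longrightarrow> normal_part u z \<bullet> w = normal_part u z \<bullet> normal_part u w"
  by (subst tangential_expansion[of w u]) (simp add: inner_add_right inner_sum_right normal_part_E)

lemma linear_normal_part: "linear (normal_part u)"
  by (rule linearI) (simp_all add: normal_part_def inner_add_right scaleR_add_left sum.distrib
      scaleR_sum_right scaleR_diff_right algebra_simps)

lemma normal_component_eq:
  assumes u: "u \<in> V"
  shows "normal_component (range (fderiv \<Phi> u)) z = normal_part u z"
proof -
  let ?D = "fderiv \<Phi> u"
  have lin: "linear ?D" using u by (rule linear_derivative)
  have perp: "normal_part u z \<bullet> ?D v = 0" for v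
    by (simp add: derivative_eq[OF u] inner_sum_right normal_part_E[OF u])
  have "z - normal_part u z = ?D (\<chi> l. dual_frame l u \<bullet> z)"
    by (simp add: normal_part_def derivative_eq[OF u])
  then have tan: "z - normal_part u z \<in> range ?D" by simp
  show ?thesis
    unfolding normal_component_def
  proof (rule the_equality)
    fix n assume n: "z - n \<in> range ?D \<and> (\<forall>X\<in>range ?D. n \<bullet> X = 0)"
    then obtain a b where "z - n = ?D a" "z - normal_part u z = ?D b" using tan by auto
    then have eq: "normal_part u z - n = ?D (a - b)" using lin by (simp add: linear_diff algebra_simps)
    have "(normal_part u z - n) \<bullet> (normal_part u z - n) = (normal_part u z - n) \<bullet> ?D (a - b)"
      by (subst eq[symmetric]) (rule refl)
    also have "\<dots> = 0"
      using perp n by (simp add: inner_diff_left)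
    finally have "(normal_part u z - n) \<bullet> (normal_part u z - n) = 0" .
    then show "n = normal_part u z" by simp
  qed (use perp tan in auto)
qed

lemma second_fundamental_form_eq:
  "u \<in> V \<Longrightarrow> second_fundamental_form \<Phi> u i j = normal_part u (H i j u)"
  by (simp add: second_fundamental_form_def normal_component_eq)

lemma H_commute: "u \<in> V \<Longrightarrow> H i j u = H j i u"
  using pderiv_at_commute[OF open_V smooth] by blast

lemma pderiv_g: "u \<in> V \<Longrightarrow> pderiv_at k (\<lambda>y. g y $ i $ j) u = E i u \<bullet> H k j u + H k i u \<bullet> E j u"
  unfolding g_component using pderiv_at_inner[OF smooth_E smooth_E] by blast

lemma christoffel_eq:
  assumes u: "u \<in> V"
  shows "christoffel g u l i j = dual_frame l u \<bullet> H i j u"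
proof -
  have "pderiv_at i (\<lambda>y. g y $ j $ s) u + pderiv_at j (\<lambda>y. g y $ i $ s) u - pderiv_at s (\<lambda>y. g y $ i $ j) u
      = 2 * (E s u \<bullet> H i j u)" for s
    unfolding pderiv_g[OF u]
    using H_commute[OF u, of i j] H_commute[OF u, of s i] H_commute[OF u, of s j]
    by (simp add: inner_commute)
  then show ?thesis
    by (simp add: christoffel_def dual_frame_def inner_sum_left sum_distrib_left)
qed

text \<open>The dual frame moves tangentially by minus the Christoffel symbols, because its pairings with the
  coordinate frame are constant, and normally by the second fundamental form with one index raised.\<close>

lemma pderiv_dual_frame_inner:
  assumes u: "u \<in> V"
  shows "pderiv_at k (dual_frame l) u \<bullet> z =
    (\<Sum>s\<in>UNIV. ginv u $ l $ s * (normal_part u (H k s u) \<bullet> normal_part u z))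
    - (\<Sum>s\<in>UNIV. (dual_frame l u \<bullet> H k s u) * (dual_frame s u \<bullet> z))"
proof -
  have tan: "pderiv_at k (dual_frame l) u \<bullet> E s u = - (dual_frame l u \<bullet> H k s u)" for s
  proof -
    have "pderiv_at k (\<lambda>y. dual_frame l y \<bullet> E s y) u = pderiv_at k (\<lambda>y. if l = s then 1 else 0 :: real) u"
      by (rule pderiv_at_cong[OF open_V u]) (auto simp: dual_frame_E intro!: smooth_on_inner open_V smooth_dual_frame smooth_E)
    also have "\<dots> = 0" by (simp add: pderiv_at_def)
    finally show ?thesis using pderiv_at_inner[OF smooth_dual_frame smooth_E u] by simp
  qed
  have nor: "pderiv_at k (dual_frame l) u \<bullet> normal_part u z =
      (\<Sum>s\<in>UNIV. ginv u $ l $ s * (normal_part u (H k s u) \<bullet> normal_part u z))"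
  proof -
    have "(dual_frame l has_derivative (\<lambda>d. \<Sum>s\<in>UNIV.
        ginv u $ l $ s *\<^sub>R fderiv (E s) u d +
        fderiv (\<lambda>y. ginv y $ l $ s) u d *\<^sub>R E s u)) (at u)"
      unfolding dual_frame_def[abs_def]
      by (intro has_derivative_sum has_derivative_scaleR smooth_on_has_derivative[OF smooth_ginv u] smooth_on_has_derivative[OF smooth_E u])
    from pderiv_atI[OF this, of k]
    have "pderiv_at k (dual_frame l) u = (\<Sum>s\<in>UNIV. ginv u $ l $ s *\<^sub>R H k s u + pderiv_at k (\<lambda>y. ginv y $ l $ s) u *\<^sub>R E s u)"
      by (simp add: pderiv_at_def)
    moreover have "E s u \<bullet> normal_part u z = 0"
      "H k s u \<bullet> normal_part u z = normal_part u (H k s u) \<bullet> normal_part u z" for s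
      using normal_part_E[OF u] normal_part_inner[OF u] by (metis inner_commute)+
    ultimately show ?thesis
      by (simp add: inner_sum_left inner_add_left)
  qed
  show ?thesis
    by (subst tangential_expansion[of z u])
      (simp add: inner_add_right inner_sum_right tan nor sum_negf mult.commute)
qed

lemma pderiv_H_commute: "u \<in> V \<Longrightarrow> pderiv_at l (H i j) u = pderiv_at j (H i l) u"
proof -
  assume u: "u \<in> V"
  have "pderiv_at l (H i j) u = pderiv_at l (H j i) u"
    by (rule pderiv_at_cong[OF open_V u _ smooth_H]) (rule H_commute)
  also have "\<dots> = pderiv_at j (H l i) u"
    by (rule pderiv_at_commute[OF open_V smooth_E u])
  also have "\<dots> = pderiv_at j (H i l) u"
    by (rule pderiv_at_cong[OF open_V u _ smooth_H]) (rule H_commute)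
  finally show ?thesis .
qed

text \<open>In the difference of the derivatives of the Christoffel symbols, the third derivatives of
  \<open>\<Phi>\<close> cancel by symmetry, and the tangential motion of the dual frame cancels
  the products of Christoffel symbols in the definition of the Ricci tensor. What remains is the
  normal motion of the dual frame.\<close>

theorem gauss_equation_ricci:
  assumes u: "u \<in> V"
  shows "ricci_coeff g u i j =
    (\<Sum>l\<in>UNIV. \<Sum>s\<in>UNIV. ginv u $ l $ s *
      (normal_part u (H l s u) \<bullet> normal_part u (H i j u) - normal_part u (H j s u) \<bullet> normal_part u (H i l u)))"
proof -
  have ch: "pderiv_at k (\<lambda>y. christoffel g y l i j) u =
      dual_frame l u \<bullet> pderiv_at k (H i j) u +
      ((\<Sum>s\<in>UNIV. ginv u $ l $ s * (normal_part u (H k s u) \<bullet> normal_part u (H i j u)))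
       - (\<Sum>s\<in>UNIV. christoffel g u l k s * christoffel g u s i j))" for k l i j
  proof -
    have "pderiv_at k (\<lambda>y. christoffel g y l i j) u = pderiv_at k (\<lambda>y. dual_frame l y \<bullet> H i j y) u"
      by (rule pderiv_at_cong[OF open_V u, symmetric])
        (auto simp: christoffel_eq intro!: smooth_on_inner open_V smooth_dual_frame smooth_H)
    then show ?thesis
      by (simp add: pderiv_at_inner[OF smooth_dual_frame smooth_H u] pderiv_dual_frame_inner[OF u] christoffel_eq[OF u])
  qed
  show ?thesis
    unfolding ricci_coeff_def ch
    by (rule sum.cong[OF refl]) (simp add: pderiv_H_commute[OF u, of _ i j] sum_subtractf right_diff_distrib)
qed

text \<open>The trace of the second fundamental form is the mean curvature, so for a minimal immersion one of
  the two terms in the Gauss equation drops out.\<close>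

lemma ricci_minimal:
  assumes u: "u \<in> V" and minimal: "mean_curvature \<Phi> u = 0"
  shows "(\<Sum>i\<in>UNIV. \<Sum>j\<in>UNIV. ricci_coeff g u i j * v $ i * v $ j) =
    - (\<Sum>l\<in>UNIV. \<Sum>s\<in>UNIV. ginv u $ l $ s *
        (normal_part u (\<Sum>j\<in>UNIV. v $ j *\<^sub>R H j s u) \<bullet> normal_part u (\<Sum>i\<in>UNIV. v $ i *\<^sub>R H i l u)))"
proof -
  have trace: "(\<Sum>l\<in>UNIV. \<Sum>s\<in>UNIV. ginv u $ l $ s *\<^sub>R normal_part u (H l s u)) = 0"
    using minimal by (simp add: mean_curvature_def second_fundamental_form_eq[OF u])
  have "(\<Sum>l\<in>UNIV. \<Sum>s\<in>UNIV. ginv u $ l $ s * (normal_part u (H l s u) \<bullet> n)) = 0" for n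
  proof -
    have "(\<Sum>l\<in>UNIV. \<Sum>s\<in>UNIV. ginv u $ l $ s *\<^sub>R normal_part u (H l s u)) \<bullet> n = 0"
      using trace by simp
    then show ?thesis by (simp add: inner_sum_left)
  qed
  then have R: "ricci_coeff g u i j =
      - (\<Sum>l\<in>UNIV. \<Sum>s\<in>UNIV. ginv u $ l $ s * (normal_part u (H j s u) \<bullet> normal_part u (H i l u)))" for i j
    unfolding gauss_equation_ricci[OF u] by (simp add: right_diff_distrib sum_subtractf)
  have lin: "normal_part u (\<Sum>j\<in>UNIV. v $ j *\<^sub>R H j s u) = (\<Sum>j\<in>UNIV. v $ j *\<^sub>R normal_part u (H j s u))" for s
    by (simp add: linear_sum[OF linear_normal_part] linear_scale[OF linear_normal_part])
  define B where "B i l = normal_part u (H i l u)" for i l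
  have "(\<Sum>i\<in>UNIV. \<Sum>j\<in>UNIV. ricci_coeff g u i j * v $ i * v $ j) =
      - (\<Sum>i\<in>UNIV. \<Sum>j\<in>UNIV. \<Sum>l\<in>UNIV. \<Sum>s\<in>UNIV. ginv u $ l $ s * (v $ j * (v $ i * (B j s \<bullet> B i l))))"
    unfolding R B_def[symmetric] by (simp add: sum_distrib_right sum_distrib_left sum_negf mult_ac)
  also have "(\<Sum>i\<in>UNIV. \<Sum>j\<in>UNIV. \<Sum>l\<in>UNIV. \<Sum>s\<in>UNIV. ginv u $ l $ s * (v $ j * (v $ i * (B j s \<bullet> B i l)))) =
      (\<Sum>i\<in>UNIV. \<Sum>l\<in>UNIV. \<Sum>s\<in>UNIV. \<Sum>j\<in>UNIV. ginv u $ l $ s * (v $ j * (v $ i * (B j s \<bullet> B i l))))"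
    by (rule sum.cong[OF refl], rule sum_rotate)
  also have "\<dots> = (\<Sum>l\<in>UNIV. \<Sum>s\<in>UNIV. \<Sum>i\<in>UNIV. \<Sum>j\<in>UNIV. ginv u $ l $ s * (v $ j * (v $ i * (B j s \<bullet> B i l))))"
    by (rule sum_rotate)
  finally show ?thesis
    by (simp add: lin B_def[symmetric] inner_sum_left inner_sum_right sum_distrib_left mult.left_commute)
qed

end

section \<open>Varying the rows of a frame\<close>

lemma wedge_linear_image:
  fixes L :: "real^'m::finite \<Rightarrow> real^'k::finite" and Q :: "real^'m^'m"
  assumes "linear L"
  shows "wedge (\<chi> i. L (Q $ i)) = det Q *\<^sub>R wedge (\<chi> i. L (axis i 1))"
proof -
  have "L (Q $ i) $ k = (\<Sum>j\<in>UNIV. Q $ i $ j * L (axis j 1) $ k)" for i k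
    by (subst linear_axis_expansion[OF assms]) simp
  then have "(\<chi> i. L (Q $ i)) = Q ** (\<chi> i. L (axis i 1))"
    by (simp add: vec_eq_iff matrix_matrix_mult_def)
  then show ?thesis by (simp add: wedge_matrix_mult)
qed

text \<open>The Gauss map is defined through oriented orthonormal bases of the tangent space. A wrong
  orientation is corrected by reversing one vector.\<close>

lemma oriented_orthonormal_basis_exists:
  fixes L :: "real^'m::finite \<Rightarrow> real^'k::finite"
  assumes lin: "linear L" and inj: "inj L"
  obtains Q :: "real^'m^'m" where "det Q > 0" "orthonormal_frame (\<chi> i. L (Q $ i))"
proof -
  have sub: "subspace (range L)" using lin by (simp add: linear_subspace_image)
  obtain B where B: "B \<subseteq> range L" "pairwise orthogonal B" "\<And>b. b \<in> B \<Longrightarrow> norm b = 1"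
    "independent B" "card B = dim (range L)"
    using orthonormal_basis_subspace[OF sub] by metis
  have "dim (range L) = CARD('m)"
    using dim_image_eq[OF lin, of UNIV] inj by simp
  then obtain q :: "'m \<Rightarrow> real^'k" where q: "bij_betw q UNIV B"
    using B(5) independent_imp_finite[OF B(4)] by (metis finite_same_card_bij finite_class.finite_UNIV)
  have qB: "q i \<in> B" for i using q by (auto simp: bij_betw_def)
  have orth: "q i \<bullet> q j = (if i = j then 1 else 0)" for i j
  proof (cases "i = j")
    case True
    then show ?thesis using B(3) qB by (simp add: norm_eq_1[symmetric])
  next
    case False
    then have "q i \<noteq> q j" using q by (auto simp: bij_betw_def inj_on_def)
    then show ?thesis using B(2) qB False by (simp add: pairwise_def orthogonal_def)
  qed
  have "\<forall>i. \<exists>w. L w = q i" using B(1) qB by (metis imageE subsetD)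
  then obtain w where w: "\<And>i. L (w i) = q i" by metis
  define Q :: "real^'m^'m" where "Q = (\<chi> i. w i)"
  have fr: "orthonormal_frame (\<chi> i. L (Q $ i))" by (simp add: orthonormal_frame_def Q_def w orth)
  have nz: "det Q \<noteq> 0"
  proof
    assume "det Q = 0"
    then have "wedge (\<chi> i. L (Q $ i)) = 0" by (simp add: wedge_linear_image[OF lin])
    then show False using norm_wedge_orthonormal[OF fr] by simp
  qed
  show ?thesis
  proof (cases "det Q > 0")
    case True then show ?thesis using that fr by blast
  next
    case False
    \<comment> \<open>reverse one vector, say the one with index \<open>a\<close>\<close>
    fix a :: 'm
    define Q' :: "real^'m^'m" where "Q' = (\<chi> i. if i = a then (-1) *s Q $ a else Q $ i)"
    have "det Q' = - det (\<chi> i. if i = a then Q $ a else Q $ i)"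
      unfolding Q'_def using det_row_mul[of a "-1" "\<lambda>i. Q $ a" "\<lambda>i. Q $ i"] by simp
    also have "(\<chi> i. if i = a then Q $ a else Q $ i) = Q" by (simp add: vec_eq_iff)
    finally have "det Q' > 0" using nz False by simp
    moreover have "L (Q' $ i) = (if i = a then - L (Q $ i) else L (Q $ i))" for i
      using lin by (simp add: Q'_def linear_neg[OF lin, symmetric])
    then have "orthonormal_frame (\<chi> i. L (Q' $ i))" using fr by (auto simp: orthonormal_frame_def)
    ultimately show ?thesis using that by blast
  qed
qed

text \<open>The Pluecker vector of a frame with one row replaced; these are the terms in the derivative of a
  Pluecker vector.\<close>

definition wedge_row :: "'m::finite \<Rightarrow> real^'k^'m \<Rightarrow> real^'k \<Rightarrow> (real, 'm \<Rightarrow> 'k::finite) vec" where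
  "wedge_row a \<xi> z = wedge (\<chi> i. if i = a then z else \<xi> $ i)"

lemma wedge_row_component:
  "wedge_row a \<xi> z $ I = det (\<chi> i. if i = a then (\<chi> j. z $ I j) else (\<chi> j. \<xi> $ i $ I j))"
  unfolding wedge_row_def wedge_def
  by simp (rule arg_cong[where f = det], simp add: vec_eq_iff)

lemma linear_wedge_row:
  fixes \<xi> :: "real^'k::finite^'m::finite"
  shows "linear (wedge_row a \<xi>)"
proof (rule linearI)
  fix z w :: "real^'k" and c :: real
  have add: "((\<chi> j. (z + w) $ I j) :: real^'m) = (\<chi> j. z $ I j) + (\<chi> j. w $ I j)"
    and mul: "((\<chi> j. (c *\<^sub>R z) $ I j) :: real^'m) = c *s (\<chi> j. z $ I j)" for I :: "'m \<Rightarrow> 'k"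
    by (simp_all add: vec_eq_iff)
  have "wedge_row a \<xi> (z + w) $ I = wedge_row a \<xi> z $ I + wedge_row a \<xi> w $ I" for I
    by (simp only: wedge_row_component add det_row_add)
  then show "wedge_row a \<xi> (z + w) = wedge_row a \<xi> z + wedge_row a \<xi> w"
    by (simp add: vec_eq_iff)
  have "wedge_row a \<xi> (c *\<^sub>R z) $ I = c * wedge_row a \<xi> z $ I" for I
    by (simp only: wedge_row_component mul det_row_mul)
  then show "wedge_row a \<xi> (c *\<^sub>R z) = c *\<^sub>R wedge_row a \<xi> z"
    by (simp add: vec_eq_iff)
qed

lemma wedge_row_frame:
  fixes \<xi> :: "real^'k::finite^'m::finite"
  shows "wedge_row a \<xi> (\<xi> $ c) = (if c = a then wedge \<xi> else 0)"
proof (cases "c = a")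
  case True
  have "(\<chi> i. if i = a then \<xi> $ a else \<xi> $ i) = \<xi>" by (simp add: vec_eq_iff)
  then show ?thesis using True by (simp add: wedge_row_def)
next
  case False
  have "det (\<chi> i. if i = a then (\<chi> j. \<xi> $ c $ I j) else (\<chi> j. \<xi> $ i $ I j)) = 0" for I :: "'m \<Rightarrow> 'k"
    by (rule det_identical_rows[of a c]) (use False in \<open>auto simp: row_def\<close>)
  then show ?thesis using False by (simp add: vec_eq_iff wedge_row_component)
qed

lemma inner_wedge_row_wedge:
  assumes "\<And>j. n \<bullet> \<xi> $ j = 0"
  shows "wedge_row a \<xi> n \<bullet> wedge \<xi> = 0"
proof -
  have "det (\<chi> j i. (\<chi> i. if i = a then n else \<xi> $ i) $ j \<bullet> \<xi> $ i) = 0"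
    by (rule det_zero_row(2)[of a]) (simp add: row_def assms vec_eq_iff)
  then show ?thesis by (simp add: wedge_row_def inner_wedge)
qed

text \<open>Replacing different rows of an orthonormal frame by normal vectors gives orthogonal Pluecker
  vectors, since the matrix of inner products then has a zero column.\<close>

lemma inner_wedge_rows:
  fixes \<xi> :: "real^'k::finite^'m::finite"
  assumes on: "orthonormal_frame \<xi>" and n: "\<And>j. n \<bullet> \<xi> $ j = 0" and n': "\<And>j. n' \<bullet> \<xi> $ j = 0"
  shows "wedge_row a \<xi> n \<bullet> wedge_row b \<xi> n' = (if a = b then fact CARD('m) * (n \<bullet> n') else 0)"
proof -
  let ?G = "(\<chi> j i. (\<chi> i. if i = a then n else \<xi> $ i) $ j \<bullet> (\<chi> i. if i = b then n' else \<xi> $ i) $ i) :: real^'m^'m"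
  have n'': "\<xi> $ j \<bullet> n' = 0" for j using n'[of j] by (simp add: inner_commute)
  have o: "\<xi> $ i \<bullet> \<xi> $ j = (if i = j then 1 else 0)" for i j using on by (simp add: orthonormal_frame_def)
  have "det ?G = (if a = b then n \<bullet> n' else 0)"
  proof (cases "a = b")
    case True
    have "det ?G = (\<Prod>i\<in>UNIV. ?G $ i $ i)"
      by (rule det_diagonal) (use True n n'' o in auto)
    also have "\<dots> = (\<Prod>i\<in>UNIV. if i = a then n \<bullet> n' else 1)"
      using True o by (intro prod.cong) auto
    finally show ?thesis using True by simp
  next
    case False
    have "column a ?G = 0" using False n o by (auto simp: column_def vec_eq_iff)
    then show ?thesis using False det_zero_column(2) by auto
  qed
  then show ?thesis by (simp add: wedge_row_def inner_wedge)
qed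

text \<open>The Pluecker vector is multilinear in the rows, hence differentiated one row at a time. In
  coordinates the product rule distributes the derivative over columns; a permutation reindexes
  columns by rows.\<close>

lemma has_derivative_wedge:
  fixes \<xi> :: "'a::euclidean_space \<Rightarrow> real^'k::finite^'m::finite"
  assumes d: "\<And>i. ((\<lambda>y. \<xi> y $ i) has_derivative \<xi>' i) (at u)"
  shows "((\<lambda>y. wedge (\<xi> y)) has_derivative (\<lambda>h. \<Sum>a\<in>UNIV. wedge_row a (\<xi> u) (\<xi>' a h))) (at u)"
proof -
  let ?S = "{p. p permutes (UNIV::'m set)}"
  have comp: "((\<lambda>y. wedge (\<xi> y) $ I) has_derivative (\<lambda>h. (\<Sum>a\<in>UNIV. wedge_row a (\<xi> u) (\<xi>' a h)) $ I)) (at u)" for I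
  proof -
    have d': "((\<lambda>y. \<xi> y $ i $ k) has_derivative (\<lambda>h. \<xi>' i h $ k)) (at u)" for i k
      using bounded_linear.has_derivative[OF bounded_linear_vec_nth d] .
    have "((\<lambda>y. \<Sum>p\<in>?S. of_int (sign p) * (\<Prod>j\<in>UNIV. \<xi> y $ p j $ I j)) has_derivative
      (\<lambda>h. \<Sum>p\<in>?S. of_int (sign p) * (\<Sum>j\<in>UNIV. \<xi>' (p j) h $ I j * (\<Prod>i\<in>UNIV - {j}. \<xi> u $ p i $ I i)))) (at u)"
      by (intro has_derivative_sum has_derivative_mult_right has_derivative_prod d')
    moreover have "(\<Sum>p\<in>?S. of_int (sign p) * (\<Sum>j\<in>UNIV. \<xi>' (p j) h $ I j * (\<Prod>i\<in>UNIV - {j}. \<xi> u $ p i $ I i))) =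
        (\<Sum>a\<in>UNIV. wedge_row a (\<xi> u) (\<xi>' a h)) $ I" for h
    proof -
      have 1: "(\<Sum>j\<in>UNIV. \<xi>' (p j) h $ I j * (\<Prod>i\<in>UNIV - {j}. \<xi> u $ p i $ I i)) =
          (\<Sum>a\<in>UNIV. \<Prod>i\<in>UNIV. (\<chi> i. if i = a then \<xi>' a h else \<xi> u $ i) $ p i $ I i)" if "p \<in> ?S" for p
      proof -
        have p: "bij p" using that by (simp add: permutes_bij)
        have "(\<Sum>a\<in>UNIV. \<Prod>i\<in>UNIV. (\<chi> i. if i = a then \<xi>' a h else \<xi> u $ i) $ p i $ I i) =
            (\<Sum>j\<in>UNIV. \<Prod>i\<in>UNIV. (\<chi> i. if i = p j then \<xi>' (p j) h else \<xi> u $ i) $ p i $ I i)"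
          using p by (rule sum.reindex_bij_betw[symmetric])
        also have "\<dots> = (\<Sum>j\<in>UNIV. \<xi>' (p j) h $ I j * (\<Prod>i\<in>UNIV - {j}. \<xi> u $ p i $ I i))"
        proof (rule sum.cong[OF refl])
          fix j
          have "(\<Prod>i\<in>UNIV. (\<chi> i. if i = p j then \<xi>' (p j) h else \<xi> u $ i) $ p i $ I i) =
              (\<chi> i. if i = p j then \<xi>' (p j) h else \<xi> u $ i) $ p j $ I j *
              (\<Prod>i\<in>UNIV - {j}. (\<chi> i. if i = p j then \<xi>' (p j) h else \<xi> u $ i) $ p i $ I i)"
            by (rule prod.remove) auto
          also have "(\<Prod>i\<in>UNIV - {j}. (\<chi> i. if i = p j then \<xi>' (p j) h else \<xi> u $ i) $ p i $ I i) =
              (\<Prod>i\<in>UNIV - {j}. \<xi> u $ p i $ I i)"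
            using p by (intro prod.cong refl) (auto simp: bij_def inj_def)
          finally show "(\<Prod>i\<in>UNIV. (\<chi> i. if i = p j then \<xi>' (p j) h else \<xi> u $ i) $ p i $ I i) =
              \<xi>' (p j) h $ I j * (\<Prod>i\<in>UNIV - {j}. \<xi> u $ p i $ I i)" by simp
        qed
        finally show ?thesis by simp
      qed
      have "(\<Sum>p\<in>?S. of_int (sign p) * (\<Sum>j\<in>UNIV. \<xi>' (p j) h $ I j * (\<Prod>i\<in>UNIV - {j}. \<xi> u $ p i $ I i))) =
          (\<Sum>p\<in>?S. of_int (sign p) * (\<Sum>a\<in>UNIV. \<Prod>i\<in>UNIV. (\<chi> i. if i = a then \<xi>' a h else \<xi> u $ i) $ p i $ I i))"
        by (rule sum.cong[OF refl]) (simp only: 1)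
      also have "\<dots> = (\<Sum>a\<in>UNIV. \<Sum>p\<in>?S. of_int (sign p) * (\<Prod>i\<in>UNIV. (\<chi> i. if i = a then \<xi>' a h else \<xi> u $ i) $ p i $ I i))"
        unfolding sum_distrib_left by (rule sum.swap)
      also have "\<dots> = (\<Sum>a\<in>UNIV. wedge_row a (\<xi> u) (\<xi>' a h)) $ I"
        unfolding wedge_row_def sum_component wedge_component ..
      finally show ?thesis .
    qed
    ultimately show ?thesis unfolding wedge_component[of "\<xi> _"] by simp
  qed
  show ?thesis
    unfolding has_derivative_componentwise_within[of "\<lambda>y. wedge (\<xi> y)"]
  proof
    fix b :: "(real, 'm \<Rightarrow> 'k) vec" assume "b \<in> Basis"
    then obtain I where "b = axis I 1" by (auto simp: Basis_vec_def)
    then show "((\<lambda>y. wedge (\<xi> y) \<bullet> b) has_derivative (\<lambda>h. (\<Sum>a\<in>UNIV. wedge_row a (\<xi> u) (\<xi>' a h)) \<bullet> b)) (at u)"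
      using comp[of I] by (simp add: inner_axis del: sum_component)
  qed
qed

section \<open>Charts\<close>

lemma chartD:
  assumes "oriented_smooth_manifold M A" "(V, x) \<in> A"
  shows "open V" "openin (top_of_set M) (x ` V)" "inj_on x V" "continuous_on V x" "x ` V \<subseteq> M"
    "continuous_on (x ` V) (the_inv_into V x)" "\<exists>y. homeomorphism V (x ` V) x y"
proof -
  from assms show V: "open V" "openin (top_of_set M) (x ` V)" "\<exists>y. homeomorphism V (x ` V) x y"
    by (auto simp: oriented_smooth_manifold_def)
  then obtain y where y: "homeomorphism V (x ` V) x y" by blast
  then show "continuous_on V x" by (simp add: homeomorphism_def)
  show inj: "inj_on x V" using y by (metis homeomorphism_def inj_on_inverseI)
  show "x ` V \<subseteq> M" using V(2) by (rule openin_imp_subset)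
  have "the_inv_into V x z = y z" if "z \<in> x ` V" for z
    using that y inj by (auto simp: homeomorphism_def the_inv_into_f_f)
  then show "continuous_on (x ` V) (the_inv_into V x)"
    using y by (subst continuous_on_cong[OF refl, of _ _ y]) (auto simp: homeomorphism_def)
qed

lemma chart_covers:
  assumes "oriented_smooth_manifold M A" "p \<in> M"
  obtains V x u where "(V, x) \<in> A" "u \<in> V" "x u = p"
  using assms unfolding oriented_smooth_manifold_def by force

lemma immersionD:
  assumes "immersion A F" "(V, x) \<in> A"
  shows "smooth_on V (F \<circ> x)" "u \<in> V \<Longrightarrow> inj (fderiv (F \<circ> x) u)"
  using assms by (auto simp: immersion_def)

lemma chart_transition:
  assumes M: "oriented_smooth_manifold M A" and c: "(V, x) \<in> A" "(W, y) \<in> A"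
  defines "D \<equiv> {u \<in> V. x u \<in> y ` W}" and "\<tau> \<equiv> \<lambda>u. the_inv_into W y (x u)"
  shows "open D" "smooth_on D \<tau>" "\<And>u. u \<in> D \<Longrightarrow> det (matrix (fderiv \<tau> u)) > 0"
    "\<And>u. u \<in> D \<Longrightarrow> \<tau> u \<in> W \<and> y (\<tau> u) = x u"
proof -
  note V = chartD[OF M c(1)] and W = chartD[OF M c(2)]
  have "openin (top_of_set V) (V \<inter> x -` (y ` W))"
    using continuous_openin_preimage[OF V(4) _ W(2)] V(5) by auto
  moreover have "V \<inter> x -` (y ` W) = D" by (auto simp: D_def)
  ultimately show "open D" using V(1) by (simp add: openin_open_eq)
  have "(let D = {u \<in> V. x u \<in> y ` W}; \<tau> = (\<lambda>u. the_inv_into W y (x u))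
        in smooth_on D \<tau> \<and> (\<forall>u\<in>D. det (matrix (fderiv \<tau> u)) > 0))"
    using M c unfolding oriented_smooth_manifold_def by fast
  then show "smooth_on D \<tau>" "\<And>u. u \<in> D \<Longrightarrow> det (matrix (fderiv \<tau> u)) > 0"
    unfolding D_def \<tau>_def Let_def by blast+
  show "\<tau> u \<in> W \<and> y (\<tau> u) = x u" if "u \<in> D" for u
    using that W(3) unfolding D_def \<tau>_def by (auto simp: the_inv_into_f_f)
qed

text \<open>The differentials of any map \<open>F\<close> in two charts are related by the differential of the
  parameter change, which does not involve \<open>F\<close>. Hence the value of the differential
  of the Gauss map on a tangent vector, given as a vector of the Euclidean space, is independent
  of the chart.\<close>

lemma chart_transition_derivative:
  assumes M: "oriented_smooth_manifold M A" and c: "(V, x) \<in> A" "(W, y) \<in> A" and F: "smooth_on W (F \<circ> y)"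
    and u: "u \<in> V" "x u \<in> y ` W"
  shows "fderiv (F \<circ> x) u v =
    fderiv (F \<circ> y) (the_inv_into W y (x u))
      (fderiv (\<lambda>u. the_inv_into W y (x u)) u v)"
proof -
  define D where "D = {u \<in> V. x u \<in> y ` W}"
  define \<tau> where "\<tau> = (\<lambda>u. the_inv_into W y (x u))"
  have D: "open D" "smooth_on D \<tau>" "\<And>u. u \<in> D \<Longrightarrow> \<tau> u \<in> W \<and> y (\<tau> u) = x u"
    using chart_transition[OF M c] unfolding D_def \<tau>_def by blast+
  have uD: "u \<in> D" using u by (simp add: D_def)
  have "((\<lambda>z. (F \<circ> y) (\<tau> z)) has_derivative
      (\<lambda>v. fderiv (F \<circ> y) (\<tau> u) (fderiv \<tau> u v))) (at u)"
    using diff_chain_at[OF smooth_on_has_derivative[OF D(2) uD] smooth_on_has_derivative[OF F]] D(3)[OF uD]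
    by (simp add: o_def)
  then have "((F \<circ> x) has_derivative
      (\<lambda>v. fderiv (F \<circ> y) (\<tau> u) (fderiv \<tau> u v))) (at u)"
    by (rule has_derivative_transform_within_open[OF _ D(1) uD]) (use D(3) in auto)
  then have "(\<lambda>v. fderiv (F \<circ> y) (\<tau> u) (fderiv \<tau> u v)) = fderiv (F \<circ> x) u"
    by (rule frechet_derivative_at)
  from fun_cong[OF this, of v] show ?thesis unfolding \<tau>_def by (rule sym)
qed

section \<open>Gauss map\<close>

text \<open>Both sides are positive multiples of the Pluecker vector of the coordinate frame, and they have
  the same norm.\<close>

lemma oriented_basis_wedge_unique:
  fixes L :: "real^'m::finite \<Rightarrow> real^'k::finite" and Q R :: "real^'m^'m"
  assumes lin: "linear L" and Q: "det Q > 0" "orthonormal_frame (\<chi> i. L (Q $ i))"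
    and R: "det R > 0" "orthonormal_frame (\<chi> i. L (R $ i))"
  shows "wedge (\<chi> i. L (Q $ i)) = wedge (\<chi> i. L (R $ i))"
proof -
  let ?w = "wedge (\<chi> i. L (axis i 1))"
  have "norm (wedge (\<chi> i. L (Q $ i))) = norm (wedge (\<chi> i. L (R $ i)))"
    using norm_wedge_orthonormal[OF Q(2)] norm_wedge_orthonormal[OF R(2)]
    by (metis norm_ge_zero power2_eq_imp_eq)
  then have "det Q * norm ?w = det R * norm ?w"
    using Q(1) R(1) by (simp add: wedge_linear_image[OF lin])
  moreover have "norm ?w \<noteq> 0"
    using norm_wedge_orthonormal[OF Q(2)] by (auto simp: wedge_linear_image[OF lin])
  ultimately show ?thesis by (simp add: wedge_linear_image[OF lin])
qed

lemma gauss_map_eq: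
  fixes f :: "'p::{second_countable_topology, t2_space} \<Rightarrow> real^'k::finite" and A :: "('p, 'm::finite) atlas"
  assumes M: "oriented_smooth_manifold M A" and f: "immersion A f" and c: "(V, x) \<in> A" and u: "u \<in> V"
    and Q: "det Q > 0" "orthonormal_frame (\<chi> i. fderiv (f \<circ> x) u (Q $ i))"
  shows "gauss_map A f (x u) = wedge (\<chi> i. fderiv (f \<circ> x) u (Q $ i))"
  unfolding gauss_map_def
proof (rule the_equality)
  show "\<exists>(V, y)\<in>A. \<exists>w\<in>V. \<exists>v :: real^'m^'m. y w = x u \<and> det v > 0 \<and>
     oriented_basis (wedge (\<chi> i. fderiv (f \<circ> x) u (Q $ i))) (\<chi> i. fderiv (f \<circ> y) w (v $ i))"
    using c u Q by (intro bexI[of _ "(V, x)"]) (auto simp: oriented_basis_def intro!: bexI[of _ u] exI[of _ Q])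
next
  fix P
  assume "\<exists>(V, y)\<in>A. \<exists>w\<in>V. \<exists>v :: real^'m^'m. y w = x u \<and> det v > 0 \<and>
     oriented_basis P (\<chi> i. fderiv (f \<circ> y) w (v $ i))"
  then obtain W y w and R :: "real^'m^'m" where c': "(W, y) \<in> A" and w: "w \<in> W" "y w = x u" and R: "det R > 0"
    "orthonormal_frame (\<chi> i. fderiv (f \<circ> y) w (R $ i))"
    and P: "P = wedge (\<chi> i. fderiv (f \<circ> y) w (R $ i))"
    by (auto simp: oriented_basis_def)
  define \<tau> where "\<tau> = (\<lambda>u. the_inv_into W y (x u))"
  have uD: "u \<in> V" "x u \<in> y ` W" using u w by (auto intro: rev_image_eqI)
  have \<tau>u: "the_inv_into W y (x u) = w"
    using w chartD(3)[OF M c'] by (metis the_inv_into_f_f)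
  define T where "T = fderiv \<tau> u"
  have dpos: "det (matrix T) > 0" using chart_transition(3)[OF M c c'] uD by (simp add: T_def \<tau>_def)
  have "smooth_on {u \<in> V. x u \<in> y ` W} \<tau>" using chart_transition(2)[OF M c c'] by (simp add: \<tau>_def)
  then have linT: "linear T" unfolding T_def by (rule smooth_on_linear_derivative) (use uD in auto)
  have chain: "fderiv (f \<circ> x) u v = fderiv (f \<circ> y) w (T v)" for v
    using chart_transition_derivative[OF M c c' immersionD(1)[OF f c'] uD] by (simp add: \<tau>u T_def \<tau>_def)
  define Q' where "Q' = (\<chi> i. T (Q $ i))"
  have "T (Q $ i) $ k = (\<Sum>j\<in>UNIV. Q $ i $ j * T (axis j 1) $ k)" for i k
    by (subst linear_axis_expansion[OF linT]) simp
  then have "Q' = Q ** transpose (matrix T)"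
    by (simp add: Q'_def vec_eq_iff matrix_matrix_mult_def transpose_def matrix_def)
  then have "det Q' > 0" using Q(1) dpos by (simp add: det_mul)
  moreover have "(\<chi> i. fderiv (f \<circ> x) u (Q $ i)) = (\<chi> i. fderiv (f \<circ> y) w (Q' $ i))"
    by (simp add: vec_eq_iff chain Q'_def)
  moreover have "linear (fderiv (f \<circ> y) w)"
    using immersionD(1)[OF f c'] w(1) by (rule smooth_on_linear_derivative)
  ultimately show "P = wedge (\<chi> i. fderiv (f \<circ> x) u (Q $ i))"
    unfolding P using Q(2) R by (metis oriented_basis_wedge_unique)
qed

lemma parametrized_immersion_chart:
  "oriented_smooth_manifold M A \<Longrightarrow> immersion A f \<Longrightarrow> (V, x) \<in> A \<Longrightarrow> parametrized_immersion V (f \<circ> x)"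
  using chartD(1)[of M A V x] by (auto simp: parametrized_immersion_def immersion_def)

text \<open>An orthonormal basis of the tangent space at \<open>u\<close>, with constant coefficients
  \<open>Q\<close>, is a frame that moves with the point. The tangential part of its velocity only
  rescales the Pluecker vector. The normal parts replace one row each and are mutually orthogonal,
  so the squared norm of the remainder is the sum of their squared norms, which is a trace of the
  square of the second fundamental form.\<close>

lemma norm_wedge_velocity:
  fixes \<Phi> :: "real^'m::finite \<Rightarrow> real^'k::finite" and Q :: "real^'m^'m" and v :: "real^'m"
  assumes im: "parametrized_immersion V \<Phi>" and u: "u \<in> V"
    and on: "orthonormal_frame (\<chi> a. fderiv \<Phi> u (Q $ a))"
  defines "h s \<equiv> \<Sum>j\<in>UNIV. v $ j *\<^sub>R pderiv_at j (pderiv_at s \<Phi>) u"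
  obtains W' t Z where "((\<lambda>y. wedge (\<chi> a. fderiv \<Phi> y (Q $ a))) has_derivative W') (at u)"
    "W' v = t *\<^sub>R wedge (\<chi> a. fderiv \<Phi> u (Q $ a)) + Z"
    "Z \<bullet> wedge (\<chi> a. fderiv \<Phi> u (Q $ a)) = 0"
    "(norm Z)\<^sup>2 = fact CARD('m) * (\<Sum>l\<in>UNIV. \<Sum>s\<in>UNIV. matrix_inv (induced_metric \<Phi> u) $ l $ s *
        (parametrized_immersion.normal_part \<Phi> u (h s) \<bullet> parametrized_immersion.normal_part \<Phi> u (h l)))"
proof -
  interpret parametrized_immersion V \<Phi> by (rule im)
  define L where "L = fderiv \<Phi> u"
  have linL: "linear L" using linear_derivative[OF u] by (simp add: L_def)
  define \<xi> where "\<xi> y = (\<chi> a. fderiv \<Phi> y (Q $ a))" for y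
  have \<xi>u: "\<xi> u $ a = L (Q $ a)" for a by (simp add: \<xi>_def L_def)
  have on': "orthonormal_frame (\<xi> u)" using on by (simp add: \<xi>_def)
  define \<eta> where "\<eta> a d = (\<Sum>b\<in>UNIV. Q $ a $ b *\<^sub>R fderiv (E b) u d)" for a d
  have d: "((\<lambda>y. \<xi> y $ a) has_derivative \<eta> a) (at u)" for a
  proof -
    have "((\<lambda>y. \<Sum>b\<in>UNIV. Q $ a $ b *\<^sub>R E b y) has_derivative \<eta> a) (at u)"
      unfolding \<eta>_def
      by (intro has_derivative_sum has_derivative_scaleR_right smooth_on_has_derivative[OF smooth_E u])
    then show ?thesis
      by (rule has_derivative_transform_within_open[OF _ open_V u]) (simp add: \<xi>_def derivative_eq)
  qed
  have \<eta>v: "\<eta> a v = (\<Sum>b\<in>UNIV. Q $ a $ b *\<^sub>R h b)" for a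
  proof -
    have "fderiv (E b) u v = h b" for b
      using linear_axis_expansion[OF smooth_on_linear_derivative[OF smooth_E u], of b v]
      by (simp add: h_def pderiv_at_def)
    then show ?thesis by (simp add: \<eta>_def)
  qed
  define n where "n a = normal_part u (\<eta> a v)" for a
  have n_eq: "n a = (\<Sum>b\<in>UNIV. Q $ a $ b *\<^sub>R normal_part u (h b))" for a
    by (simp add: n_def \<eta>v linear_sum[OF linear_normal_part] linear_scale[OF linear_normal_part])
  have perp: "n a \<bullet> L w = 0" for a w
    by (simp add: L_def derivative_eq[OF u] inner_sum_right n_def normal_part_E[OF u])
  have Qnz: "det Q \<noteq> 0"
  proof
    assume "det Q = 0"
    then have "wedge (\<chi> i. L (Q $ i)) = 0" by (simp add: wedge_linear_image[OF linL])
    then show False using norm_wedge_orthonormal[OF on] by (simp add: L_def)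
  qed
  have tangential: "\<exists>c. wedge_row a (\<xi> u) (L w) = c *\<^sub>R wedge (\<xi> u)" for a w
  proof -
    define c where "c = matrix_inv (transpose Q) *v w"
    have "transpose Q *v c = w"
      using matrix_inv_inverse(1)[of "transpose Q"] Qnz by (simp add: c_def matrix_vector_mul_assoc)
    then have "w = (\<Sum>b\<in>UNIV. c $ b *\<^sub>R Q $ b)"
      by (auto simp: vec_eq_iff matrix_vector_mult_def transpose_def vector_matrix_mult_def mult.commute)
    then have "L w = (\<Sum>b\<in>UNIV. c $ b *\<^sub>R \<xi> u $ b)"
      by (simp add: linear_sum[OF linL] linear_scale[OF linL] \<xi>u)
    then have "wedge_row a (\<xi> u) (L w) = c $ a *\<^sub>R wedge (\<xi> u)"
      by (simp add: linear_sum[OF linear_wedge_row] linear_scale[OF linear_wedge_row] wedge_row_frame if_distrib cong: if_cong)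
    then show ?thesis ..
  qed
  define Z where "Z = (\<Sum>a\<in>UNIV. wedge_row a (\<xi> u) (n a))"
  have "\<exists>c. wedge_row a (\<xi> u) (\<eta> a v) = c *\<^sub>R wedge (\<xi> u) + wedge_row a (\<xi> u) (n a)" for a
  proof -
    have "\<eta> a v = L (\<chi> l. dual_frame l u \<bullet> \<eta> a v) + n a"
      by (simp add: n_def L_def derivative_eq[OF u] normal_part_def)
    then have "wedge_row a (\<xi> u) (\<eta> a v) = wedge_row a (\<xi> u) (L (\<chi> l. dual_frame l u \<bullet> \<eta> a v)) + wedge_row a (\<xi> u) (n a)"
      by (metis linear_add[OF linear_wedge_row])
    then show ?thesis using tangential by metis
  qed
  then obtain c where c: "\<And>a. wedge_row a (\<xi> u) (\<eta> a v) = c a *\<^sub>R wedge (\<xi> u) + wedge_row a (\<xi> u) (n a)"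
    by metis
  show ?thesis
  proof (rule that[of "\<lambda>d. \<Sum>a\<in>UNIV. wedge_row a (\<xi> u) (\<eta> a d)" "\<Sum>a\<in>UNIV. c a" Z])
    show "((\<lambda>y. wedge (\<chi> a. fderiv \<Phi> y (Q $ a))) has_derivative
        (\<lambda>d. \<Sum>a\<in>UNIV. wedge_row a (\<xi> u) (\<eta> a d))) (at u)"
      using has_derivative_wedge[OF d] by (simp add: \<xi>_def)
    show "(\<Sum>a\<in>UNIV. wedge_row a (\<xi> u) (\<eta> a v)) = (\<Sum>a\<in>UNIV. c a) *\<^sub>R wedge (\<chi> a. fderiv \<Phi> u (Q $ a)) + Z"
      unfolding c Z_def by (simp add: sum.distrib scaleR_sum_left \<xi>_def)
    have np: "n a \<bullet> \<xi> u $ j = 0" for a j by (simp add: \<xi>u perp)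
    show "Z \<bullet> wedge (\<chi> a. fderiv \<Phi> u (Q $ a)) = 0"
      using inner_wedge_row_wedge[OF np] by (simp add: Z_def inner_sum_left \<xi>_def)
    have "(norm Z)\<^sup>2 = (\<Sum>a\<in>UNIV. \<Sum>b\<in>UNIV. wedge_row a (\<xi> u) (n a) \<bullet> wedge_row b (\<xi> u) (n b))"
      by (simp add: power2_norm_eq_inner Z_def inner_sum_left inner_sum_right) (rule sum.swap)
    also have "\<dots> = fact CARD('m) * (\<Sum>a\<in>UNIV. n a \<bullet> n a)"
      by (simp add: inner_wedge_rows[OF on' np np] sum_distrib_left)
    also have "(\<Sum>a\<in>UNIV. n a \<bullet> n a) = (\<Sum>a\<in>UNIV. \<Sum>l\<in>UNIV. \<Sum>s\<in>UNIV. (Q $ a $ l * Q $ a $ s) * (normal_part u (h s) \<bullet> normal_part u (h l)))"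
      by (simp add: n_eq inner_sum_left inner_sum_right sum_distrib_left inner_commute mult_ac)
    also have "\<dots> = (\<Sum>l\<in>UNIV. \<Sum>s\<in>UNIV. (\<Sum>a\<in>UNIV. Q $ a $ l * Q $ a $ s) * (normal_part u (h s) \<bullet> normal_part u (h l)))"
      by (subst sum_rotate) (simp add: sum_distrib_right)
    also have "\<dots> = (\<Sum>l\<in>UNIV. \<Sum>s\<in>UNIV. ginv u $ l $ s * (normal_part u (h s) \<bullet> normal_part u (h l)))"
      using on' by (simp add: orthonormal_frame_ginv[OF u] orthonormal_frame_def \<xi>u L_def)
    finally show "(norm Z)\<^sup>2 = fact CARD('m) * (\<Sum>l\<in>UNIV. \<Sum>s\<in>UNIV. ginv u $ l $ s * (normal_part u (h s) \<bullet> normal_part u (h l)))" .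
  qed
qed

text \<open>Near \<open>u\<close> the moving Pluecker vector \<open>W\<close> is a scalar multiple of the
  Gauss map \<open>\<gamma>\<close>. Since \<open>\<gamma>\<close> has constant norm, its velocity
  is orthogonal to it, so it is the component of the velocity of \<open>W\<close> orthogonal to
  \<open>\<gamma>\<close>.\<close>

lemma norm_gauss_map_derivative:
  fixes f :: "'p::{second_countable_topology, t2_space} \<Rightarrow> real^'k::finite" and A :: "('p, 'm::finite) atlas"
    and v :: "real^'m"
  assumes M: "oriented_smooth_manifold M A" and f: "immersion A f" and gm: "immersion A (gauss_map A f)"
    and c: "(V, x) \<in> A" and u: "u \<in> V"
  defines "h s \<equiv> \<Sum>j\<in>UNIV. v $ j *\<^sub>R pderiv_at j (pderiv_at s (f \<circ> x)) u"
  shows "(norm (fderiv (gauss_map A f \<circ> x) u v))\<^sup>2 / fact CARD('m) =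
    (\<Sum>l\<in>UNIV. \<Sum>s\<in>UNIV. matrix_inv (induced_metric (f \<circ> x) u) $ l $ s *
      (parametrized_immersion.normal_part (f \<circ> x) u (h s) \<bullet> parametrized_immersion.normal_part (f \<circ> x) u (h l)))"
proof -
  define \<Phi> where "\<Phi> = f \<circ> x"
  have im: "parametrized_immersion V \<Phi>" using parametrized_immersion_chart[OF M f c] by (simp add: \<Phi>_def)
  interpret parametrized_immersion V \<Phi> by (rule im)
  define \<gamma> where "\<gamma> = gauss_map A f \<circ> x"
  have \<gamma>: "\<exists>Q. det Q > 0 \<and> orthonormal_frame (\<chi> i. fderiv \<Phi> y (Q $ i)) \<and>
      \<gamma> y = wedge (\<chi> i. fderiv \<Phi> y (Q $ i))" if y: "y \<in> V" for y
  proof -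
    obtain Q where "det Q > 0" "orthonormal_frame (\<chi> i. fderiv \<Phi> y (Q $ i))"
      using oriented_orthonormal_basis_exists[OF linear_derivative[OF y] inj_derivative[OF y]] by blast
    then show ?thesis
      using gauss_map_eq[OF M f c y] by (auto simp: \<gamma>_def \<Phi>_def)
  qed
  then have norm_\<gamma>: "\<gamma> y \<bullet> \<gamma> y = fact CARD('m)" if "y \<in> V" for y
    using that norm_wedge_orthonormal by (metis power2_norm_eq_inner)
  obtain Q where Q: "det Q > 0" "orthonormal_frame (\<chi> i. fderiv \<Phi> u (Q $ i))"
    "\<gamma> u = wedge (\<chi> i. fderiv \<Phi> u (Q $ i))"
    using \<gamma>[OF u] by blast
  define W where "W y = wedge (\<chi> i. fderiv \<Phi> y (Q $ i))" for y
  obtain W' t Z where W': "(W has_derivative W') (at u)" "W' v = t *\<^sub>R \<gamma> u + Z" "Z \<bullet> \<gamma> u = 0"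
    and Z: "(norm Z)\<^sup>2 = fact CARD('m) * (\<Sum>l\<in>UNIV. \<Sum>s\<in>UNIV. ginv u $ l $ s *
        (normal_part u (h s) \<bullet> normal_part u (h l)))"
    using norm_wedge_velocity[OF im u Q(2), of v] unfolding Q(3)[symmetric] W_def[symmetric, abs_def] h_def \<Phi>_def[symmetric] by blast
  \<comment> \<open>the factor in \<open>W = s \<gamma>\<close>, written as an inner product to see that it is differentiable\<close>
  define s where "s y = (W y \<bullet> \<gamma> y) / fact CARD('m)" for y
  have W: "W y = s y *\<^sub>R \<gamma> y" if y: "y \<in> V" for y
  proof -
    obtain R where R: "det R > 0" "\<gamma> y = wedge (\<chi> i. fderiv \<Phi> y (R $ i))"
      using \<gamma>[OF y] by blast
    have "W y = (det Q / det R) *\<^sub>R \<gamma> y"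
      using R(1) unfolding W_def R(2) by (simp add: wedge_linear_image[OF linear_derivative[OF y]])
    then show ?thesis by (simp add: s_def norm_\<gamma>[OF y])
  qed
  define \<gamma>' where "\<gamma>' = fderiv \<gamma> u"
  have d\<gamma>: "(\<gamma> has_derivative \<gamma>') (at u)"
    using smooth_on_has_derivative[OF immersionD(1)[OF gm c] u] by (simp add: \<gamma>_def \<gamma>'_def)
  have "((\<lambda>y. \<gamma> y \<bullet> \<gamma> y) has_derivative (\<lambda>d. \<gamma> u \<bullet> \<gamma>' d + \<gamma>' d \<bullet> \<gamma> u)) (at u)"
    by (intro has_derivative_inner d\<gamma>)
  then have "((\<lambda>y. fact CARD('m) :: real) has_derivative (\<lambda>d. \<gamma> u \<bullet> \<gamma>' d + \<gamma>' d \<bullet> \<gamma> u)) (at u)"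
    by (rule has_derivative_transform_within_open[OF _ open_V u]) (simp add: norm_\<gamma>)
  then have "(\<lambda>d. \<gamma> u \<bullet> \<gamma>' d + \<gamma>' d \<bullet> \<gamma> u) = (\<lambda>d. 0)"
    using has_derivative_const has_derivative_unique by blast
  then have orth: "\<gamma>' v \<bullet> \<gamma> u = 0"
    by (metis (no_types, lifting) inner_commute mult_2 mult_eq_0_iff zero_neq_numeral)
  obtain s' where ds: "(s has_derivative s') (at u)"
  proof
    show "(s has_derivative (\<lambda>d. (W u \<bullet> \<gamma>' d + W' d \<bullet> \<gamma> u) / fact CARD('m))) (at u)"
      unfolding s_def[abs_def] divide_inverse by (intro has_derivative_mult_left has_derivative_inner W'(1) d\<gamma>)
  qed
  have su: "s u = 1" by (simp add: s_def W_def Q(3)[symmetric] norm_\<gamma>[OF u])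
  have "((\<lambda>y. s y *\<^sub>R \<gamma> y) has_derivative (\<lambda>d. s u *\<^sub>R \<gamma>' d + s' d *\<^sub>R \<gamma> u)) (at u)"
    by (intro has_derivative_scaleR ds d\<gamma>)
  then have "(W has_derivative (\<lambda>d. s u *\<^sub>R \<gamma>' d + s' d *\<^sub>R \<gamma> u)) (at u)"
    by (rule has_derivative_transform_within_open[OF _ open_V u]) (simp add: W)
  then have "W' = (\<lambda>d. s u *\<^sub>R \<gamma>' d + s' d *\<^sub>R \<gamma> u)" using W'(1) has_derivative_unique by blast
  then have "\<gamma>' v + s' v *\<^sub>R \<gamma> u = t *\<^sub>R \<gamma> u + Z" using W'(2) su by simp
  then have eq: "\<gamma>' v - Z = (t - s' v) *\<^sub>R \<gamma> u" by (simp add: algebra_simps)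
  have "(\<gamma>' v - Z) \<bullet> \<gamma> u = 0" using orth W'(3) by (simp add: inner_diff_left)
  then have "(t - s' v) * fact CARD('m) = 0" unfolding eq by (simp add: norm_\<gamma>[OF u])
  then have "\<gamma>' v = Z" using eq by simp
  then show ?thesis using Z by (simp add: \<gamma>'_def \<gamma>_def \<Phi>_def)
qed

text \<open>Obata's identity. The Ricci tensor according to the Gauss equation and the squared speed of the
  Gauss map are, up to sign, the same trace of the square of the second fundamental form.\<close>

theorem ricci_gauss_map:
  fixes f :: "'p::{second_countable_topology, t2_space} \<Rightarrow> real^'k::finite" and A :: "('p, 'm::finite) atlas"
  assumes M: "oriented_smooth_manifold M A" and f: "immersion A f" and gm: "immersion A (gauss_map A f)"
    and minimal: "minimal_submanifold A f" and c: "(V, x) \<in> A" and u: "u \<in> V"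
  shows "(\<Sum>i\<in>UNIV. \<Sum>j\<in>UNIV. ricci_coeff (induced_metric (f \<circ> x)) u i j * v $ i * v $ j) =
    - (norm (fderiv (gauss_map A f \<circ> x) u v))\<^sup>2 / fact CARD('m)"
proof -
  interpret parametrized_immersion V "f \<circ> x" using parametrized_immersion_chart[OF M f c] .
  have "mean_curvature (f \<circ> x) u = 0" using minimal c u by (auto simp: minimal_submanifold_def)
  from ricci_minimal[OF u this, of v] show ?thesis
    using norm_gauss_map_derivative[OF M f gm c u, of v] by simp
qed

text \<open>The right-hand side depends only on the tangent vector \<open>X\<close>, and this settles that the
  Ricci tensor does not depend on the chart.\<close>

lemma Ric_eq:
  fixes f :: "'p::{second_countable_topology, t2_space} \<Rightarrow> real^'k::finite" and A :: "('p, 'm::finite) atlas"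
  assumes M: "oriented_smooth_manifold M A" and f: "immersion A f" and gm: "immersion A (gauss_map A f)"
    and minimal: "minimal_submanifold A f" and c: "(V, x) \<in> A" and u: "u \<in> V"
    and X: "fderiv (f \<circ> x) u v = X"
  shows "Ric A f (x u) X X = - (norm (fderiv (gauss_map A f \<circ> x) u v))\<^sup>2 / fact CARD('m)"
  unfolding Ric_def
proof (rule the_equality)
  show "\<exists>(W, y)\<in>A. \<exists>w\<in>W. \<exists>v' v''. y w = x u \<and> fderiv (f \<circ> y) w v' = X \<and>
     fderiv (f \<circ> y) w v'' = X \<and>
     - (norm (fderiv (gauss_map A f \<circ> x) u v))\<^sup>2 / fact CARD('m) =
     (\<Sum>i\<in>UNIV. \<Sum>j\<in>UNIV. ricci_coeff (induced_metric (f \<circ> y)) w i j * v' $ i * v'' $ j)"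
    by (rule bexI[OF _ c]) (use u X ricci_gauss_map[OF M f gm minimal c u, of v] in \<open>auto intro!: bexI[of _ u] exI[of _ v]\<close>)
next
  fix r
  assume "\<exists>(W, y)\<in>A. \<exists>w\<in>W. \<exists>v' v''. y w = x u \<and> fderiv (f \<circ> y) w v' = X \<and>
     fderiv (f \<circ> y) w v'' = X \<and>
     r = (\<Sum>i\<in>UNIV. \<Sum>j\<in>UNIV. ricci_coeff (induced_metric (f \<circ> y)) w i j * v' $ i * v'' $ j)"
  then obtain W y w v' v'' where c': "(W, y) \<in> A" and w: "w \<in> W" "y w = x u" and v': "fderiv (f \<circ> y) w v' = X"
    "fderiv (f \<circ> y) w v'' = X"
    and r: "r = (\<Sum>i\<in>UNIV. \<Sum>j\<in>UNIV. ricci_coeff (induced_metric (f \<circ> y)) w i j * v' $ i * v'' $ j)"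
    by auto
  have inj: "inj (fderiv (f \<circ> y) w)" by (rule immersionD(2)[OF f c' w(1)])
  have "v'' = v'" using v' inj by (simp add: inj_def)
  then have r': "r = - (norm (fderiv (gauss_map A f \<circ> y) w v'))\<^sup>2 / fact CARD('m)"
    using r ricci_gauss_map[OF M f gm minimal c' w(1), of v'] by simp
  have uD: "u \<in> V" "x u \<in> y ` W" using u w by (auto intro: rev_image_eqI)
  have \<tau>u: "the_inv_into W y (x u) = w"
    using w chartD(3)[OF M c'] by (metis the_inv_into_f_f)
  have "fderiv (f \<circ> y) w (fderiv (\<lambda>u. the_inv_into W y (x u)) u v) = X"
    using chart_transition_derivative[OF M c c' immersionD(1)[OF f c'] uD, of v] X by (simp add: \<tau>u)
  then have "fderiv (\<lambda>u. the_inv_into W y (x u)) u v = v'"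
    using v' inj by (simp add: inj_def)
  then show "r = - (norm (fderiv (gauss_map A f \<circ> x) u v))\<^sup>2 / fact CARD('m)"
    using chart_transition_derivative[OF M c c' immersionD(1)[OF gm c'] uD, of v] by (simp add: r' \<tau>u)
qed

section \<open>Curves and the length distance\<close>

lemma smooth_on_has_vector_derivative:
  fixes h :: "real \<Rightarrow> 'e::euclidean_space"
  assumes "smooth_on T h" "t \<in> T"
  shows "(h has_vector_derivative fderiv h t 1) (at t)"
proof -
  have d: "(h has_derivative fderiv h t) (at t)"
    using assms by (rule smooth_on_has_derivative)
  have "fderiv h t = (\<lambda>s. s *\<^sub>R fderiv h t 1)"
  proof
    fix s :: real
    have "fderiv h t (s *\<^sub>R 1) = s *\<^sub>R fderiv h t 1"
      by (rule linear_scale[OF smooth_on_linear_derivative[OF assms]])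
    then show "fderiv h t s = s *\<^sub>R fderiv h t 1" by simp
  qed
  then show ?thesis using d by (simp add: has_vector_derivative_def)
qed

lemma smooth_on_affine: "smooth_on S (\<lambda>t::real. m * t + k)" if "open S"
  using that by (auto simp: smooth_on_def intro!: Ck_on_add Ck_on_mult Ck_on_const Ck_on_id)

text \<open>The distance and the completeness concern the induced metric of an immersed manifold, and the
  ambient space can be any Euclidean space.\<close>

locale immersed_manifold =
  fixes M :: "'p::{second_countable_topology, t2_space} set"
    and A :: "('p, 'm::finite) atlas"
    and f :: "'p \<Rightarrow> 'e::euclidean_space"
  assumes manifold: "oriented_smooth_manifold M A" and immersed: "immersion A f"
begin

text \<open>A curve smooth on a closed interval is the restriction of a path that is smooth on an open set,
  \<open>smooth_path\<close> below.\<close>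

abbreviation "smooth_arc \<equiv> smooth_curve_manifold M A"

lemma continuous_on_manifold:
  assumes F: "\<And>V x. (V, x) \<in> A \<Longrightarrow> continuous_on V (F \<circ> x)"
  shows "continuous_on M F"
proof -
  have "\<exists>U. open U \<and> p \<in> U \<and> continuous_on (M \<inter> U) F" if p: "p \<in> M" for p
  proof -
    obtain V x u where x: "(V, x) \<in> A" "u \<in> V" "x u = p" using chart_covers[OF manifold p] by blast
    note ch = chartD[OF manifold x(1)]
    obtain U where U: "open U" "x ` V = M \<inter> U" using ch(2) by (auto simp: openin_open)
    have "continuous_on (x ` V) (\<lambda>z. (F \<circ> x) (the_inv_into V x z))"
      using ch(3) by (intro continuous_on_compose2[OF F[OF x(1)] ch(6)]) (auto simp: the_inv_into_f_f)
    then have "continuous_on (x ` V) F"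
      by (subst continuous_on_cong[OF refl, of _ _ "\<lambda>z. (F \<circ> x) (the_inv_into V x z)"])
        (auto simp: the_inv_into_f_f[OF ch(3)])
    then show ?thesis using U x(2,3) by auto
  qed
  then have "continuous (at p within M) F" if "p \<in> M" for p
  proof -
    obtain U where U: "open U" "p \<in> U" "continuous_on (M \<inter> U) F"
      using \<open>\<And>p. p \<in> M \<Longrightarrow> \<exists>U. open U \<and> p \<in> U \<and> continuous_on (M \<inter> U) F\<close> \<open>p \<in> M\<close> by blast
    then have "continuous (at p within (M \<inter> U)) F"
      using \<open>p \<in> M\<close> by (simp add: continuous_on_eq_continuous_within)
    moreover have "at p within (M \<inter> U) = at p within M"
      by (rule at_within_nhd[OF U(2,1)]) auto
    ultimately show ?thesis by simp
  qed
  then show ?thesis by (simp add: continuous_on_eq_continuous_within)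
qed

definition smooth_path :: "real set \<Rightarrow> (real \<Rightarrow> 'p) \<Rightarrow> bool" where
  "smooth_path T c \<longleftrightarrow> open T \<and> continuous_on T c \<and> c ` T \<subseteq> M \<and>
    (\<forall>(V, x)\<in>A. smooth_on {t \<in> T. c t \<in> x ` V} (\<lambda>t. the_inv_into V x (c t)))"

lemma smooth_arc_iff: "smooth_arc c a b \<longleftrightarrow> (\<exists>T c'. smooth_path T c' \<and> {a..b} \<subseteq> T \<and> (\<forall>t\<in>{a..b}. c' t = c t))"
  unfolding smooth_curve_manifold_def smooth_path_def by blast

lemma smooth_pathD:
  assumes "smooth_path T c"
  shows "open T" "continuous_on T c" "c ` T \<subseteq> M"
    "(V, x) \<in> A \<Longrightarrow> smooth_on {t \<in> T. c t \<in> x ` V} (\<lambda>t. the_inv_into V x (c t))"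
    "(V, x) \<in> A \<Longrightarrow> open {t \<in> T. c t \<in> x ` V}"
proof -
  show *: "open T" "continuous_on T c" "c ` T \<subseteq> M"
    "(V, x) \<in> A \<Longrightarrow> smooth_on {t \<in> T. c t \<in> x ` V} (\<lambda>t. the_inv_into V x (c t))"
    using assms by (auto simp: smooth_path_def)
  assume x: "(V, x) \<in> A"
  have "openin (top_of_set T) (T \<inter> c -` (x ` V))"
    using continuous_openin_preimage[OF *(2) _ chartD(2)[OF manifold x]] *(3) by auto
  moreover have "T \<inter> c -` (x ` V) = {t \<in> T. c t \<in> x ` V}" by auto
  ultimately show "open {t \<in> T. c t \<in> x ` V}" using *(1) by (simp add: openin_open_eq)
qed

lemma smooth_arc_continuous: "smooth_arc c a b \<Longrightarrow> continuous_on {a..b} c"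
  and smooth_arc_in_M: "smooth_arc c a b \<Longrightarrow> t \<in> {a..b} \<Longrightarrow> c t \<in> M"
proof -
  assume "smooth_arc c a b"
  then obtain T c' where T: "smooth_path T c'" "{a..b} \<subseteq> T" "\<forall>t\<in>{a..b}. c' t = c t"
    unfolding smooth_arc_iff by blast
  show "continuous_on {a..b} c"
    by (rule continuous_on_eq[OF continuous_on_subset[OF smooth_pathD(2)[OF T(1)] T(2)]]) (use T(3) in auto)
  show "t \<in> {a..b} \<Longrightarrow> c t \<in> M" using smooth_pathD(3)[OF T(1)] T(2,3) by (metis image_subset_iff subsetD)
qed

lemma smooth_arc_subinterval: "smooth_arc c a b \<Longrightarrow> {a'..b'} \<subseteq> {a..b} \<Longrightarrow> smooth_arc c a' b'"
  unfolding smooth_arc_iff by blast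

lemma smooth_arc_cong: "smooth_arc c a b \<Longrightarrow> (\<And>t. t \<in> {a..b} \<Longrightarrow> c t = d t) \<Longrightarrow> smooth_arc d a b"
  unfolding smooth_arc_iff by simp

lemma smooth_arc_const: "p \<in> M \<Longrightarrow> smooth_arc (\<lambda>_. p) a b"
  unfolding smooth_arc_iff smooth_path_def
  by (rule exI[of _ UNIV], rule exI[of _ "\<lambda>_. p"]) (auto simp: smooth_on_const)

lemma smooth_path_affine:
  assumes "smooth_path T c"
  shows "smooth_path ((\<lambda>t. m * t + k) -` T) (\<lambda>t. c (m * t + k))"
proof -
  note T = smooth_pathD[OF assms]
  define \<phi> where "\<phi> t = m * t + k" for t
  have sm: "smooth_on UNIV \<phi>" unfolding \<phi>_def[abs_def] by (rule smooth_on_affine) simp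
  then have cont: "continuous_on UNIV \<phi>" by (rule smooth_on_continuous)
  have pre: "open (\<phi> -` S)" if "open S" for S using that cont by (rule open_vimage)
  have "smooth_on {t \<in> \<phi> -` T. c (\<phi> t) \<in> x ` V} (\<lambda>t. the_inv_into V x (c (\<phi> t)))" if "(V, x) \<in> A" for V x
  proof -
    have eq: "{t \<in> \<phi> -` T. c (\<phi> t) \<in> x ` V} = \<phi> -` {t \<in> T. c t \<in> x ` V}" by auto
    show ?thesis unfolding eq
      by (rule smooth_on_compose[OF pre[OF T(5)[OF that]] T(5)[OF that] smooth_on_subset[OF sm] T(4)[OF that]]) auto
  qed
  moreover have "continuous_on (\<phi> -` T) (\<lambda>t. c (\<phi> t))"
    by (rule continuous_on_compose2[OF T(2) continuous_on_subset[OF cont]]) auto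
  moreover have "(\<lambda>t. c (\<phi> t)) ` (\<phi> -` T) \<subseteq> M" using T(3) by auto
  ultimately have "smooth_path (\<phi> -` T) (\<lambda>t. c (\<phi> t))"
    using pre[OF T(1)] by (auto simp: smooth_path_def)
  then show ?thesis unfolding \<phi>_def .
qed

lemma smooth_arc_affine:
  assumes c: "smooth_arc c a b" and sub: "\<And>t. t \<in> {a'..b'} \<Longrightarrow> m * t + k \<in> {a..b}"
  shows "smooth_arc (\<lambda>t. c (m * t + k)) a' b'"
proof -
  obtain T c' where T: "smooth_path T c'" "{a..b} \<subseteq> T" "\<forall>t\<in>{a..b}. c' t = c t"
    using c unfolding smooth_arc_iff by blast
  have "{a'..b'} \<subseteq> (\<lambda>t. m * t + k) -` T" using subsetD[OF T(2) sub] by auto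
  moreover have "\<forall>t\<in>{a'..b'}. c' (m * t + k) = c (m * t + k)" using T(3) sub by blast
  ultimately show ?thesis
    unfolding smooth_arc_iff using smooth_path_affine[OF T(1)]
    by (intro exI[of _ "(\<lambda>t. m * t + k) -` T"] exI[of _ "\<lambda>t. c' (m * t + k)"]) simp
qed

lemma smooth_along_curve:
  assumes F: "immersion A F" and T: "smooth_path T c'"
  shows "smooth_on T (\<lambda>t. F (c' t))"
proof (rule smooth_on_local)
  fix t assume "t \<in> T"
  then have "c' t \<in> M" using smooth_pathD(3)[OF T] by auto
  then obtain V x u where x: "(V, x) \<in> A" "u \<in> V" "x u = c' t" using chart_covers[OF manifold] by blast
  note ch = chartD[OF manifold x(1)]
  let ?S = "{t \<in> T. c' t \<in> x ` V}"
  have "smooth_on ?S (\<lambda>t. (F \<circ> x) (the_inv_into V x (c' t)))"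
    by (rule smooth_on_compose[OF smooth_pathD(5)[OF T x(1)] ch(1) smooth_pathD(4)[OF T x(1)] immersionD(1)[OF F x(1)]])
      (auto simp: the_inv_into_f_f[OF ch(3)])
  then have "smooth_on ?S (\<lambda>t. F (c' t))"
    by (rule smooth_on_cong[OF smooth_pathD(5)[OF T x(1)]]) (auto simp: the_inv_into_f_f[OF ch(3)])
  moreover have "t \<in> ?S" using \<open>t \<in> T\<close> x(2,3) by (metis (mono_tags, lifting) imageI mem_Collect_eq)
  ultimately show "\<exists>S. open S \<and> t \<in> S \<and> smooth_on S (\<lambda>t. F (c' t))" using smooth_pathD(5)[OF T x(1)] by blast
qed

definition speed :: "(real \<Rightarrow> 'p) \<Rightarrow> real \<Rightarrow> real" where
  "speed c t = norm (vector_derivative (f \<circ> c) (at t))"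

lemma speed_eqI: "((f \<circ> c) has_vector_derivative v) (at t) \<Longrightarrow> speed c t = norm v"
  by (simp add: speed_def vector_derivative_at)

lemma speed_nonneg: "0 \<le> speed c t"
  by (simp add: speed_def)

text \<open>At the end points of the interval the curve itself may fail to be differentiable, but the velocity
  of its smooth extension is continuous there. This is what makes the speed integrable.\<close>

lemma smooth_arc_velocity:
  assumes "smooth_arc c a b"
  shows "\<exists>d. continuous_on {a..b} d \<and>
    (\<forall>t\<in>{a<..<b}. ((f \<circ> c) has_vector_derivative d t) (at t) \<and> speed c t = norm (d t))"
proof -
  obtain T c' where T: "smooth_path T c'" "{a..b} \<subseteq> T" "\<forall>t\<in>{a..b}. c' t = c t"
    using assms unfolding smooth_arc_iff by blast
  have sm: "smooth_on T (\<lambda>t. f (c' t))" by (rule smooth_along_curve[OF immersed T(1)])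
  define d where "d t = fderiv (\<lambda>t. f (c' t)) t 1" for t
  have "continuous_on {a..b} d"
    unfolding d_def by (rule continuous_on_subset[OF smooth_on_continuous[OF smooth_on_derivative[OF sm]] T(2)])
  moreover have "((f \<circ> c) has_vector_derivative d t) (at t)" if t: "t \<in> {a<..<b}" for t
  proof -
    have "((\<lambda>t. f (c' t)) has_vector_derivative d t) (at t)"
      unfolding d_def using T(2) t by (intro smooth_on_has_vector_derivative[OF sm]) auto
    then show ?thesis
      by (rule has_vector_derivative_transform_within_open[OF _ open_greaterThanLessThan t]) (use T(3) in auto)
  qed
  ultimately show ?thesis using speed_eqI by blast
qed

lemma smooth_arc_speed_integrable:
  assumes "smooth_arc c a b"
  shows "speed c integrable_on {a..b}"
proof -
  obtain d where d: "continuous_on {a..b} d"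
    "\<forall>t\<in>{a<..<b}. ((f \<circ> c) has_vector_derivative d t) (at t) \<and> speed c t = norm (d t)"
    using smooth_arc_velocity[OF assms] by blast
  have "(\<lambda>t. norm (d t)) integrable_on {a..b}"
    by (intro integrable_continuous_real continuous_intros d(1))
  then show ?thesis
    using integrable_spike_interior[of a b "speed c" "\<lambda>t. norm (d t)"] d(2) by (auto simp: box_real)
qed

lemma smooth_arc_affine_length:
  assumes c: "smooth_arc c a b" and I: "(speed c has_integral L) {a..b}" and ab: "a < b"
    and m: "m \<noteq> 0" and img: "(\<lambda>t. (t - k) / m) ` {a..b} = {a'..b'}"
  shows "smooth_arc (\<lambda>t. c (m * t + k)) a' b'" "(speed (\<lambda>t. c (m * t + k)) has_integral L) {a'..b'}" "a' < b'"
proof -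
  have ends: "(a - k) / m \<in> {a'..b'}" "(b - k) / m \<in> {a'..b'}" "(a - k) / m \<noteq> (b - k) / m"
    using img ab m by auto
  then show a'b': "a' < b'" unfolding atLeastAtMost_iff by argo
  have inside: "m * t + k \<in> {a..b}" if "t \<in> {a'..b'}" for t
    using that m unfolding img[symmetric] by auto
  then show "smooth_arc (\<lambda>t. c (m * t + k)) a' b'" by (rule smooth_arc_affine[OF c])
  obtain d where d: "\<forall>t\<in>{a<..<b}. ((f \<circ> c) has_vector_derivative d t) (at t) \<and> speed c t = norm (d t)"
    using smooth_arc_velocity[OF c] by blast
  have inner: "m * t + k \<in> {a<..<b}" if t: "t \<in> {a'<..<b'}" for t
  proof -
    have "m * t + k \<noteq> a" "m * t + k \<noteq> b"
    proof -
      define e where "e = min (t - a') (b' - t)"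
      have e: "e > 0" "t - e \<in> {a'..b'}" "t + e \<in> {a'..b'}" using t by (auto simp: e_def)
      note inside[OF e(2)] inside[OF e(3)]
      then show "m * t + k \<noteq> a" "m * t + k \<noteq> b"
        using m e(1) by (auto simp: algebra_simps mult_le_0_iff zero_le_mult_iff)
    qed
    then show ?thesis using inside[of t] t by auto
  qed
  have sp: "speed (\<lambda>t. c (m * t + k)) t = \<bar>m\<bar> * speed c (m * t + k)" if t: "t \<in> {a'<..<b'}" for t
  proof -
    have "((\<lambda>t. m * t + k) has_vector_derivative m) (at t)"
      by (auto intro!: derivative_eq_intros)
    from vector_diff_chain_at[OF this d[rule_format, OF inner[OF t], THEN conjunct1]]
    have "((f \<circ> (\<lambda>t. c (m * t + k))) has_vector_derivative m *\<^sub>R d (m * t + k)) (at t)"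
      by (simp add: o_def)
    then show ?thesis using d[rule_format, OF inner[OF t]] by (simp add: speed_eqI)
  qed
  have img': "(\<lambda>x. (1 / m) *\<^sub>R x + - ((1 / m) *\<^sub>R k)) ` {a..b} = {a'..b'}"
    unfolding img[symmetric] by (rule image_cong) (auto simp: diff_divide_distrib)
  have "((\<lambda>t. speed c (m *\<^sub>R t + k)) has_integral (1 / \<bar>m\<bar>) *\<^sub>R L) {a'..b'}"
    using has_integral_affinity[of "speed c" L a b m k] I m img' by simp
  from has_integral_mult_right[OF this, of "\<bar>m\<bar>"]
  have "((\<lambda>t. \<bar>m\<bar> * speed c (m * t + k)) has_integral L) {a'..b'}" using m by simp
  then show "(speed (\<lambda>t. c (m * t + k)) has_integral L) {a'..b'}"
    using has_integral_spike_interior[of "\<lambda>t. \<bar>m\<bar> * speed c (m * t + k)" L a' b' "speed (\<lambda>t. c (m * t + k))"] sp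
    by (simp add: box_real)
qed

subsection \<open>Points joined by curves of a given length\<close>

definition seg :: "'p \<Rightarrow> 'p \<Rightarrow> real \<Rightarrow> bool" where
  "seg p q L \<longleftrightarrow> (\<exists>c a b. a < b \<and> smooth_arc c a b \<and> c a = p \<and> c b = q \<and> (speed c has_integral L) {a..b})"

text \<open>The predicate \<open>reach p q L\<close> says that finitely many smooth arcs, of total length
  \<open>L\<close>, lead from \<open>p\<close> to \<open>q\<close>. Unlike a single piecewise
  smooth curve on the unit interval, such a chain needs no reparametrization when it is reversed,
  continued or cut.\<close>

inductive reach :: "'p \<Rightarrow> 'p \<Rightarrow> real \<Rightarrow> bool" where
  refl: "p \<in> M \<Longrightarrow> reach p p 0"
| step: "reach p q L \<Longrightarrow> seg q r L' \<Longrightarrow> reach p r (L + L')"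

lemma seg_in_M: "seg p q L \<Longrightarrow> p \<in> M \<and> q \<in> M"
  unfolding seg_def using smooth_arc_in_M by (metis atLeastAtMost_iff less_imp_le order_refl)

lemma reach_in_M: "reach p q L \<Longrightarrow> p \<in> M \<and> q \<in> M"
  by (induction rule: reach.induct) (auto dest: seg_in_M)

lemma seg_nonneg: "seg p q L \<Longrightarrow> 0 \<le> L"
  unfolding seg_def using has_integral_nonneg speed_nonneg by blast

lemma reach_nonneg: "reach p q L \<Longrightarrow> 0 \<le> L"
  by (induction rule: reach.induct) (auto dest: seg_nonneg)

lemma seg_reach: "seg p q L \<Longrightarrow> reach p q L"
  using reach.step[OF reach.refl] seg_in_M by fastforce

lemma reach_trans: "reach q r L' \<Longrightarrow> reach p q L \<Longrightarrow> reach p r (L + L')"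
proof (induction rule: reach.induct)
  case (refl q)
  then show ?case by simp
next
  case (step q r L' s L'')
  then show ?case using reach.step[of p r "L + L'"] by (simp add: add.assoc)
qed

lemma seg_sym: "seg p q L \<Longrightarrow> seg q p L"
proof -
  assume "seg p q L"
  then obtain c a b where c: "a < b" "smooth_arc c a b" "c a = p" "c b = q" "(speed c has_integral L) {a..b}"
    by (auto simp: seg_def)
  have img: "(\<lambda>t. (t - 0) / (-1)) ` {a..b} = {-b..-a}"
    by (auto simp: image_iff intro!: bexI[of _ "- _"])
  show ?thesis
    using smooth_arc_affine_length[OF c(2,5,1) _ img] c(3,4) unfolding seg_def
    by (intro exI[of _ "\<lambda>t. c (-1 * t + 0)"] exI[of _ "-b"] exI[of _ "-a"]) auto
qed

lemma reach_sym: "reach p q L \<Longrightarrow> reach q p L"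
proof (induction rule: reach.induct)
  case (refl p)
  then show ?case by (rule reach.refl)
next
  case (step p q L r L')
  then show ?case using reach_trans[OF step.IH seg_reach[OF seg_sym[OF step.hyps(2)]]] by (simp add: add.commute)
qed

lemma smooth_arc_reach:
  assumes "smooth_arc c a b" "a \<le> b"
  shows "reach (c a) (c b) (integral {a..b} (speed c))"
proof (cases "a = b")
  case True
  then show ?thesis using reach.refl[of "c a"] smooth_arc_in_M[OF assms(1)] by simp
next
  case False
  then have "a < b" using assms by simp
  then show ?thesis
    using smooth_arc_speed_integrable[OF assms(1)] assms(1)
    by (intro seg_reach) (auto simp: seg_def has_integral_integral)
qed

lemma seg_split:
  assumes "seg p q L" "0 \<le> s" "s \<le> L"
  shows "\<exists>z. reach p z s \<and> reach z q (L - s)"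
proof -
  obtain c a b where c: "a < b" "smooth_arc c a b" "c a = p" "c b = q" "(speed c has_integral L) {a..b}"
    using assms(1) by (auto simp: seg_def)
  have int: "speed c integrable_on {a..b}" using c(5) by blast
  have L: "integral {a..b} (speed c) = L" using c(5) by (rule integral_unique)
  obtain t where t: "a \<le> t" "t \<le> b" "integral {a..t} (speed c) = s"
    using IVT'[of "\<lambda>t. integral {a..t} (speed c)" a s b] indefinite_integral_continuous_1[OF int] assms(2,3) L c(1)
    by auto
  have "integral {t..b} (speed c) = L - s"
    using Henstock_Kurzweil_Integration.integral_combine[OF t(1,2) int] t(3) L by simp
  moreover have "reach (c a) (c t) (integral {a..t} (speed c))"
    by (rule smooth_arc_reach[OF smooth_arc_subinterval[OF c(2)]]) (use t in auto)
  moreover have "reach (c t) (c b) (integral {t..b} (speed c))"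
    by (rule smooth_arc_reach[OF smooth_arc_subinterval[OF c(2)]]) (use t in auto)
  ultimately show ?thesis using c(3,4) t(3) by metis
qed

text \<open>This is where the distance is used as a length distance: a chain of length \<open>L\<close> can be
  cut at any prescribed distance from its start.\<close>

lemma reach_split:
  "reach p q L \<Longrightarrow> 0 \<le> s \<Longrightarrow> s \<le> L \<Longrightarrow> \<exists>z. reach p z s \<and> reach z q (L - s)"
proof (induction rule: reach.induct)
  case (refl p)
  then show ?case using reach.refl[OF refl(1)] by (metis antisym diff_self)
next
  case (step p q L r L')
  show ?case
  proof (cases "s \<le> L")
    case True
    then obtain z where z: "reach p z s" "reach z q (L - s)" using step by blast
    have "reach z r (L - s + L')" using z(2) step.hyps(2) by (rule reach.step)
    then show ?thesis using z(1) by (auto simp: algebra_simps)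
  next
    case False
    then obtain z where z: "reach q z (s - L)" "reach z r (L' - (s - L))"
      using seg_split[OF step.hyps(2), of "s - L"] step.prems by auto
    have "reach p z (L + (s - L))" using z(1) step.hyps(1) by (rule reach_trans)
    moreover have "L + (s - L) = s" "L' - (s - L) = L + L' - s" by simp_all
    ultimately show ?thesis using z(2) by metis
  qed
qed

subsection \<open>Comparison with the Riemannian distance\<close>

text \<open>Single curves made of the arcs of a chain, kept together with their length. They lead back to the
  curves on the unit interval in the definition of the Riemannian distance.\<close>

inductive chain_curve :: "(real \<Rightarrow> 'p) \<Rightarrow> real \<Rightarrow> real \<Rightarrow> real \<Rightarrow> bool" where
  one: "a < b \<Longrightarrow> smooth_arc c a b \<Longrightarrow> (speed c has_integral L) {a..b} \<Longrightarrow> chain_curve c a b L"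
| app: "chain_curve c a b L \<Longrightarrow> b < d \<Longrightarrow> smooth_arc c b d \<Longrightarrow> (speed c has_integral L') {b..d} \<Longrightarrow> chain_curve c a d (L + L')"

lemma chain_curve_less: "chain_curve c a b L \<Longrightarrow> a < b"
  by (induction rule: chain_curve.induct) auto

lemma positive_affine_image:
  fixes m :: real
  assumes "m > 0"
  shows "(\<lambda>t. (t - k) / m) ` {a..b} = {(a - k) / m..(b - k) / m}"
proof (intro equalityI subsetI)
  fix x assume "x \<in> {(a - k) / m..(b - k) / m}"
  then show "x \<in> (\<lambda>t. (t - k) / m) ` {a..b}"
    using assms by (intro image_eqI[of _ _ "m * x + k"]) (auto simp: field_simps)
qed (use assms in \<open>auto simp: divide_right_mono\<close>)

lemma chain_curve_affine:
  assumes "m > 0"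
  shows "chain_curve c a b L \<Longrightarrow> chain_curve (\<lambda>t. c (m * t + k)) ((a - k) / m) ((b - k) / m) L"
proof (induction rule: chain_curve.induct)
  case (one a b c L)
  then show ?case
    using smooth_arc_affine_length[OF one(2,3,1) _ positive_affine_image[OF assms]] assms by (intro chain_curve.one) auto
next
  case (app c a b L d L')
  then show ?case
    using smooth_arc_affine_length[OF app.hyps(3,4,2) _ positive_affine_image[OF assms]] assms by (intro chain_curve.app) auto
qed

lemma smooth_arc_speed_cong:
  assumes c: "smooth_arc c a b" "(speed c has_integral L) {a..b}" and eq: "\<And>t. t \<in> {a..b} \<Longrightarrow> c t = d t"
  shows "smooth_arc d a b" "(speed d has_integral L) {a..b}"
proof -
  show "smooth_arc d a b" using c(1) eq by (rule smooth_arc_cong)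
  have "speed d t = speed c t" if t: "t \<in> {a<..<b}" for t
  proof -
    obtain v where v: "((f \<circ> c) has_vector_derivative v) (at t)" using smooth_arc_velocity[OF c(1)] t by blast
    then have "((f \<circ> d) has_vector_derivative v) (at t)"
      by (rule has_vector_derivative_transform_within_open[OF _ open_greaterThanLessThan t]) (use eq in auto)
    then show ?thesis using v by (simp add: speed_eqI)
  qed
  then show "(speed d has_integral L) {a..b}"
    using has_integral_spike_interior[of "speed c" L a b "speed d"] c(2) by (simp add: box_real)
qed

lemma chain_curve_cong: "chain_curve c a b L \<Longrightarrow> (\<And>t. t \<in> {a..b} \<Longrightarrow> c t = d t) \<Longrightarrow> chain_curve d a b L"
proof (induction rule: chain_curve.induct)
  case (one a b c L)
  then show ?case using smooth_arc_speed_cong[OF one(2,3)] by (intro chain_curve.one) auto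
next
  case (app c a b L e L')
  have "a < b" using app.hyps(1) by (rule chain_curve_less)
  then have "smooth_arc d b e" "(speed d has_integral L') {b..e}" "chain_curve d a b L"
    using smooth_arc_speed_cong[OF app.hyps(3,4), of d] app.IH app.prems app.hyps(2) by auto
  then show ?case using app.hyps(2) by (intro chain_curve.app)
qed

lemma chain_curve_has_integral: "chain_curve c a b L \<Longrightarrow> (speed c has_integral L) {a..b}"
proof (induction rule: chain_curve.induct)
  case (app c a b L d L')
  then show ?case using chain_curve_less by (intro has_integral_combine[of a b d]) (auto intro: less_imp_le)
qed

lemma chain_curve_subdivision:
  "chain_curve c a b L \<Longrightarrow> \<exists>(n::nat) \<tau>. \<tau> 0 = a \<and> \<tau> n = b \<and> (\<forall>i<n. \<tau> i < \<tau> (Suc i) \<and> smooth_arc c (\<tau> i) (\<tau> (Suc i)))"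
proof (induction rule: chain_curve.induct)
  case (one a b c L)
  then show ?case by (intro exI[of _ 1] exI[of _ "\<lambda>i. if i = 0 then a else b"]) auto
next
  case (app c a b L d L')
  then obtain n :: nat and \<tau> where "\<tau> 0 = a" "\<tau> n = b" "\<forall>i<n. \<tau> i < \<tau> (Suc i) \<and> smooth_arc c (\<tau> i) (\<tau> (Suc i))" by blast
  then show ?case using app.hyps(2,3)
    by (intro exI[of _ "Suc n"] exI[of _ "\<tau>(Suc n := d)"]) (auto simp: less_Suc_eq)
qed

lemma reach_chain_curve: "reach p q L \<Longrightarrow> \<exists>c a b. chain_curve c a b L \<and> c a = p \<and> c b = q"
proof (induction rule: reach.induct)
  case (refl p)
  have "(speed (\<lambda>_. p) has_integral 0) {0..1}"
    by (rule has_integral_eq[where f = "\<lambda>_. 0"]) (auto simp: speed_def o_def)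
  then show ?case
    using smooth_arc_const[OF refl, of 0 1] by (intro exI[of _ "\<lambda>_. p"] exI[of _ 0] exI[of _ 1]) (auto intro: chain_curve.one)
next
  case (step p q L r L')
  obtain c a b where c: "chain_curve c a b L" "c a = p" "c b = q" using step.IH by blast
  obtain d s t where d: "s < t" "smooth_arc d s t" "d s = q" "d t = r" "(speed d has_integral L') {s..t}"
    using step.hyps(2) by (auto simp: seg_def)
  have ab: "a < b" using c(1) by (rule chain_curve_less)
  define d' where "d' = (\<lambda>u. d (1 * u + (s - b)))"
  define e where "e u = (if u \<le> b then c u else d' u)" for u
  have "(\<lambda>u. (u - (s - b)) / 1) ` {s..t} = {b..b + (t - s)}"
    using positive_affine_image[of 1 "s - b" s t] by (simp add: algebra_simps)
  from smooth_arc_affine_length[OF d(2,5,1) _ this]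
  have d': "smooth_arc d' b (b + (t - s))" "(speed d' has_integral L') {b..b + (t - s)}" by (auto simp: d'_def)
  have "e u = d' u" if "u \<in> {b..b + (t - s)}" for u
    using that c(3) d(3) by (cases "u = b") (auto simp: e_def d'_def)
  then have "smooth_arc e b (b + (t - s))" "(speed e has_integral L') {b..b + (t - s)}"
    using smooth_arc_speed_cong[OF d', of e] by auto
  moreover have "chain_curve e a b L" using c(1) by (rule chain_curve_cong) (auto simp: e_def)
  ultimately have "chain_curve e a (b + (t - s)) (L + L')" using d(1) by (intro chain_curve.app) auto
  moreover have "e a = p" "e (b + (t - s)) = r" using c(2) d(1,4) ab by (auto simp: e_def d'_def)
  ultimately show ?case by blast
qed

lemma riemannian_dist_le:
  assumes "reach p q L"
  shows "riemannian_dist M A f p q \<le> ereal L"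
proof -
  obtain c a b where c: "chain_curve c a b L" "c a = p" "c b = q" using reach_chain_curve[OF assms] by blast
  have ab: "b - a > 0" using chain_curve_less[OF c(1)] by simp
  define e where "e = (\<lambda>t. c ((b - a) * t + a))"
  have e: "chain_curve e 0 1 L" using chain_curve_affine[OF ab c(1), of a] ab by (simp add: e_def)
  have "piecewise (smooth_arc e)" using chain_curve_subdivision[OF e] by (simp add: piecewise_def)
  moreover have "curve_length f e = L"
    using integral_unique[OF chain_curve_has_integral[OF e]] unfolding curve_length_def speed_def[symmetric] .
  moreover have "e 0 = p" "e 1 = q" using c(2,3) by (auto simp: e_def)
  ultimately show ?thesis unfolding riemannian_dist_def by (intro Inf_lower) blast
qed

lemma piecewise_reach:
  assumes "piecewise (smooth_arc c)"
  shows "reach (c 0) (c 1) (curve_length f c)"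
proof -
  obtain n :: nat and \<tau> where \<tau>: "\<tau> 0 = 0" "\<tau> n = 1" "\<And>i. i < n \<Longrightarrow> \<tau> i < \<tau> (Suc i) \<and> smooth_arc c (\<tau> i) (\<tau> (Suc i))"
    using assms unfolding piecewise_def by auto
  have n: "n > 0" using \<tau>(1,2) by (cases n) auto
  have "0 \<le> \<tau> i \<and> speed c integrable_on {0..\<tau> i} \<and> reach (c 0) (c (\<tau> i)) (integral {0..\<tau> i} (speed c))" if "i \<le> n" for i
    using that
  proof (induction i)
    case 0
    have "c 0 \<in> M" using \<tau>(3)[OF n] \<tau>(1) smooth_arc_in_M[of c "\<tau> 0" "\<tau> (Suc 0)" 0] by auto
    then show ?case using \<tau>(1) reach.refl integrable_on_refl[of "speed c" 0] by simp
  next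
    case (Suc i)
    have i: "\<tau> i < \<tau> (Suc i)" "smooth_arc c (\<tau> i) (\<tau> (Suc i))" using \<tau>(3)[of i] Suc.prems by auto
    have IH: "0 \<le> \<tau> i" "speed c integrable_on {0..\<tau> i}" "reach (c 0) (c (\<tau> i)) (integral {0..\<tau> i} (speed c))"
      using Suc by auto
    have int: "speed c integrable_on {0..\<tau> (Suc i)}"
      by (rule Henstock_Kurzweil_Integration.integrable_combine[OF IH(1) less_imp_le[OF i(1)] IH(2) smooth_arc_speed_integrable[OF i(2)]])
    have "reach (c (\<tau> i)) (c (\<tau> (Suc i))) (integral {\<tau> i..\<tau> (Suc i)} (speed c))"
      using smooth_arc_reach[OF i(2)] i(1) by simp
    from reach_trans[OF this IH(3)] show ?case
      using IH(1) i(1) int Henstock_Kurzweil_Integration.integral_combine[OF IH(1) _ int] by simp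
  qed
  from this[of n] show ?thesis
    using \<tau>(2) unfolding curve_length_def speed_def[symmetric] by simp
qed

lemma riemannian_dist_less:
  assumes "riemannian_dist M A f p q < ereal r"
  shows "\<exists>L<r. reach p q L"
proof -
  obtain c where "piecewise (smooth_arc c)" "c 0 = p" "c 1 = q" "ereal (curve_length f c) < ereal r"
    using assms unfolding riemannian_dist_def Inf_less_iff by blast
  then show ?thesis using piecewise_reach[of c] by auto
qed

subsection \<open>Small distance balls\<close>

lemma smooth_path_in_chart:
  assumes x: "(V, x) \<in> A" and T: "open T" and h: "smooth_on T h" "h ` T \<subseteq> V"
  shows "smooth_path T (\<lambda>t. x (h t))"
proof -
  note ch = chartD[OF manifold x]
  have cont: "continuous_on T (\<lambda>t. x (h t))"
    by (rule continuous_on_compose2[OF ch(4) smooth_on_continuous[OF h(1)] h(2)])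
  moreover have img: "(\<lambda>t. x (h t)) ` T \<subseteq> M" using h(2) ch(5) by auto
  moreover have "smooth_on {t \<in> T. x (h t) \<in> y ` W} (\<lambda>t. the_inv_into W y (x (h t)))" if y: "(W, y) \<in> A" for W y
  proof -
    have "openin (top_of_set T) (T \<inter> (\<lambda>t. x (h t)) -` (y ` W))"
      using continuous_openin_preimage[OF cont _ chartD(2)[OF manifold y]] img by auto
    moreover have "T \<inter> (\<lambda>t. x (h t)) -` (y ` W) = {t \<in> T. x (h t) \<in> y ` W}" by auto
    ultimately have op: "open {t \<in> T. x (h t) \<in> y ` W}" using T by (simp add: openin_open_eq)
    show ?thesis
      by (rule smooth_on_compose[OF op chart_transition(1)[OF manifold x y] smooth_on_subset[OF h(1)] chart_transition(2)[OF manifold x y]])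
        (use h(2) in auto)
  qed
  ultimately show ?thesis using T by (auto simp: smooth_path_def)
qed

lemma smooth_arc_in_chart:
  assumes "(V, x) \<in> A" "open T" "smooth_on T h" "h ` T \<subseteq> V" "{a..b} \<subseteq> T"
  shows "smooth_arc (\<lambda>t. x (h t)) a b"
  unfolding smooth_arc_iff using smooth_path_in_chart[OF assms(1-4)] assms(5) by blast

lemma openin_chart_image:
  assumes x: "(V, x) \<in> A" and U: "open U" "U \<subseteq> V"
  obtains N where "open N" "x ` U = M \<inter> N"
proof -
  note ch = chartD[OF manifold x]
  obtain y where y: "homeomorphism V (x ` V) x y" using ch(7) by blast
  have "openin (top_of_set V) U" using U by (simp add: open_openin_trans open_subset)
  then have "openin (top_of_set (x ` V)) (x ` U)" using homeomorphism_imp_open_map[OF y] by blast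
  then have "openin (top_of_set M) (x ` U)" using ch(2) by (rule openin_trans)
  then show ?thesis using that by (auto simp: openin_open)
qed

text \<open>The open ball of the length distance, phrased with \<open>reach\<close> in order to calculate with
  real numbers although the distance may be infinite.\<close>

definition dist_ball :: "'p \<Rightarrow> real \<Rightarrow> 'p set" where
  "dist_ball p r = {q. \<exists>L<r. reach p q L}"

text \<open>A straight segment in a chart has a length comparable to its Euclidean length, so the balls are
  neighbourhoods in the topology of \<open>M\<close>.\<close>

lemma dist_ball_neighborhood:
  assumes p: "p \<in> M" and r: "r > 0"
  obtains N where "open N" "p \<in> N" "M \<inter> N \<subseteq> dist_ball p r"
proof -
  obtain V x u where x: "(V, x) \<in> A" "u \<in> V" "x u = p" using chart_covers[OF manifold p] by blast
  interpret patch: parametrized_immersion V "f \<circ> x"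
    by (rule parametrized_immersion_chart[OF manifold immersed x(1)])
  obtain \<delta> where \<delta>: "\<delta> > 0" "cball u \<delta> \<subseteq> V" using patch.open_V x(2) open_contains_cball by blast
  define B where "B y = (\<Sum>i\<in>UNIV. norm (patch.E i y))" for y
  have "continuous_on (cball u \<delta>) B"
    unfolding B_def using continuous_on_subset[OF smooth_on_continuous[OF patch.smooth_E] \<delta>(2)]
    by (intro continuous_intros)
  then have "bounded (B ` cball u \<delta>)" using compact_continuous_image compact_imp_bounded compact_cball by blast
  then obtain C where C0: "C > 0" "\<forall>b\<in>B ` cball u \<delta>. norm b \<le> C"
    unfolding bounded_pos by blast
  have C: "B y \<le> C" if "y \<in> cball u \<delta>" for y
    using C0(2)[rule_format, OF imageI[OF that]] by simp
  have bound: "norm (fderiv (f \<circ> x) y w) \<le> C * norm w" if y: "y \<in> cball u \<delta>" for y w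
  proof -
    have "norm (fderiv (f \<circ> x) y w) \<le> (\<Sum>i\<in>UNIV. \<bar>w $ i\<bar> * norm (patch.E i y))"
      using y \<delta>(2) norm_sum[of "\<lambda>i. w $ i *\<^sub>R patch.E i y" UNIV] by (auto simp: patch.derivative_eq)
    also have "\<dots> \<le> (\<Sum>i\<in>UNIV. norm w * norm (patch.E i y))"
      by (intro sum_mono mult_right_mono component_le_norm_cart) auto
    also have "\<dots> = norm w * B y" by (simp add: B_def sum_distrib_left)
    also have "\<dots> \<le> norm w * C" using C[OF y] by (intro mult_left_mono) auto
    finally show ?thesis by (simp add: mult.commute)
  qed
  define e where "e = min \<delta> (r / C)"
  have e: "e > 0" "e \<le> \<delta>" "e \<le> r / C" using \<delta>(1) r C0(1) by (auto simp: e_def)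
  have eV: "ball u e \<subseteq> V" using e(2) \<delta>(2) by auto
  obtain N where N: "open N" "x ` ball u e = M \<inter> N" using openin_chart_image[OF x(1) open_ball eV] by blast
  have "x w \<in> dist_ball p r" if w: "w \<in> ball u e" for w
  proof -
    \<comment> \<open>the segment from \<open>u\<close> to \<open>w\<close>, on the open set of times where it stays in the ball\<close>
    define h where "h t = u + t *\<^sub>R (w - u)" for t :: real
    define T where "T = h -` ball u e"
    have smh: "smooth_on UNIV h"
      by (auto simp: smooth_on_def h_def[abs_def] intro!: Ck_on_add Ck_on_scaleR Ck_on_const Ck_on_id)
    have T: "open T" unfolding T_def by (rule open_vimage[OF open_ball smooth_on_continuous[OF smh]])
    have sub: "{0..1} \<subseteq> T"
    proof
      fix t :: real assume t: "t \<in> {0..1}"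
      have "norm (t *\<^sub>R (w - u)) \<le> 1 * norm (w - u)"
        unfolding norm_scaleR using t by (intro mult_right_mono) auto
      then show "t \<in> T" using w by (simp add: T_def h_def dist_norm norm_minus_commute)
    qed
    have hV: "h ` T \<subseteq> V" using eV by (auto simp: T_def)
    have sc: "smooth_arc (\<lambda>t. x (h t)) 0 1"
      by (rule smooth_arc_in_chart[OF x(1) T smooth_on_subset[OF smh] hV sub]) simp
    have speed_le: "speed (\<lambda>t. x (h t)) t \<le> C * norm (w - u)" if t: "t \<in> {0..1}" for t
    proof -
      have tT: "h t \<in> ball u e" using t sub by (auto simp: T_def)
      have "(h has_vector_derivative (w - u)) (at t)"
        unfolding h_def[abs_def] by (auto intro!: derivative_eq_intros)
      moreover have "((f \<circ> x) has_derivative fderiv (f \<circ> x) (h t)) (at (h t))"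
        using tT eV by (intro smooth_on_has_derivative[OF patch.smooth]) auto
      ultimately have "(((f \<circ> x) \<circ> h) has_vector_derivative fderiv (f \<circ> x) (h t) (w - u)) (at t)"
        unfolding has_vector_derivative_def
        using diff_chain_at[of h "\<lambda>s. s *\<^sub>R (w - u)" t "f \<circ> x" "fderiv (f \<circ> x) (h t)"]
          linear_scale[OF patch.linear_derivative, of "h t"] tT eV by (auto simp: o_def)
      then have "speed (\<lambda>t. x (h t)) t = norm (fderiv (f \<circ> x) (h t) (w - u))"
        by (intro speed_eqI) (simp add: o_def)
      then show ?thesis using bound[of "h t" "w - u"] tT e(2) by auto
    qed
    have "integral {0..1} (speed (\<lambda>t. x (h t))) \<le> integral {0..1} (\<lambda>t::real. C * norm (w - u))"
      using speed_le by (intro integral_le smooth_arc_speed_integrable[OF sc]) auto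
    also have "\<dots> = C * norm (w - u)" by simp
    also have "\<dots> < C * e" using w C0(1) by (simp add: dist_norm norm_minus_commute)
    also have "\<dots> \<le> r" using e(3) C0(1) by (simp add: pos_le_divide_eq mult.commute)
    finally have "integral {0..1} (speed (\<lambda>t. x (h t))) < r" .
    moreover have "reach (x (h 0)) (x (h 1)) (integral {0..1} (speed (\<lambda>t. x (h t))))"
      by (rule smooth_arc_reach[OF sc]) simp
    moreover have "x (h 0) = p" "x (h 1) = x w" using x(3) by (auto simp: h_def)
    ultimately show ?thesis unfolding dist_ball_def by auto
  qed
  then have "M \<inter> N \<subseteq> dist_ball p r" unfolding N(2)[symmetric] by blast
  moreover have "p \<in> N" using N(2) x(3) e(1) by (metis IntE centre_in_ball image_eqI)
  ultimately show ?thesis using that N(1) by blast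
qed

text \<open>Where the metric is bounded below by the Euclidean metric of the chart, the length bounds the
  displacement of the coordinates.\<close>

lemma displacement_in_chart:
  assumes x: "(V, x) \<in> A" and sc: "smooth_arc c s t" and st: "s \<le> t"
    and B: "B \<subseteq> V" "\<And>r. r \<in> {s..t} \<Longrightarrow> c r \<in> x ` B"
    and lower: "\<And>y w. y \<in> B \<Longrightarrow> k * norm w \<le> norm (fderiv (f \<circ> x) y w)" and k: "k > 0"
  shows "k * norm (the_inv_into V x (c t) - the_inv_into V x (c s)) \<le> integral {s..t} (speed c)"
proof -
  note ch = chartD[OF manifold x]
  obtain T c' where T: "smooth_path T c'" "{s..t} \<subseteq> T" "\<forall>t\<in>{s..t}. c' t = c t"
    using sc unfolding smooth_arc_iff by blast
  define S where "S = {r \<in> T. c' r \<in> x ` V}"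
  define \<tau> where "\<tau> r = the_inv_into V x (c' r)" for r
  have S: "open S" "smooth_on S \<tau>" using smooth_pathD(4,5)[OF T(1) x] by (auto simp: S_def \<tau>_def[abs_def])
  have sub: "{s..t} \<subseteq> S" using T(2,3) B by (fastforce simp: S_def)
  define d where "d r = fderiv \<tau> r 1" for r
  have d: "(\<tau> has_vector_derivative d r) (at r)" if "r \<in> S" for r
    unfolding d_def by (rule smooth_on_has_vector_derivative[OF S(2) that])
  have contd: "continuous_on {s..t} d"
    unfolding d_def by (rule continuous_on_subset[OF smooth_on_continuous[OF smooth_on_derivative[OF S(2)]] sub])
  have \<tau>V: "\<tau> r \<in> V" "x (\<tau> r) = c' r" if "r \<in> S" for r
    using that ch(3) by (auto simp: S_def \<tau>_def the_inv_into_f_f)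
  have "(d has_integral (\<tau> t - \<tau> s)) {s..t}"
    using sub by (intro fundamental_theorem_of_calculus[OF st] has_vector_derivative_at_within[OF d]) auto
  then have int: "integral {s..t} d = \<tau> t - \<tau> s" by (rule integral_unique)
  have nd: "norm (d r) \<le> speed c r / k" if r: "r \<in> {s<..<t}" for r
  proof -
    have rS: "r \<in> S" and rB: "\<tau> r \<in> B"
    proof -
      show "r \<in> S" using r sub by auto
      have "c' r \<in> x ` B" using r B(2) T(3) by auto
      then show "\<tau> r \<in> B" using ch(3) B(1) by (auto simp: \<tau>_def the_inv_into_f_f subset_iff)
    qed
    have lin: "linear (fderiv (f \<circ> x) (\<tau> r))"
      by (rule smooth_on_linear_derivative[OF immersionD(1)[OF immersed x] \<tau>V(1)[OF rS]])
    have "fderiv (f \<circ> x) (\<tau> r) \<circ> (\<lambda>s. s *\<^sub>R d r) =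
        (\<lambda>s. s *\<^sub>R fderiv (f \<circ> x) (\<tau> r) (d r))"
      using linear_scale[OF lin] by (auto simp del: o_apply simp: comp_def[of "frechet_derivative _ _"])
    then have "(((f \<circ> x) \<circ> \<tau>) has_vector_derivative fderiv (f \<circ> x) (\<tau> r) (d r)) (at r)"
      using diff_chain_at[OF d[OF rS, unfolded has_vector_derivative_def]
          smooth_on_has_derivative[OF immersionD(1)[OF immersed x] \<tau>V(1)[OF rS]]]
      unfolding has_vector_derivative_def by metis
    then have "((f \<circ> c) has_vector_derivative fderiv (f \<circ> x) (\<tau> r) (d r)) (at r)"
      by (rule has_vector_derivative_transform_within_open[OF _ open_greaterThanLessThan r])
        (use subsetD[OF sub] \<tau>V(2) T(3) in simp)
    then have "speed c r = norm (fderiv (f \<circ> x) (\<tau> r) (d r))" by (rule speed_eqI)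
    then have "k * norm (d r) \<le> speed c r" using lower[OF rB] by simp
    then show ?thesis using k by (simp add: pos_le_divide_eq mult.commute)
  qed
  define e where "e r = (if r \<in> {s<..<t} then d r else 0)" for r
  have e_int: "(e has_integral (\<tau> t - \<tau> s)) {s..t}"
    using has_integral_spike_interior[of d "\<tau> t - \<tau> s" s t e] \<open>(d has_integral (\<tau> t - \<tau> s)) {s..t}\<close>
    by (simp add: box_real e_def)
  have "norm (integral {s..t} e) \<le> integral {s..t} (\<lambda>r. speed c r / k)"
  proof (rule integral_norm_bound_integral)
    show "e integrable_on {s..t}" using e_int by blast
    show "(\<lambda>r. speed c r / k) integrable_on {s..t}" using smooth_arc_speed_integrable[OF sc] by (rule integrable_on_divide)
    show "norm (e r) \<le> speed c r / k" for r using nd k speed_nonneg[of c r] by (simp add: e_def)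
  qed
  then have "norm (\<tau> t - \<tau> s) \<le> integral {s..t} (speed c) / k"
    using integral_unique[OF e_int] by simp
  moreover have "\<tau> t = the_inv_into V x (c t)" "\<tau> s = the_inv_into V x (c s)"
    using T(3) st by (auto simp: \<tau>_def)
  ultimately show ?thesis using k by (simp add: pos_le_divide_eq mult.commute)
qed

text \<open>Near each time the curve either lies in the larger ball, where its length controls its
  displacement, or avoids the smaller ball. In the second case nothing is claimed, since the claim
  concerns pieces of the curve that start in the smaller ball. Bisection combines these local
  statements.\<close>

lemma short_curve_stays_in_chart:
  assumes x: "(V, x) \<in> A" and \<rho>: "cball u \<rho>' \<subseteq> V" "\<rho> < \<rho>'"
    and lower: "\<And>y w. y \<in> cball u \<rho>' \<Longrightarrow> k * norm w \<le> norm (fderiv (f \<circ> x) y w)" and k: "k > 0"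
    and sg: "seg p q L" and w: "p = x w" "k * norm (w - u) + L < k * \<rho>"
  obtains w' where "q = x w'" "k * norm (w' - u) \<le> k * norm (w - u) + L"
proof -
  note ch = chartD[OF manifold x]
  obtain c a b where c: "a < b" "smooth_arc c a b" "c a = p" "c b = q" "(speed c has_integral L) {a..b}"
    using sg by (auto simp: seg_def)
  have int: "speed c integrable_on {s..t}" if "a \<le> s" "t \<le> b" for s t
    using that by (intro smooth_arc_speed_integrable smooth_arc_subinterval[OF c(2)]) auto
  define l where "l s t = integral {s..t} (speed c)" for s t
  have l0: "0 \<le> l s t" if "a \<le> s" "t \<le> b" for s t
    unfolding l_def using int[OF that] by (rule integral_nonneg) (rule speed_nonneg)
  have ladd: "l s t + l t r = l s r" if "a \<le> s" "s \<le> t" "t \<le> r" "r \<le> b" for s t r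
    unfolding l_def using that by (intro Henstock_Kurzweil_Integration.integral_combine int) auto
  have contc: "continuous_on {a..b} c" by (rule smooth_arc_continuous[OF c(2)])
  have nbhd: "\<exists>d>0. \<forall>r\<in>{a..b}. \<bar>r - t\<bar> < d \<longrightarrow> c r \<in> U" if "t \<in> {a..b}" "openin (top_of_set M) U" "c t \<in> U" for t U
  proof -
    have "openin (top_of_set {a..b}) ({a..b} \<inter> c -` U)"
      using continuous_openin_preimage[OF contc _ that(2)] smooth_arc_in_M[OF c(2)] by auto
    moreover have "t \<in> {a..b} \<inter> c -` U" using that by auto
    ultimately obtain d where "d > 0" "\<And>r. r \<in> {a..b} \<Longrightarrow> dist r t < d \<Longrightarrow> r \<in> {a..b} \<inter> c -` U"
      unfolding openin_euclidean_subtopology_iff by blast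
    then show ?thesis by (auto simp: dist_real_def)
  qed
  define P where "P s t \<longleftrightarrow> (a \<le> s \<and> s \<le> t \<and> t \<le> b \<longrightarrow>
    (\<forall>w. c s = x w \<longrightarrow> k * norm (w - u) + l s t < k * \<rho> \<longrightarrow> w \<in> V \<longrightarrow>
      (\<exists>w'\<in>V. c t = x w' \<and> k * norm (w' - u) \<le> k * norm (w - u) + l s t)))" for s t
  have "P a b"
  proof (rule Bolzano)
    show "a \<le> b" using c(1) by simp
  next
    fix s t r assume P: "P s t" "P t r" and le: "s \<le> t" "t \<le> r"
    show "P s r"
      unfolding P_def
    proof (intro impI allI)
      fix w assume B: "a \<le> s \<and> s \<le> r \<and> r \<le> b" and w: "c s = x w" "k * norm (w - u) + l s r < k * \<rho>" "w \<in> V"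
      have add: "l s t + l t r = l s r" using ladd B le by auto
      have "0 \<le> l t r" using l0 B le by auto
      then obtain w' where w': "w' \<in> V" "c t = x w'" "k * norm (w' - u) \<le> k * norm (w - u) + l s t"
        using P(1) w B le add unfolding P_def by force
      then obtain w'' where "w'' \<in> V" "c r = x w''" "k * norm (w'' - u) \<le> k * norm (w' - u) + l t r"
        using P(2) w B le add unfolding P_def by force
      then show "\<exists>w'\<in>V. c r = x w' \<and> k * norm (w' - u) \<le> k * norm (w - u) + l s r"
        using w'(3) add by force
    qed
  next
    fix t assume t: "a \<le> t" "t \<le> b"
    show "\<exists>d>0. \<forall>s r. s \<le> t \<and> t \<le> r \<and> r - s < d \<longrightarrow> P s r"
    \<comment> \<open>Near \<open>t\<close> the curve either stays in the larger ball, where lengths are controlled, or avoids the smaller one, where there is nothing to show.\<close>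
    proof (cases "c t \<in> x ` ball u \<rho>'")
      case True
      have "ball u \<rho>' \<subseteq> V" using \<rho>(1) by auto
      then obtain N where "open N" "x ` ball u \<rho>' = M \<inter> N" using openin_chart_image[OF x open_ball] by blast
      then have "openin (top_of_set M) (x ` ball u \<rho>')" by (auto simp: openin_open)
      then obtain d where d: "d > 0" "\<And>r. r \<in> {a..b} \<Longrightarrow> \<bar>r - t\<bar> < d \<Longrightarrow> c r \<in> x ` ball u \<rho>'"
        using nbhd[of t "x ` ball u \<rho>'"] True t by auto
      show ?thesis
      proof (intro exI[of _ d] conjI allI impI d(1))
        fix s r assume sr: "s \<le> t \<and> t \<le> r \<and> r - s < d"
        show "P s r"
          unfolding P_def
        proof (intro impI allI)
          fix w assume B: "a \<le> s \<and> s \<le> r \<and> r \<le> b" and w: "c s = x w" "w \<in> V"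
          have disp: "k * norm (the_inv_into V x (c r) - the_inv_into V x (c s)) \<le> integral {s..r} (speed c)"
            by (rule displacement_in_chart[OF x smooth_arc_subinterval[OF c(2)] _ \<open>ball u \<rho>' \<subseteq> V\<close> _ _ k])
              (use B sr in \<open>auto intro!: d(2) lower\<close>)
          obtain w' where w': "w' \<in> ball u \<rho>'" "c r = x w'" using d(2)[of r] B sr by auto
          then have "w' \<in> V" using \<open>ball u \<rho>' \<subseteq> V\<close> by auto
          then have "k * norm (w' - w) \<le> l s r"
            using disp w w'(2) by (simp add: l_def the_inv_into_f_f[OF ch(3)])
          moreover have "k * norm (w' - u) \<le> k * norm (w' - w) + k * norm (w - u)"
            using k norm_triangle_ineq[of "w' - w" "w - u"] by (simp add: distrib_left[symmetric])
          ultimately show "\<exists>w'\<in>V. c r = x w' \<and> k * norm (w' - u) \<le> k * norm (w - u) + l s r"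
            using \<open>w' \<in> V\<close> w'(2) by force
        qed
      qed
    next
      case False
      have "compact (x ` cball u \<rho>)"
        using \<rho> by (intro compact_continuous_image continuous_on_subset[OF ch(4)]) auto
      then have "open (- (x ` cball u \<rho>))" using compact_imp_closed by blast
      then have "openin (top_of_set M) (M - x ` cball u \<rho>)" by (auto simp: openin_open)
      moreover have "c t \<in> M - x ` cball u \<rho>"
        using False smooth_arc_in_M[OF c(2)] t \<rho>(2) by auto
      ultimately obtain d where d: "d > 0" "\<And>r. r \<in> {a..b} \<Longrightarrow> \<bar>r - t\<bar> < d \<Longrightarrow> c r \<notin> x ` cball u \<rho>"
        using nbhd[of t "M - x ` cball u \<rho>"] t by auto
      show ?thesis
      proof (intro exI[of _ d] conjI allI impI d(1))
        fix s r assume sr: "s \<le> t \<and> t \<le> r \<and> r - s < d"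
        show "P s r"
          unfolding P_def
        proof (intro impI allI)
          fix w assume B: "a \<le> s \<and> s \<le> r \<and> r \<le> b" and w: "c s = x w" "k * norm (w - u) + l s r < k * \<rho>"
          have "k * norm (w - u) < k * \<rho>" using w(2) l0[of s r] B by auto
          then have "w \<in> cball u \<rho>" using k by (simp add: dist_norm norm_minus_commute)
          moreover have "c s \<notin> x ` cball u \<rho>" using d(2)[of s] B sr by auto
          ultimately show "\<exists>w'\<in>V. c r = x w' \<and> k * norm (w' - u) \<le> k * norm (w - u) + l s r"
            using w(1) by blast
        qed
      qed
    qed
  qed
  moreover have "l a b = L" unfolding l_def using c(5) by (rule integral_unique)
  moreover have "w \<in> V"
  proof -
    have "k * norm (w - u) < k * \<rho>" using w(2) seg_nonneg[OF sg] by simp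
    then have "norm (w - u) < \<rho>" using k by simp
    then show ?thesis using \<rho> by (auto simp: dist_norm norm_minus_commute)
  qed
  ultimately show ?thesis
    using that w c(1,3,4) unfolding P_def by force
qed

text \<open>On a compact coordinate ball the metric is bounded below by a multiple of the Euclidean metric, as
  its minimum over the compact set of points and unit vectors is positive. Hence short curves from
  the centre stay in the coordinate ball.\<close>

lemma dist_ball_precompact:
  assumes p: "p \<in> M"
  obtains r K where "r > 0" "compact K" "K \<subseteq> M" "dist_ball p r \<subseteq> K"
proof -
  obtain V x u where x: "(V, x) \<in> A" "u \<in> V" "x u = p" using chart_covers[OF manifold p] by blast
  note ch = chartD[OF manifold x(1)]
  interpret patch: parametrized_immersion V "f \<circ> x"
    by (rule parametrized_immersion_chart[OF manifold immersed x(1)])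
  obtain \<delta> where \<delta>: "\<delta> > 0" "cball u \<delta> \<subseteq> V" using patch.open_V x(2) open_contains_cball by blast
  define D where "D z = norm (\<Sum>i\<in>UNIV. snd z $ i *\<^sub>R patch.E i (fst z))" for z :: "(real^'m) \<times> (real^'m)"
  let ?S = "cball u \<delta> \<times> sphere (0::real^'m) 1"
  have "continuous_on (cball u \<delta>) (patch.E i)" for i
    using continuous_on_subset[OF smooth_on_continuous[OF patch.smooth_E] \<delta>(2)] .
  then have "continuous_on ?S (\<lambda>z. patch.E i (fst z))" for i
    by (rule continuous_on_compose2[OF _ continuous_on_fst[OF continuous_on_id]]) auto
  then have "continuous_on ?S D"
    unfolding D_def by (intro continuous_intros)
  moreover have "compact ?S" by (intro compact_Times) auto
  moreover have "?S \<noteq> {}"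
    using \<delta>(1) vector_choose_size[of 1, where 'a="real^'m"] by auto
  ultimately obtain z where z: "z \<in> ?S" "\<And>z'. z' \<in> ?S \<Longrightarrow> D z \<le> D z'"
    using continuous_attains_inf[of ?S D] by blast
  define k where "k = D z"
  have Dv: "D (y, w) = norm (fderiv (f \<circ> x) y w)" if "y \<in> cball u \<delta>" for y w
    using that \<delta>(2) by (auto simp: D_def patch.derivative_eq)
  have zV: "fst z \<in> V" "snd z \<noteq> 0" using z(1) \<delta>(2) by (auto simp: mem_Times_iff)
  then have "fderiv (f \<circ> x) (fst z) (snd z) \<noteq> 0"
    using patch.inj_derivative patch.linear_derivative by (metis linear_injective_0)
  then have k: "k > 0" using Dv[of "fst z" "snd z"] z(1) by (auto simp: k_def mem_Times_iff)
  have lower: "k * norm w \<le> norm (fderiv (f \<circ> x) y w)" if y: "y \<in> cball u \<delta>" for y w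
  proof (cases "w = 0")
    case False
    have lin: "linear (fderiv (f \<circ> x) y)" using y \<delta>(2) by (intro patch.linear_derivative) auto
    have "k \<le> D (y, w /\<^sub>R norm w)" unfolding k_def using y False by (intro z(2)) auto
    then have "k \<le> norm (fderiv (f \<circ> x) y w) / norm w"
      using Dv[OF y] False by (simp add: linear_scale[OF lin] divide_inverse mult.commute)
    then show ?thesis using False by (simp add: pos_le_divide_eq)
  qed simp
  define \<rho> where "\<rho> = \<delta> / 2"
  have \<rho>: "\<rho> < \<delta>" "0 < \<rho>" using \<delta>(1) by (auto simp: \<rho>_def)
  have stay: "reach p' q L \<Longrightarrow> p' = p \<Longrightarrow> L < k * \<rho> \<Longrightarrow> \<exists>w. q = x w \<and> k * norm (w - u) \<le> L" for p' q L
  proof (induction rule: reach.induct)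
    case (refl p')
    then show ?case using x(3) by (intro exI[of _ u]) auto
  next
    case (step p' q L r L')
    have L': "0 \<le> L'" using seg_nonneg[OF step.hyps(2)] .
    then obtain w where w: "q = x w" "k * norm (w - u) \<le> L" using step by auto
    obtain w' where "r = x w'" "k * norm (w' - u) \<le> k * norm (w - u) + L'"
      by (rule short_curve_stays_in_chart[OF x(1) \<delta>(2) \<rho>(1) lower k step.hyps(2) w(1)])
        (use w(2) step.prems(2) in auto)
    then show ?case using w(2) by (intro exI[of _ w']) auto
  qed
  have "dist_ball p (k * \<rho>) \<subseteq> x ` cball u \<rho>"
  proof
    fix q assume "q \<in> dist_ball p (k * \<rho>)"
    then obtain L w where "L < k * \<rho>" "q = x w" "k * norm (w - u) \<le> L"
      using stay unfolding dist_ball_def by blast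
    moreover from this have "norm (w - u) \<le> \<rho>" using k by (metis less_eq_real_def mult_le_cancel_left_pos order_le_less_trans)
    ultimately show "q \<in> x ` cball u \<rho>" by (auto simp: dist_norm norm_minus_commute)
  qed
  moreover have "compact (x ` cball u \<rho>)"
    using \<rho> \<delta>(2) by (intro compact_continuous_image continuous_on_subset[OF ch(4)]) auto
  moreover have "cball u \<rho> \<subseteq> V" using \<rho> \<delta>(2) by auto
  then have "x ` cball u \<rho> \<subseteq> M" using ch(5) by blast
  ultimately show ?thesis using that[of "k * \<rho>" "x ` cball u \<rho>"] k \<rho>(2) by auto
qed

end

section \<open>Completeness and boundedness imply compactness\<close>

context immersed_manifold
begin

lemma dist_ball_triangle:
  assumes "reach p q L"
  shows "dist_ball q r \<subseteq> dist_ball p (L + r)"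
proof
  fix z assume "z \<in> dist_ball q r"
  then obtain L' where "L' < r" "reach q z L'" by (auto simp: dist_ball_def)
  then show "z \<in> dist_ball p (L + r)"
    using reach_trans[OF _ assms, of z L'] by (force simp: dist_ball_def)
qed

lemma dist_ball_mono: "r \<le> s \<Longrightarrow> dist_ball p r \<subseteq> dist_ball p s"
  by (auto simp: dist_ball_def intro: less_le_trans)

text \<open>Balls contained in a compact subset of \<open>M\<close>. Relative compactness is expressed without
  closures because \<open>M\<close> need not be closed in the surrounding space.\<close>

definition precompact_ball :: "'p \<Rightarrow> real \<Rightarrow> bool" where
  "precompact_ball p r \<longleftrightarrow> (\<exists>K. compact K \<and> K \<subseteq> M \<and> dist_ball p r \<subseteq> K)"

lemma precompact_ball_subset: "precompact_ball q s \<Longrightarrow> dist_ball p r \<subseteq> dist_ball q s \<Longrightarrow> precompact_ball p r"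
  unfolding precompact_ball_def by blast

text \<open>If the concentric ball of radius \<open>3/4 * r\<close> is precompact and all points of the ball
  of radius \<open>r\<close> have precompact balls of radius \<open>r/2\<close>, then finitely
  many of the latter cover a ball of radius larger than \<open>r\<close>: a chain that leads to a
  point of the larger ball is cut at length \<open>5/8 * r\<close>, and the cutting point lies
  within \<open>r/16\<close> of one of finitely many centres.\<close>

lemma precompact_ball_enlarge:
  assumes p: "p \<in> M" and r: "r > 0" and K: "compact K" "K \<subseteq> M" "dist_ball p (3/4 * r) \<subseteq> K"
    and half: "\<And>q. q \<in> dist_ball p r \<Longrightarrow> precompact_ball q (r/2)"
  shows "precompact_ball p (17/16 * r)"
proof -
  have "\<forall>q\<in>K. \<exists>N. open N \<and> q \<in> N \<and> M \<inter> N \<subseteq> dist_ball q (r/16)"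
    using dist_ball_neighborhood[of _ "r/16"] K(2) r by (metis subsetD divide_pos_pos zero_less_numeral)
  then obtain N where N: "\<And>q. q \<in> K \<Longrightarrow> open (N q) \<and> q \<in> N q \<and> M \<inter> N q \<subseteq> dist_ball q (r/16)" by metis
  obtain F where F: "F \<subseteq> K" "finite F" "K \<subseteq> (\<Union>q\<in>F. N q)"
    using compactE_image[OF K(1), of K N] N by (metis UN_I subsetI)
  define F' where "F' = F \<inter> dist_ball p r"
  have "\<forall>q\<in>F'. \<exists>C. compact C \<and> C \<subseteq> M \<and> dist_ball q (r/2) \<subseteq> C"
    using half unfolding F'_def precompact_ball_def by blast
  then obtain C where C: "\<And>q. q \<in> F' \<Longrightarrow> compact (C q) \<and> C q \<subseteq> M \<and> dist_ball q (r/2) \<subseteq> C q" by metis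
  have "dist_ball p (17/16 * r) \<subseteq> (\<Union>q\<in>F'. C q)"
  proof
    fix z assume "z \<in> dist_ball p (17/16 * r)"
    then obtain L where L: "L < 17/16 * r" "reach p z L" by (auto simp: dist_ball_def)
    \<comment> \<open>cut so early that the first part stays in \<open>K\<close>, and so late that the second part is shorter than \<open>7/16 * r\<close>\<close>
    define s where "s = min L (5/8 * r)"
    obtain y where y: "reach p y s" "reach y z (L - s)"
      using reach_split[OF L(2), of s] reach_nonneg[OF L(2)] r by (auto simp: s_def)
    have s: "s < 3/4 * r" "L - s < 7/16 * r" using L(1) r by (auto simp: s_def min_def)
    have "y \<in> K" using y(1) s(1) K(3) by (auto simp: dist_ball_def)
    then obtain q where q: "q \<in> F" "y \<in> N q" using F(3) by blast
    have "q \<in> K" using q(1) F(1) by blast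
    moreover have "y \<in> M" using \<open>y \<in> K\<close> K(2) by blast
    ultimately have "y \<in> dist_ball q (r/16)" using N q(2) by blast
    then obtain L' where L': "L' < r/16" "reach q y L'" by (auto simp: dist_ball_def)
    have "reach p q (s + L')" using reach_sym[OF L'(2)] y(1) by (rule reach_trans)
    moreover have "s + L' < r" using s(1) L'(1) r by simp
    ultimately have "q \<in> F'" using q(1) by (auto simp: F'_def dist_ball_def)
    moreover have "reach q z (L' + (L - s))" using y(2) L'(2) by (rule reach_trans)
    moreover have "L' + (L - s) < r/2" using s(2) L'(1) by simp
    ultimately have "q \<in> F'" "z \<in> dist_ball q (r/2)" unfolding dist_ball_def by blast+
    then show "z \<in> (\<Union>q\<in>F'. C q)" using C by blast
  qed
  moreover have "compact (\<Union>q\<in>F'. C q)" using C F(2) by (intro compact_UN) (auto simp: F'_def)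
  moreover have "(\<Union>q\<in>F'. C q) \<subseteq> M" using C by blast
  ultimately show ?thesis unfolding precompact_ball_def by blast
qed

text \<open>A version of the theorem of Hopf and Rinow that avoids geodesics. Let \<open>\<rho> p\<close> be
  the supremum of the radii of precompact balls at \<open>p\<close>. If \<open>M\<close> is not
  compact, then by boundedness \<open>\<rho>\<close> is finite, and
  \<open>precompact_ball_enlarge\<close> shows that within distance \<open>\<rho> p\<close> of
  \<open>p\<close> there is a point where \<open>\<rho>\<close> is at most
  \<open>\<rho> p / 2\<close>. Iterating gives a Cauchy sequence along which
  \<open>\<rho>\<close> tends to 0. This is impossible near its limit, which has a precompact ball
  of positive radius.\<close>

theorem compact_if_complete_bounded:
  assumes complete: "complete_submanifold M A f" and ne: "M \<noteq> {}"
    and bounded: "\<And>p q. p \<in> M \<Longrightarrow> q \<in> M \<Longrightarrow> \<exists>L<D. reach p q L"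
  shows "compact M"
proof (rule ccontr)
  assume nc: "\<not> compact M"
  have D: "\<not> precompact_ball p D" if "p \<in> M" for p
  proof
    assume "precompact_ball p D"
    then obtain K where "compact K" "K \<subseteq> M" "dist_ball p D \<subseteq> K" by (auto simp: precompact_ball_def)
    moreover have "M \<subseteq> dist_ball p D" using bounded that by (auto simp: dist_ball_def)
    ultimately show False using nc by (metis subset_antisym subset_trans)
  qed
  define R where "R p = {r. r > 0 \<and> precompact_ball p r}" for p
  define \<rho> where "\<rho> p = Sup (R p)" for p
  have R_le: "r \<le> D" if "p \<in> M" "r \<in> R p" for p r
    using D[OF that(1)] that(2) precompact_ball_subset[of p r p D] dist_ball_mono[of D r p]
    by (force simp: R_def)
  have R_ne: "\<exists>r. r \<in> R p" if "p \<in> M" for p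
    using dist_ball_precompact[OF that] by (force simp: R_def precompact_ball_def)
  have bdd: "bdd_above (R p)" if "p \<in> M" for p
    by (rule bdd_aboveI[of _ D]) (rule R_le[OF that])
  have \<rho>_upper: "r \<le> \<rho> p" if "p \<in> M" "r > 0" "precompact_ball p r" for p r
    unfolding \<rho>_def using bdd[OF that(1)] that by (intro cSup_upper) (auto simp: R_def)
  have \<rho>_pos: "\<rho> p > 0" if p: "p \<in> M" for p
  proof -
    obtain r where r: "r > 0" "precompact_ball p r" using R_ne[OF p] by (auto simp: R_def)
    then show ?thesis using \<rho>_upper[OF p r] by simp
  qed
  have \<rho>_less: "precompact_ball p r" if p: "p \<in> M" and r: "r < \<rho> p" for p r
  proof -
    have "R p \<noteq> {}" using R_ne[OF p] by blast
    then obtain s where "s \<in> R p" "r < s"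
      using r less_cSup_iff[OF _ bdd[OF p], of r] unfolding \<rho>_def by blast
    then show ?thesis using precompact_ball_subset[of p s p r] dist_ball_mono[of r s p] by (auto simp: R_def)
  qed
  have step: "\<exists>q. q \<in> dist_ball p (\<rho> p) \<and> \<rho> q \<le> \<rho> p / 2" if p: "p \<in> M" for p
  proof (rule ccontr)
    assume "\<nexists>q. q \<in> dist_ball p (\<rho> p) \<and> \<rho> q \<le> \<rho> p / 2"
    then have "precompact_ball q (\<rho> p / 2)" if "q \<in> dist_ball p (\<rho> p)" for q
      using that \<rho>_less[of q "\<rho> p / 2"] reach_in_M by (force simp: dist_ball_def)
    moreover have "precompact_ball p (3/4 * \<rho> p)" using \<rho>_less[OF p, of "3/4 * \<rho> p"] \<rho>_pos[OF p] by simp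
    then obtain K where "compact K" "K \<subseteq> M" "dist_ball p (3/4 * \<rho> p) \<subseteq> K" by (auto simp: precompact_ball_def)
    ultimately have "precompact_ball p (17/16 * \<rho> p)"
      using precompact_ball_enlarge[OF p \<rho>_pos[OF p]] by blast
    then show False using \<rho>_upper[OF p, of "17/16 * \<rho> p"] \<rho>_pos[OF p] by simp
  qed
  obtain p0 where p0: "p0 \<in> M" using ne by blast
  define next_point where "next_point p = (SOME q. q \<in> dist_ball p (\<rho> p) \<and> \<rho> q \<le> \<rho> p / 2)" for p
  have nextp: "next_point p \<in> dist_ball p (\<rho> p)" "\<rho> (next_point p) \<le> \<rho> p / 2" if "p \<in> M" for p
    using someI_ex[OF step[OF that]] by (auto simp: next_point_def)
  define s where "s n = (next_point ^^ n) p0" for n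
  have sM: "s n \<in> M" for n
  proof (induction n)
    case (Suc n)
    have "s (Suc n) = next_point (s n)" by (simp add: s_def)
    then show ?case using nextp(1)[OF Suc] reach_in_M by (auto simp: dist_ball_def)
  qed (simp add: s_def p0)
  have s_step: "s (Suc n) \<in> dist_ball (s n) (\<rho> (s n))" "\<rho> (s (Suc n)) \<le> \<rho> (s n) / 2" for n
    using nextp[OF sM[of n]] by (auto simp: s_def)
  have \<rho>_pow: "\<rho> (s n) \<le> \<rho> p0 * (1/2) ^ n" for n
  proof (induction n)
    case (Suc n)
    then show ?case using s_step(2)[of n] by simp
  qed (simp add: s_def)
  have tele: "\<exists>L. reach (s i) (s (i + k)) L \<and> L \<le> 2 * (\<rho> (s i) - \<rho> (s (i + k)))" for i k
  proof (induction k)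
    case 0
    then show ?case using reach.refl[OF sM] by (intro exI[of _ 0]) simp
  next
    case (Suc k)
    then obtain L where L: "reach (s i) (s (i + k)) L" "L \<le> 2 * (\<rho> (s i) - \<rho> (s (i + k)))" by blast
    obtain L' where L': "reach (s (i + k)) (s (Suc (i + k))) L'" "L' < \<rho> (s (i + k))"
      using s_step(1)[of "i + k"] by (auto simp: dist_ball_def)
    show ?case
      using reach_trans[OF L'(1) L(1)] L(2) L'(2) s_step(2)[of "i + k"] by (intro exI[of _ "L + L'"]) auto
  qed
  have lim0: "(\<lambda>n. \<rho> p0 * (1/2) ^ n) \<longlonglongrightarrow> 0"
    by (intro tendsto_mult_right_zero LIMSEQ_power_zero) simp
  have small: "\<exists>N. \<forall>n\<ge>N. \<rho> (s n) < e" if "e > 0" for e :: real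
  proof -
    have "\<forall>\<^sub>F n in sequentially. \<rho> p0 * (1/2) ^ n < e" using lim0 that by (rule order_tendstoD)
    then show ?thesis using \<rho>_pow unfolding eventually_sequentially by (meson order_le_less_trans)
  qed
  have cauchy: "\<exists>N. \<forall>i\<ge>N. \<forall>j\<ge>N. riemannian_dist M A f (s i) (s j) < ereal e" if e: "e > 0" for e :: real
  proof -
    obtain N where N: "\<And>n. n \<ge> N \<Longrightarrow> \<rho> (s n) < e / 2" using small[of "e/2"] e by auto
    have le: "\<exists>L<e. reach (s i) (s j) L" if "N \<le> i" "i \<le> j" for i j
    proof -
      obtain L where L: "reach (s i) (s (i + (j - i))) L" "L \<le> 2 * (\<rho> (s i) - \<rho> (s (i + (j - i))))" using tele by blast
      then have "L < e" using N[OF that(1)] \<rho>_pos[OF sM, of "i + (j - i)"] by simp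
      then show ?thesis using L(1) that by auto
    qed
    have "\<exists>L<e. reach (s i) (s j) L" if "N \<le> i" "N \<le> j" for i j
      using le[of i j] le[of j i] that reach_sym by (metis linear)
    then have "riemannian_dist M A f (s i) (s j) < ereal e" if "N \<le> i" "N \<le> j" for i j
      using that riemannian_dist_le by (metis ereal_less_le less_ereal.simps(1) order_le_less_trans)
    then show ?thesis by blast
  qed
  obtain l where l: "l \<in> M" "(\<lambda>n. riemannian_dist M A f (s n) l) \<longlonglongrightarrow> 0"
  proof -
    have "range s \<subseteq> M" using sM by auto
    then have "range s \<subseteq> M \<and> (\<forall>e>0. \<exists>N. \<forall>i\<ge>N. \<forall>j\<ge>N. riemannian_dist M A f (s i) (s j) < ereal e)"
      using cauchy by simp
    then have "\<exists>l\<in>M. (\<lambda>n. riemannian_dist M A f (s n) l) \<longlonglongrightarrow> 0"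
      by (rule complete[unfolded complete_submanifold_def, THEN spec, THEN mp])
    then show ?thesis using that by blast
  qed
  obtain r where r: "r > 0" "precompact_ball l r" using R_ne[OF l(1)] by (auto simp: R_def)
  obtain N where N: "\<And>n. n \<ge> N \<Longrightarrow> \<rho> (s n) < r / 2" using small[of "r/2"] r(1) by auto
  have "\<forall>\<^sub>F n in sequentially. riemannian_dist M A f (s n) l < ereal (r/2)"
    using l(2) r(1) by (intro order_tendstoD(2)[OF l(2)]) simp
  then obtain N' where N': "\<And>n. n \<ge> N' \<Longrightarrow> riemannian_dist M A f (s n) l < ereal (r/2)"
    by (auto simp: eventually_sequentially)
  define n where "n = max N N'"
  obtain L where L: "L < r/2" "reach (s n) l L" using riemannian_dist_less[OF N'[of n]] by (auto simp: n_def)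
  have "dist_ball (s n) (r/2) \<subseteq> dist_ball l r"
    using dist_ball_triangle[OF reach_sym[OF L(2)], of "r/2"] dist_ball_mono[of "L + r/2" r l] L(1) by auto
  then have "precompact_ball (s n) (r/2)" by (rule precompact_ball_subset[OF r(2)])
  then have "r/2 \<le> \<rho> (s n)" using r(1) by (intro \<rho>_upper[OF sM]) simp_all
  then show False using N[of n] by (simp add: n_def)
qed

end

section \<open>Compact minimal submanifolds\<close>

lemma second_derivative_at_max:
  fixes h h' :: "real \<Rightarrow> real"
  assumes e: "e > 0" and d: "\<And>t. \<bar>t\<bar> < e \<Longrightarrow> (h has_real_derivative h' t) (at t)"
    and d2: "(h' has_real_derivative c) (at 0)" and max: "\<And>t. \<bar>t\<bar> < e \<Longrightarrow> h t \<le> h 0"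
  shows "c \<le> 0"
proof (rule ccontr)
  assume "\<not> c \<le> 0"
  then have c: "c > 0" by simp
  have "h' 0 = 0"
    using DERIV_local_max[OF d[of 0] e] max e by simp
  then obtain \<delta> where \<delta>: "\<delta> > 0" "\<And>t. 0 < t \<Longrightarrow> t < \<delta> \<Longrightarrow> 0 < h' t"
    using DERIV_pos_inc_right[OF d2 c] by auto
  define t where "t = min \<delta> e / 2"
  have t: "0 < t" "t < \<delta>" "t < e" using \<delta>(1) e by (auto simp: t_def min_def)
  have "(h has_real_derivative h' s) (at s)" if "0 \<le> s" "s \<le> t" for s
    using that t by (intro d) auto
  then obtain s where s: "0 < s" "s < t" "h t - h 0 = (t - 0) * h' s" using MVT2[OF t(1)] by blast
  have "h t - h 0 > 0" using s \<delta>(2)[of s] t by simp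
  then show False using max[of t] t by simp
qed

context parametrized_immersion
begin

lemma hessian_norm_at_max:
  assumes u: "u \<in> V" and max: "\<And>y. y \<in> V \<Longrightarrow> \<Phi> y \<bullet> \<Phi> y \<le> \<Phi> u \<bullet> \<Phi> u"
  shows "\<Phi> u \<bullet> fderiv \<Phi> u v = 0"
    and "fderiv \<Phi> u v \<bullet> fderiv \<Phi> u v +
      \<Phi> u \<bullet> (\<Sum>i\<in>UNIV. \<Sum>j\<in>UNIV. (v $ i * v $ j) *\<^sub>R H i j u) \<le> 0"
proof -
  obtain \<delta> where \<delta>: "\<delta> > 0" "ball u \<delta> \<subseteq> V" using open_V u open_contains_ball by blast
  define e where "e = \<delta> / (norm v + 1)"
  have e: "e > 0" using \<delta>(1) by (simp add: e_def add_nonneg_pos)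
  have line: "u + t *\<^sub>R v \<in> V" if "\<bar>t\<bar> < e" for t
  proof -
    have "norm (t *\<^sub>R v) \<le> \<bar>t\<bar> * (norm v + 1)" by (simp add: algebra_simps)
    also have "\<dots> < e * (norm v + 1)" using that by (intro mult_strict_right_mono) (auto simp: add_nonneg_pos)
    also have "\<dots> = \<delta>" using norm_ge_zero[of v] by (simp add: e_def del: norm_ge_zero)
    finally show ?thesis using \<delta>(2) by (auto simp: dist_norm)
  qed
  define h where "h t = \<Phi> (u + t *\<^sub>R v) \<bullet> \<Phi> (u + t *\<^sub>R v)" for t
  define D where "D y = fderiv \<Phi> y v" for y
  define h' where "h' t = 2 * (\<Phi> (u + t *\<^sub>R v) \<bullet> D (u + t *\<^sub>R v))" for t
  have smD: "smooth_on V D" unfolding D_def[abs_def] using smooth by (rule smooth_on_derivative)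
  have along: "((\<lambda>t. F (u + t *\<^sub>R v)) has_vector_derivative fderiv F (u + t *\<^sub>R v) v) (at t)"
    if "smooth_on V F" "\<bar>t\<bar> < e" for F :: "real^'m \<Rightarrow> 'e" and t
  proof -
    have "((\<lambda>t. u + t *\<^sub>R v) has_derivative (\<lambda>s. s *\<^sub>R v)) (at t)" by (auto intro!: derivative_eq_intros)
    from diff_chain_at[OF this smooth_on_has_derivative[OF that(1) line[OF that(2)]]]
    show ?thesis
      using linear_scale[OF smooth_on_linear_derivative[OF that(1) line[OF that(2)]]]
      by (simp add: has_vector_derivative_def o_def)
  qed
  have dh: "(h has_real_derivative h' t) (at t)" if "\<bar>t\<bar> < e" for t
  proof -
    have "(h has_vector_derivative (\<Phi> (u + t *\<^sub>R v) \<bullet> D (u + t *\<^sub>R v) + D (u + t *\<^sub>R v) \<bullet> \<Phi> (u + t *\<^sub>R v))) (at t)"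
      unfolding h_def[abs_def] D_def
      by (rule bounded_bilinear.has_vector_derivative[OF bounded_bilinear_inner along[OF smooth that] along[OF smooth that]])
    then show ?thesis by (simp add: has_real_derivative_iff_has_vector_derivative h'_def inner_commute)
  qed
  have "(h' has_vector_derivative 2 *\<^sub>R (\<Phi> (u + 0 *\<^sub>R v) \<bullet> fderiv D (u + 0 *\<^sub>R v) v +
      D (u + 0 *\<^sub>R v) \<bullet> D (u + 0 *\<^sub>R v))) (at 0)"
    unfolding h'_def[abs_def] real_scaleR_def[symmetric] D_def
    by (intro bounded_linear.has_vector_derivative[OF bounded_linear_scaleR_right]
        bounded_bilinear.has_vector_derivative[OF bounded_bilinear_inner along[OF smooth] along[OF smD[unfolded D_def[abs_def]]]])
      (use e in auto)
  then have dh': "(h' has_real_derivative 2 * (\<Phi> u \<bullet> fderiv D u v + D u \<bullet> D u)) (at 0)"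
    by (simp add: has_real_derivative_iff_has_vector_derivative)
  have hmax: "h t \<le> h 0" if "\<bar>t\<bar> < e" for t using max[OF line[OF that]] by (simp add: h_def)
  show "\<Phi> u \<bullet> fderiv \<Phi> u v = 0"
    using DERIV_local_max[OF dh[of 0] e] hmax e by (simp add: h'_def D_def)
  have "\<Phi> u \<bullet> fderiv D u v + D u \<bullet> D u \<le> 0"
    using second_derivative_at_max[OF e dh dh' hmax] by simp
  moreover have "fderiv D u v = (\<Sum>i\<in>UNIV. \<Sum>j\<in>UNIV. (v $ i * v $ j) *\<^sub>R H i j u)"
  proof -
    have "((\<lambda>y. \<Sum>j\<in>UNIV. v $ j *\<^sub>R E j y) has_derivative (\<lambda>d. \<Sum>j\<in>UNIV. v $ j *\<^sub>R fderiv (E j) u d)) (at u)"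
      by (intro has_derivative_sum has_derivative_scaleR_right smooth_on_has_derivative[OF smooth_E u])
    then have "(D has_derivative (\<lambda>d. \<Sum>j\<in>UNIV. v $ j *\<^sub>R fderiv (E j) u d)) (at u)"
      by (rule has_derivative_transform_within_open[OF _ open_V u]) (simp add: D_def derivative_eq)
    then have "(\<lambda>d. \<Sum>j\<in>UNIV. v $ j *\<^sub>R fderiv (E j) u d) = fderiv D u"
      by (rule frechet_derivative_at)
    from fun_cong[OF this[symmetric], of v]
    have "fderiv D u v = (\<Sum>j\<in>UNIV. v $ j *\<^sub>R fderiv (E j) u v)" .
    moreover have "fderiv (E j) u v = (\<Sum>i\<in>UNIV. v $ i *\<^sub>R H i j u)" for j
      using linear_axis_expansion[OF smooth_on_linear_derivative[OF smooth_E u], of j v]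
      by (simp add: pderiv_at_def)
    ultimately have "fderiv D u v = (\<Sum>j\<in>UNIV. \<Sum>i\<in>UNIV. (v $ i * v $ j) *\<^sub>R H i j u)"
      by (simp add: scaleR_sum_right mult.commute)
    also have "\<dots> = (\<Sum>i\<in>UNIV. \<Sum>j\<in>UNIV. (v $ i * v $ j) *\<^sub>R H i j u)" by (rule sum.swap)
    finally show ?thesis .
  qed
  ultimately show "fderiv \<Phi> u v \<bullet> fderiv \<Phi> u v +
      \<Phi> u \<bullet> (\<Sum>i\<in>UNIV. \<Sum>j\<in>UNIV. (v $ i * v $ j) *\<^sub>R H i j u) \<le> 0"
    by (simp add: D_def)
qed

end

lemma minimal_no_max_norm:
  fixes \<Phi> :: "real^'m::finite \<Rightarrow> real^'k::finite"
  assumes im: "parametrized_immersion V \<Phi>" and u: "u \<in> V" and minimal: "mean_curvature \<Phi> u = 0"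
    and max: "\<And>y. y \<in> V \<Longrightarrow> \<Phi> y \<bullet> \<Phi> y \<le> \<Phi> u \<bullet> \<Phi> u"
  shows False
proof -
  interpret parametrized_immersion V \<Phi> by (rule im)
  obtain Q :: "real^'m^'m" where Q: "orthonormal_frame (\<chi> i. fderiv \<Phi> u (Q $ i))"
    using oriented_orthonormal_basis_exists[OF linear_derivative[OF u] inj_derivative[OF u]] by blast
  then have on: "fderiv \<Phi> u (Q $ a) \<bullet> fderiv \<Phi> u (Q $ b) = (if a = b then 1 else 0)" for a b
    by (simp add: orthonormal_frame_def)
  have normal: "\<Phi> u \<bullet> E i u = 0" for i
    using hessian_norm_at_max(1)[OF u max, of "axis i 1"] by (simp add: pderiv_at_def)
  then have n: "\<Phi> u \<bullet> z = \<Phi> u \<bullet> normal_part u z" for z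
    by (subst tangential_expansion[of z u]) (simp add: inner_add_right inner_sum_right)
  have "(\<Sum>a\<in>UNIV. fderiv \<Phi> u (Q $ a) \<bullet> fderiv \<Phi> u (Q $ a) +
      \<Phi> u \<bullet> (\<Sum>i\<in>UNIV. \<Sum>j\<in>UNIV. (Q $ a $ i * Q $ a $ j) *\<^sub>R H i j u)) \<le> 0"
    by (intro sum_nonpos hessian_norm_at_max(2)[OF u max])
  then have "real CARD('m) + (\<Sum>a\<in>UNIV. \<Sum>i\<in>UNIV. \<Sum>j\<in>UNIV. (Q $ a $ i * Q $ a $ j) * (\<Phi> u \<bullet> H i j u)) \<le> 0"
    by (simp add: on sum.distrib inner_sum_right)
  also have "(\<Sum>a\<in>UNIV. \<Sum>i\<in>UNIV. \<Sum>j\<in>UNIV. (Q $ a $ i * Q $ a $ j) * (\<Phi> u \<bullet> H i j u)) =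
      (\<Sum>i\<in>UNIV. \<Sum>j\<in>UNIV. ginv u $ i $ j * (\<Phi> u \<bullet> H i j u))"
    by (subst sum_rotate) (simp add: orthonormal_frame_ginv[OF u on, symmetric] sum_distrib_right)
  also have "\<dots> = \<Phi> u \<bullet> (\<Sum>i\<in>UNIV. \<Sum>j\<in>UNIV. ginv u $ i $ j *\<^sub>R normal_part u (H i j u))"
    by (simp add: inner_sum_right n[of "H _ _ u"])
  also have "\<dots> = 0"
    using minimal by (simp add: mean_curvature_def second_fundamental_form_eq[OF u])
  finally show False by simp
qed

text \<open>At a maximum of the squared norm of the position vector, this vector is normal, and half the trace
  of the Hessian is the dimension plus the inner product of the position vector with the trace of
  the second fundamental form. Minimality makes the second term vanish, and a positive trace
  contradicts the maximum.\<close>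

theorem minimal_submanifold_not_compact:
  fixes f :: "'p::{second_countable_topology, t2_space} \<Rightarrow> real^'k::finite" and A :: "('p, 'm::finite) atlas"
  assumes M: "oriented_smooth_manifold M A" and f: "immersion A f" and minimal: "minimal_submanifold A f"
    and ne: "M \<noteq> {}"
  shows "\<not> compact M"
proof
  assume "compact M"
  interpret immersed_manifold M A f by (rule immersed_manifold.intro) (fact M f)+
  have "continuous_on M f"
    by (rule continuous_on_manifold) (rule smooth_on_continuous[OF immersionD(1)[OF f]])
  then have "continuous_on M (\<lambda>p. f p \<bullet> f p)" by (intro continuous_intros)
  then obtain p where p: "p \<in> M" "\<And>q. q \<in> M \<Longrightarrow> f q \<bullet> f q \<le> f p \<bullet> f p"
    using continuous_attains_sup[OF \<open>compact M\<close> ne] by blast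
  obtain V x u where x: "(V, x) \<in> A" "u \<in> V" "x u = p" using chart_covers[OF M p(1)] by blast
  have "mean_curvature (f \<circ> x) u = 0" using minimal x by (auto simp: minimal_submanifold_def)
  moreover have "(f \<circ> x) y \<bullet> (f \<circ> x) y \<le> (f \<circ> x) u \<bullet> (f \<circ> x) u" if "y \<in> V" for y
    using p(2) x(3) chartD(5)[OF M x(1)] that by auto
  ultimately show False
    using minimal_no_max_norm[OF parametrized_immersion_chart[OF M f x(1)] x(2)] by blast
qed

section \<open>Pulling back curves along an embedding\<close>

lemma smooth_on_chain_velocity:
  fixes h :: "real \<Rightarrow> 'a::euclidean_space"
  assumes h: "smooth_on S h" and G: "smooth_on V G" and \<tau>: "\<tau> \<in> S" "h \<tau> \<in> V"
  shows "((\<lambda>\<tau>. G (h \<tau>)) has_vector_derivative fderiv G (h \<tau>) (fderiv h \<tau> 1)) (at \<tau>)"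
proof -
  define d where "d = fderiv h \<tau> 1"
  have dh: "(h has_derivative (\<lambda>z. z *\<^sub>R d)) (at \<tau>)"
    using smooth_on_has_vector_derivative[OF h \<tau>(1)] by (simp add: d_def has_vector_derivative_def)
  have "(G \<circ> h has_derivative fderiv G (h \<tau>) \<circ> (\<lambda>z. z *\<^sub>R d)) (at \<tau>)"
    by (rule diff_chain_at[OF dh smooth_on_has_derivative[OF G \<tau>(2)]])
  moreover have "fderiv G (h \<tau>) \<circ> (\<lambda>z. z *\<^sub>R d) = (\<lambda>z. z *\<^sub>R fderiv G (h \<tau>) d)"
    using linear_scale[OF smooth_on_linear_derivative[OF G \<tau>(2)]] by (simp add: fun_eq_iff)
  ultimately show ?thesis by (simp add: has_vector_derivative_def comp_def d_def)
qed

context immersed_manifold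
begin

text \<open>A local left inverse \<open>r\<close> of the immersion \<open>F \<circ> x\<close>, defined on an
  open subset of the ambient space, maps the smooth extension of \<open>c\<close> into the chart,
  even where this extension leaves the image of \<open>F\<close>. Thus the lifted curve also
  extends smoothly beyond its end points.\<close>

lemma pull_back_curve_locally:
  fixes F :: "'p \<Rightarrow> 'd::euclidean_space" and c :: "real \<Rightarrow> 'd"
  assumes F: "immersion A F" and x: "(V, x) \<in> A" and \<kappa>: "\<kappa> > 0"
    and expand: "\<forall>u\<in>V. \<forall>v.
      \<kappa> * norm (fderiv (f \<circ> x) u v) \<le> norm (fderiv (F \<circ> x) u v)"
    and T: "open T" "smooth_on T c" "{s..t} \<subseteq> T" and st: "s \<le> t"
    and U: "U \<subseteq> V" and W: "open W" "(F \<circ> x) ` U \<subseteq> W" "smooth_on W r" "r ` W \<subseteq> U"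
      "\<And>u. u \<in> U \<Longrightarrow> r ((F \<circ> x) u) = u"
    and e: "\<And>\<tau>. \<tau> \<in> {s..t} \<Longrightarrow> e \<tau> \<in> x ` U \<and> F (e \<tau>) = c \<tau>"
  shows "\<exists>L. reach (e s) (e t) L \<and> \<kappa> * L \<le> integral {s..t} (\<lambda>\<tau>. norm (fderiv c \<tau> 1))"
proof -
  define S where "S = T \<inter> c -` W"
  have S: "open S" unfolding S_def using T(1) smooth_on_continuous[OF T(2)] W(1) by (metis continuous_on_open_vimage Int_commute)
  define h where "h \<tau> = r (c \<tau>)" for \<tau>
  have smh: "smooth_on S h" unfolding h_def[abs_def]
    by (rule smooth_on_compose[OF S W(1) smooth_on_subset[OF T(2)] W(3)]) (auto simp: S_def)
  have hU: "h ` S \<subseteq> U" using W(4) by (auto simp: h_def S_def)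
  have on: "\<tau> \<in> S" "x (h \<tau>) = e \<tau>" "F (x (h \<tau>)) = c \<tau>" if \<tau>: "\<tau> \<in> {s..t}" for \<tau>
  proof -
    obtain w where w: "w \<in> U" "e \<tau> = x w" using e[OF \<tau>] by auto
    then have cw: "c \<tau> = (F \<circ> x) w" using e[OF \<tau>] by simp
    then have "c \<tau> \<in> W" using W(2) w(1) by auto
    then show "\<tau> \<in> S" using T(3) \<tau> by (auto simp: S_def)
    have "h \<tau> = w" unfolding h_def cw using W(5)[OF w(1)] .
    then show "x (h \<tau>) = e \<tau>" "F (x (h \<tau>)) = c \<tau>" using w(2) cw by auto
  qed
  have sub: "{s..t} \<subseteq> S" using on(1) by blast
  have sc: "smooth_arc (\<lambda>\<tau>. x (h \<tau>)) s t"
    by (rule smooth_arc_in_chart[OF x S smh order_trans[OF hU U] sub])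
  define d where "d \<tau> = fderiv h \<tau> 1" for \<tau>
  have bound: "\<kappa> * speed (\<lambda>\<tau>. x (h \<tau>)) \<tau> \<le> norm (fderiv c \<tau> 1)" if \<tau>: "\<tau> \<in> {s<..<t}" for \<tau>
  proof -
    have \<tau>S: "\<tau> \<in> S" using sub \<tau> by auto
    have hV: "h \<tau> \<in> V" using hU U \<tau>S by auto
    have "speed (\<lambda>\<tau>. x (h \<tau>)) \<tau> = norm (fderiv (f \<circ> x) (h \<tau>) (d \<tau>))"
      using smooth_on_chain_velocity[OF smh immersionD(1)[OF immersed x] \<tau>S hV]
      by (intro speed_eqI) (simp add: o_def d_def)
    moreover have "(c has_vector_derivative fderiv (F \<circ> x) (h \<tau>) (d \<tau>)) (at \<tau>)"
      unfolding d_def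
      by (rule has_vector_derivative_transform_within_open
          [OF smooth_on_chain_velocity[OF smh immersionD(1)[OF F x] \<tau>S hV] open_greaterThanLessThan \<tau>])
        (use on(3) in auto)
    then have "fderiv (F \<circ> x) (h \<tau>) (d \<tau>) = fderiv c \<tau> 1"
      using vector_derivative_unique_at[OF _ smooth_on_has_vector_derivative[OF T(2)]] \<tau>S by (auto simp: S_def)
    ultimately show ?thesis using expand[rule_format, OF hV, of "d \<tau>"] by simp
  qed
  \<comment> \<open>The bound holds at interior times only; the value 0 at the end points does not affect the integral.\<close>
  define sp where "sp \<tau> = (if \<tau> \<in> {s<..<t} then speed (\<lambda>\<tau>. x (h \<tau>)) \<tau> else 0)" for \<tau>
  have "(speed (\<lambda>\<tau>. x (h \<tau>)) has_integral integral {s..t} (speed (\<lambda>\<tau>. x (h \<tau>)))) {s..t}"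
    using smooth_arc_speed_integrable[OF sc] by (rule integrable_integral)
  then have sp: "(sp has_integral integral {s..t} (speed (\<lambda>\<tau>. x (h \<tau>)))) {s..t}"
    using has_integral_spike_interior[of "speed (\<lambda>\<tau>. x (h \<tau>))" _ s t sp] by (simp add: box_real sp_def)
  have "continuous_on {s..t} (\<lambda>\<tau>. norm (fderiv c \<tau> 1))"
    by (intro continuous_intros continuous_on_subset[OF smooth_on_continuous[OF smooth_on_derivative[OF T(2)]] T(3)])
  then have "(\<lambda>\<tau>. norm (fderiv c \<tau> 1)) integrable_on {s..t}" by (rule integrable_continuous_real)
  then have "\<kappa> * integral {s..t} (speed (\<lambda>\<tau>. x (h \<tau>))) \<le> integral {s..t} (\<lambda>\<tau>. norm (fderiv c \<tau> 1))"
    using bound by (intro has_integral_le[OF has_integral_mult_right[OF sp] integrable_integral]) (auto simp: sp_def)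
  moreover have "reach (e s) (e t) (integral {s..t} (speed (\<lambda>\<tau>. x (h \<tau>))))"
    using smooth_arc_reach[OF sc st] on(2) st by simp
  ultimately show ?thesis by blast
qed

text \<open>The inverse of an embedding is continuous, so the local lifts apply to all sufficiently short
  pieces of the curve, and bisection (the principle \<open>Bolzano\<close>) joins them.\<close>

lemma pull_back_curve:
  fixes F :: "'p \<Rightarrow> 'd::euclidean_space" and c :: "real \<Rightarrow> 'd"
  assumes F: "immersion A F" and h: "homeomorphism M (F ` M) F h" and \<kappa>: "\<kappa> > 0"
    and expand: "\<forall>(V, x)\<in>A. \<forall>u\<in>V. \<forall>v.
      \<kappa> * norm (fderiv (f \<circ> x) u v) \<le> norm (fderiv (F \<circ> x) u v)"
    and T: "open T" "smooth_on T c" "{a..b} \<subseteq> T" and ab: "a \<le> b" and im: "c ` {a..b} \<subseteq> F ` M"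
  shows "\<exists>L. reach (h (c a)) (h (c b)) L \<and> \<kappa> * L \<le> integral {a..b} (\<lambda>t. norm (fderiv c t 1))"
proof -
  define e where "e t = h (c t)" for t
  define sp where "sp t = norm (fderiv c t 1)" for t
  have "continuous_on {a..b} sp" unfolding sp_def[abs_def]
    by (intro continuous_intros continuous_on_subset[OF smooth_on_continuous[OF smooth_on_derivative[OF T(2)]] T(3)])
  then have int: "sp integrable_on {s..t}" if "a \<le> s" "t \<le> b" for s t
    by (intro integrable_continuous_real) (rule continuous_on_subset, use that in auto)
  have eM: "e t \<in> M" "F (e t) = c t" if "t \<in> {a..b}" for t
  proof -
    have "c t \<in> F ` M" using im that by auto
    then show "e t \<in> M" "F (e t) = c t" using h unfolding e_def homeomorphism_def by auto
  qed
  have conte: "continuous_on {a..b} e"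
    unfolding e_def
    by (rule continuous_on_compose2[OF _ continuous_on_subset[OF smooth_on_continuous[OF T(2)] T(3)] im])
      (use h in \<open>simp add: homeomorphism_def\<close>)
  define P where "P s t \<longleftrightarrow> (a \<le> s \<and> s \<le> t \<and> t \<le> b \<longrightarrow> (\<exists>L. reach (e s) (e t) L \<and> \<kappa> * L \<le> integral {s..t} sp))" for s t
  have "P a b"
  proof (rule Bolzano[OF ab])
    fix s t r assume P: "P s t" "P t r" and le: "s \<le> t" "t \<le> r"
    show "P s r"
      unfolding P_def
    proof
      assume B: "a \<le> s \<and> s \<le> r \<and> r \<le> b"
      obtain L L' where L: "reach (e s) (e t) L" "\<kappa> * L \<le> integral {s..t} sp"
        "reach (e t) (e r) L'" "\<kappa> * L' \<le> integral {t..r} sp"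
        using P B le unfolding P_def by (meson order_trans)
      have "integral {s..t} sp + integral {t..r} sp = integral {s..r} sp"
        using B le by (intro Henstock_Kurzweil_Integration.integral_combine int) auto
      then show "\<exists>L. reach (e s) (e r) L \<and> \<kappa> * L \<le> integral {s..r} sp"
        using reach_trans[OF L(3,1)] L(2,4) by (intro exI[of _ "L + L'"]) (auto simp: distrib_left)
    qed
  next
    fix t assume t: "a \<le> t" "t \<le> b"
    then have tab: "t \<in> {a..b}" by simp
    obtain V x u where x: "(V, x) \<in> A" "u \<in> V" "x u = e t" using chart_covers[OF manifold eM(1)[OF tab]] by blast
    obtain U W r where U: "open U" "U \<subseteq> V" "u \<in> U" and W: "open W" "(F \<circ> x) ` U \<subseteq> W" "smooth_on W r" "r ` W \<subseteq> U"
      "\<And>u. u \<in> U \<Longrightarrow> r ((F \<circ> x) u) = u"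
      using smooth_local_left_inverse[OF chartD(1)[OF manifold x(1)] immersionD(1)[OF F x(1)] x(2) immersionD(2)[OF F x(1,2)]]
      by blast
    have ex: "\<forall>u\<in>V. \<forall>v. \<kappa> * norm (fderiv (f \<circ> x) u v) \<le> norm (fderiv (F \<circ> x) u v)"
      using expand x(1) by auto
    obtain N where N: "open N" "x ` U = M \<inter> N" using openin_chart_image[OF x(1) U(1,2)] by blast
    have et: "e t \<in> x ` U" using x(3) U(3) by (metis imageI)
    have "openin (top_of_set {a..b}) ({a..b} \<inter> e -` N)"
      by (rule continuous_openin_preimage_gen[OF conte N(1)])
    moreover have "t \<in> {a..b} \<inter> e -` N" using tab N(2) et by auto
    ultimately obtain d where d: "d > 0" "\<forall>r\<in>{a..b}. dist r t < d \<longrightarrow> r \<in> {a..b} \<inter> e -` N"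
      unfolding openin_euclidean_subtopology_iff by blast
    show "\<exists>d>0. \<forall>s r. s \<le> t \<and> t \<le> r \<and> r - s < d \<longrightarrow> P s r"
    proof (intro exI[of _ d] conjI allI impI d(1))
      fix s r' assume sr: "s \<le> t \<and> t \<le> r' \<and> r' - s < d"
      show "P s r'"
        unfolding P_def
      proof
        assume B: "a \<le> s \<and> s \<le> r' \<and> r' \<le> b"
        have loc: "e \<tau> \<in> x ` U \<and> F (e \<tau>) = c \<tau>" if \<tau>: "\<tau> \<in> {s..r'}" for \<tau>
        proof -
          have "\<tau> \<in> {a..b}" "dist \<tau> t < d" using \<tau> B sr by (auto simp: dist_real_def)
          then show ?thesis using d(2) eM N(2) by auto
        qed
        have "{s..r'} \<subseteq> T" using T(3) B by auto
        then show "\<exists>L. reach (e s) (e r') L \<and> \<kappa> * L \<le> integral {s..r'} sp"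
          unfolding sp_def
          using pull_back_curve_locally[OF F x(1) \<kappa> ex T(1,2) _ _ U(2) W loc] B by auto
      qed
    qed
  qed
  then show ?thesis using ab by (simp add: P_def e_def sp_def[abs_def])
qed

end

section \<open>Curves in the Gauss image\<close>

definition speed_c :: "(real \<Rightarrow> (real, 'm::finite \<Rightarrow> 'k::finite) vec) \<Rightarrow> real \<Rightarrow> real" where
  "speed_c c t = sqrt (metric_c (c t) (vector_derivative c (at t)))"

text \<open>At an interior time the curve itself is an admissible path for computing the canonical metric on
  its velocity.\<close>

lemma speed_c_eq:
  fixes c :: "real \<Rightarrow> (real, 'm::finite \<Rightarrow> 'k::finite) vec"
  assumes T: "open T" "smooth_on T c'" "{a..b} \<subseteq> T" and eq: "\<And>t. t \<in> {a..b} \<Longrightarrow> c' t = c t"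
    and G: "c ` {a..b} \<subseteq> oriented_grassmannian" and t: "t \<in> {a<..<b}"
  shows "speed_c c t = norm (fderiv c' t 1) / sqrt (fact CARD('m))"
proof -
  let ?v = "fderiv c' t 1"
  have d: "(c' has_vector_derivative ?v) (at t)"
    using T(3) t by (intro smooth_on_has_vector_derivative[OF T(2)]) auto
  then have "(c has_vector_derivative ?v) (at t)"
    by (rule has_vector_derivative_transform_within_open[OF _ open_greaterThanLessThan t]) (use eq in auto)
  then have vc: "vector_derivative c (at t) = ?v" by (rule vector_derivative_at)
  define z where "z s = c' (1 * s + t)" for s
  define S where "S = (\<lambda>s. 1 * s + t) -` {a<..<b}"
  have sm: "smooth_on UNIV (\<lambda>s. 1 * s + t)" by (rule smooth_on_affine) simp
  have S: "open S" unfolding S_def by (rule open_vimage[OF open_greaterThanLessThan smooth_on_continuous[OF sm]])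
  have "smooth_on S z"
    unfolding z_def[abs_def]
    by (rule smooth_on_compose[OF S T(1) smooth_on_subset[OF sm] T(2)]) (use T(3) in \<open>auto simp: S_def\<close>)
  moreover have "z ` S \<subseteq> oriented_grassmannian"
  proof
    fix P assume "P \<in> z ` S"
    then obtain s where "P = c' (s + t)" "s + t \<in> {a..b}" by (auto simp: z_def S_def)
    then show "P \<in> oriented_grassmannian" using eq[of "s + t"] G by auto
  qed
  moreover have "0 \<in> S" using t by (simp add: S_def)
  ultimately have "metric_c (z 0) (vector_derivative z (at 0)) = (norm (vector_derivative z (at 0)))\<^sup>2 / fact CARD('m)"
    using S by (intro metric_c_velocity) auto
  moreover have "vector_derivative z (at 0) = ?v"
  proof (rule vector_derivative_at)
    have "((\<lambda>s. 1 * s + t) has_vector_derivative 1) (at 0)" by (auto intro!: derivative_eq_intros)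
    from vector_diff_chain_at[OF this, of c' ?v] d show "(z has_vector_derivative ?v) (at 0)"
      by (simp add: z_def[abs_def] o_def)
  qed
  moreover have "z 0 = c t" using eq[of t] t by (simp add: z_def)
  ultimately show ?thesis by (simp add: speed_c_def vc real_sqrt_divide)
qed

lemma gauss_curve_piece:
  fixes f :: "'p::{second_countable_topology, t2_space} \<Rightarrow> real^'k::finite" and A :: "('p, 'm::finite) atlas"
  assumes M: "oriented_smooth_manifold M A" and f: "immersion A f" and gm: "immersion A \<gamma>"
    and G: "\<gamma> ` M \<subseteq> (oriented_grassmannian :: (real, 'm \<Rightarrow> 'k) vec set)"
    and h: "homeomorphism M (\<gamma> ` M) \<gamma> h" and \<kappa>: "\<kappa> > 0"
    and expand: "\<forall>(V, x)\<in>A. \<forall>u\<in>V. \<forall>v.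
      \<kappa> * norm (fderiv (f \<circ> x) u v) \<le> norm (fderiv (\<gamma> \<circ> x) u v) / sqrt (fact CARD('m))"
    and c: "smooth_curve_in (\<gamma> ` M) c a b" and ab: "a < b"
  shows "speed_c c integrable_on {a..b}"
    and "\<exists>L. immersed_manifold.reach M A f (h (c a)) (h (c b)) L \<and> \<kappa> * L \<le> integral {a..b} (speed_c c)"
proof -
  interpret immersed_manifold M A f by (rule immersed_manifold.intro) (fact M f)+
  define q where "q = sqrt (fact CARD('m) :: real)"
  have q: "q > 0" by (simp add: q_def)
  obtain T c' where T: "open T" "{a..b} \<subseteq> T" "smooth_on T c'" "\<forall>t\<in>{a..b}. c' t = c t" and im: "c ` {a..b} \<subseteq> \<gamma> ` M"
    using c unfolding smooth_curve_in_def by blast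
  define sp where "sp t = norm (fderiv c' t 1)" for t
  have "continuous_on {a..b} sp" unfolding sp_def[abs_def]
    by (intro continuous_intros continuous_on_subset[OF smooth_on_continuous[OF smooth_on_derivative[OF T(3)]] T(2)])
  then have "(sp has_integral integral {a..b} sp) {a..b}"
    using integrable_continuous_real integrable_integral by blast
  then have "((\<lambda>t. sp t * inverse q) has_integral integral {a..b} sp * inverse q) {a..b}"
    by (rule has_integral_mult_left)
  moreover have "speed_c c t = sp t * inverse q" if "t \<in> {a<..<b}" for t
    using speed_c_eq[OF T(1,3,2) _ order_trans[OF im G] that] T(4) by (simp add: sp_def q_def divide_inverse)
  ultimately have I: "(speed_c c has_integral integral {a..b} sp * inverse q) {a..b}"
    using has_integral_spike_interior[of "\<lambda>t. sp t * inverse q" _ a b "speed_c c"] by (simp add: box_real)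
  then show "speed_c c integrable_on {a..b}" by blast
  have "c' ` {a..b} \<subseteq> \<gamma> ` M" using im T(4) by auto
  moreover have "\<forall>(V, x)\<in>A. \<forall>u\<in>V. \<forall>v.
      (\<kappa> * q) * norm (fderiv (f \<circ> x) u v) \<le> norm (fderiv (\<gamma> \<circ> x) u v)"
    using expand q by (simp add: q_def[symmetric] pos_le_divide_eq mult_ac)
  ultimately obtain L where L: "reach (h (c' a)) (h (c' b)) L" "(\<kappa> * q) * L \<le> integral {a..b} sp"
    using pull_back_curve[OF gm h _ _ T(1,3,2) less_imp_le[OF ab], of "\<kappa> * q"] \<kappa> q unfolding sp_def[abs_def] by auto
  have "\<kappa> * L = (\<kappa> * q) * L * inverse q" using q by simp
  also have "\<dots> \<le> integral {a..b} sp * inverse q" using q by (intro mult_right_mono L(2)) simp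
  finally have "\<kappa> * L \<le> integral {a..b} sp * inverse q" .
  then show "\<exists>L. reach (h (c a)) (h (c b)) L \<and> \<kappa> * L \<le> integral {a..b} (speed_c c)"
    using L(1) T(4) ab integral_unique[OF I] by auto
qed

text \<open>The length comparison passes from the smooth pieces of a curve to the whole curve because the
  lifts of consecutive pieces have matching end points: both are preimages of the same point under
  the injective map \<open>\<gamma>\<close>.\<close>

lemma gauss_curve:
  fixes f :: "'p::{second_countable_topology, t2_space} \<Rightarrow> real^'k::finite" and A :: "('p, 'm::finite) atlas"
  assumes M: "oriented_smooth_manifold M A" and f: "immersion A f" and gm: "immersion A \<gamma>"
    and G: "\<gamma> ` M \<subseteq> (oriented_grassmannian :: (real, 'm \<Rightarrow> 'k) vec set)"
    and h: "homeomorphism M (\<gamma> ` M) \<gamma> h" and \<kappa>: "\<kappa> > 0"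
    and expand: "\<forall>(V, x)\<in>A. \<forall>u\<in>V. \<forall>v.
      \<kappa> * norm (fderiv (f \<circ> x) u v) \<le> norm (fderiv (\<gamma> \<circ> x) u v) / sqrt (fact CARD('m))"
    and c: "piecewise (smooth_curve_in (\<gamma> ` M) c)"
  shows "\<exists>L. immersed_manifold.reach M A f (h (c 0)) (h (c 1)) L \<and> \<kappa> * L \<le> length_c c"
proof -
  interpret immersed_manifold M A f by (rule immersed_manifold.intro) (fact M f)+
  note piece = gauss_curve_piece[OF M f gm G h \<kappa> expand]
  obtain n :: nat and \<tau> where \<tau>: "\<tau> 0 = 0" "\<tau> n = 1"
    "\<And>i. i < n \<Longrightarrow> \<tau> i < \<tau> (Suc i) \<and> smooth_curve_in (\<gamma> ` M) c (\<tau> i) (\<tau> (Suc i))"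
    using c unfolding piecewise_def by auto
  have n: "n > 0" using \<tau>(1,2) by (cases n) auto
  have "0 \<le> \<tau> i \<and> speed_c c integrable_on {0..\<tau> i} \<and>
      (\<exists>L. reach (h (c 0)) (h (c (\<tau> i))) L \<and> \<kappa> * L \<le> integral {0..\<tau> i} (speed_c c))" if "i \<le> n" for i
    using that
  proof (induction i)
    case 0
    have "c 0 \<in> \<gamma> ` M" using \<tau>(3)[OF n] \<tau>(1) unfolding smooth_curve_in_def by auto
    then have "h (c 0) \<in> M" using h by (auto simp: homeomorphism_def)
    then show ?case using \<tau>(1) reach.refl integrable_on_refl[of "speed_c c" 0] by (auto intro!: exI[of _ 0])
  next
    case (Suc i)
    have i: "\<tau> i < \<tau> (Suc i)" "smooth_curve_in (\<gamma> ` M) c (\<tau> i) (\<tau> (Suc i))" using \<tau>(3)[of i] Suc.prems by auto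
    have IH: "0 \<le> \<tau> i" "speed_c c integrable_on {0..\<tau> i}" using Suc by auto
    obtain L where L: "reach (h (c 0)) (h (c (\<tau> i))) L" "\<kappa> * L \<le> integral {0..\<tau> i} (speed_c c)" using Suc by auto
    obtain L' where L': "reach (h (c (\<tau> i))) (h (c (\<tau> (Suc i)))) L'" "\<kappa> * L' \<le> integral {\<tau> i..\<tau> (Suc i)} (speed_c c)"
      using piece(2)[OF i(2,1)] by auto
    have int: "speed_c c integrable_on {0..\<tau> (Suc i)}"
      by (rule Henstock_Kurzweil_Integration.integrable_combine[OF IH(1) less_imp_le[OF i(1)] IH(2)])
        (rule piece(1)[OF i(2,1)])
    have "integral {0..\<tau> i} (speed_c c) + integral {\<tau> i..\<tau> (Suc i)} (speed_c c) = integral {0..\<tau> (Suc i)} (speed_c c)"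
      using IH(1) i(1) int by (intro Henstock_Kurzweil_Integration.integral_combine) auto
    then show ?case
      using reach_trans[OF L'(1) L(1)] L(2) L'(2) IH(1) i(1) int
      by (auto simp: distrib_left intro!: exI[of _ "L + L'"])
  qed
  from this[of n] show ?thesis
    using \<tau>(2) unfolding length_c_def speed_c_def[symmetric] by simp
qed

theorem theoremA:
  fixes M :: "'p::{second_countable_topology, t2_space} set"
    and A :: "('p, 'm::finite) atlas"
    and f :: "'p \<Rightarrow> real^'k::finite"
  assumes "oriented_smooth_manifold M A"
    and "M \<noteq> {}"
    and "immersion A f"
    and "complete_submanifold M A f"
    and "minimal_submanifold A f"
    and "bounded_embedding M A (gauss_map A f)"
  shows "(\<forall>p\<in>M. \<forall>X\<in>tangent_space A f p. X \<noteq> 0 \<longrightarrow> Ric A f p X X < 0) \<and>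
    Sup {ereal (Ric A f p X X) | p X. p \<in> M \<and> X \<in> tangent_space A f p \<and> norm X = 1} = 0"
proof -
  note M = assms(1) and ne = assms(2) and f = assms(3) and complete = assms(4) and minimal = assms(5)
  interpret immersed_manifold M A f by (rule immersed_manifold.intro) (fact M f)+
  define \<gamma> where "\<gamma> = gauss_map A f"
  obtain h C where G: "\<gamma> ` M \<subseteq> oriented_grassmannian" and gm: "immersion A \<gamma>"
    and h: "homeomorphism M (\<gamma> ` M) \<gamma> h"
    and C: "\<And>P Q. P \<in> \<gamma> ` M \<Longrightarrow> Q \<in> \<gamma> ` M \<Longrightarrow> dist_c_on (\<gamma> ` M) P Q \<le> ereal C"
    using assms(6) unfolding bounded_embedding_def smooth_embedding_def \<gamma>_def by blast
  note ric = Ric_eq[OF M f gm[unfolded \<gamma>_def] minimal, folded \<gamma>_def]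
  have neg: "Ric A f p X X < 0" if p: "p \<in> M" "X \<in> tangent_space A f p" "X \<noteq> 0" for p X
  proof -
    obtain V x u v where x: "(V, x) \<in> A" "u \<in> V" "x u = p" "fderiv (f \<circ> x) u v = X"
      using p(2) by (auto simp: tangent_space_def)
    have lf: "linear (fderiv (f \<circ> x) u)" and lg: "linear (fderiv (\<gamma> \<circ> x) u)"
      using x(2) by (auto intro: smooth_on_linear_derivative immersionD(1)[OF f x(1)] immersionD(1)[OF gm x(1)])
    have "v \<noteq> 0" using x(4) p(3) linear_0[OF lf] by auto
    then have "fderiv (\<gamma> \<circ> x) u v \<noteq> 0"
      using immersionD(2)[OF gm x(1,2)] lg by (metis linear_injective_0)
    then show ?thesis using ric[OF x(1,2,4)] x(3) by (simp add: divide_less_0_iff)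
  qed
  let ?S = "{ereal (Ric A f p X X) | p X. p \<in> M \<and> X \<in> tangent_space A f p \<and> norm X = 1}"
  have upper: "Sup ?S \<le> 0"
  proof (rule Sup_least)
    fix r assume "r \<in> ?S"
    then obtain p X where r: "r = ereal (Ric A f p X X)" "p \<in> M" "X \<in> tangent_space A f p" "norm X = 1" by blast
    then have "X \<noteq> 0" by auto
    then have "Ric A f p X X < 0" using neg r(2,3) by blast
    then show "r \<le> 0" using r(1) by simp
  qed
  moreover have "\<not> Sup ?S < 0"
  proof
    assume "Sup ?S < 0"
    then obtain r where r: "Sup ?S < ereal r" "ereal r < 0" using ereal_dense2 by blast
    define \<epsilon> where "\<epsilon> = - r"
    have \<epsilon>: "\<epsilon> > 0" using r(2) by (simp add: \<epsilon>_def)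
    have Ric_le: "Ric A f p X X \<le> - \<epsilon>" if "p \<in> M" "X \<in> tangent_space A f p" "norm X = 1" for p X
    proof -
      have "ereal (Ric A f p X X) \<le> Sup ?S" using that by (intro Sup_upper) blast
      then have "ereal (Ric A f p X X) < ereal r" using r(1) by (rule order_le_less_trans)
      then show ?thesis by (simp add: \<epsilon>_def)
    qed
    define \<kappa> where "\<kappa> = sqrt \<epsilon>"
    have \<kappa>: "\<kappa> > 0" using \<epsilon> by (simp add: \<kappa>_def)
    have expand': "\<kappa> * norm (fderiv (f \<circ> x) u v) \<le> norm (fderiv (\<gamma> \<circ> x) u v) / sqrt (fact CARD('m))"
      if x: "(V, x) \<in> A" "u \<in> V" for V x u v
    proof (cases "fderiv (f \<circ> x) u v = 0")
      case False
      let ?X = "fderiv (f \<circ> x) u v" and ?Y = "fderiv (\<gamma> \<circ> x) u v"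
      have lf: "linear (fderiv (f \<circ> x) u)" and lg: "linear (fderiv (\<gamma> \<circ> x) u)"
        using x(2) by (auto intro: smooth_on_linear_derivative immersionD(1)[OF f x(1)] immersionD(1)[OF gm x(1)])
      \<comment> \<open>the supremum concerns unit tangent vectors\<close>
      define w where "w = v /\<^sub>R norm ?X"
      have X: "fderiv (f \<circ> x) u w = ?X /\<^sub>R norm ?X" "fderiv (\<gamma> \<circ> x) u w = ?Y /\<^sub>R norm ?X"
        unfolding w_def by (rule linear_scale[OF lf], rule linear_scale[OF lg])
      have "x u \<in> M" using chartD(5)[OF M x(1)] x(2) by auto
      moreover have "fderiv (f \<circ> x) u w \<in> tangent_space A f (x u)"
        unfolding tangent_space_def by (intro CollectI bexI[OF _ x(1)]) (use x(2) in auto)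
      moreover have "norm (fderiv (f \<circ> x) u w) = 1" using False by (simp add: X(1))
      ultimately have "- (norm (fderiv (\<gamma> \<circ> x) u w))\<^sup>2 / fact CARD('m) \<le> - \<epsilon>"
        using Ric_le ric[OF x HOL.refl, of w] by metis
      then have "\<epsilon> \<le> (norm ?Y / sqrt (fact CARD('m)) / norm ?X)\<^sup>2"
        by (simp add: X(2) power_divide power_mult_distrib divide_inverse mult_ac power_inverse)
      then have "\<kappa> \<le> norm ?Y / sqrt (fact CARD('m)) / norm ?X"
        unfolding \<kappa>_def by (intro real_le_lsqrt) auto
      then show ?thesis using False by (simp add: pos_le_divide_eq mult_ac)
    qed (simp add: divide_nonneg_nonneg)
    then have expand: "\<forall>(V, x)\<in>A. \<forall>u\<in>V. \<forall>v.
        \<kappa> * norm (fderiv (f \<circ> x) u v) \<le> norm (fderiv (\<gamma> \<circ> x) u v) / sqrt (fact CARD('m))"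
      by (intro ballI) (auto intro: expand')
    have "\<exists>L<(C + 1) / \<kappa>. reach p q L" if pq: "p \<in> M" "q \<in> M" for p q
    proof -
      have "dist_c_on (\<gamma> ` M) (\<gamma> p) (\<gamma> q) < ereal (C + 1)"
        by (rule order_le_less_trans[OF C]) (use pq in auto)
      then obtain c where c: "piecewise (smooth_curve_in (\<gamma> ` M) c)" "c 0 = \<gamma> p" "c 1 = \<gamma> q" "length_c c < C + 1"
        unfolding dist_c_on_def Inf_less_iff by auto
      obtain L where L: "reach (h (c 0)) (h (c 1)) L" "\<kappa> * L \<le> length_c c"
        using gauss_curve[OF M f gm G h \<kappa> expand c(1)] by blast
      have "h (c 0) = p" "h (c 1) = q" using c(2,3) h pq by (auto simp: homeomorphism_def)
      moreover have "L < (C + 1) / \<kappa>" using L(2) c(4) \<kappa> by (simp add: pos_less_divide_eq mult.commute)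
      ultimately show ?thesis using L(1) by auto
    qed
    then have "compact M" using compact_if_complete_bounded[OF complete ne] by blast
    then show False using minimal_submanifold_not_compact[OF M f minimal ne] by blast
  qed
  ultimately have "Sup ?S = 0" by (meson antisym_conv2 not_le order_le_less)
  then show ?thesis using neg by blast
qed

end
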